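(* Let $1<p<\infty$ and let $\Omega\subset\mathbb{R}^n$ be non-empty and open. (i) If $\mathbb{R}^n\setminus\Omega$ has non-empty interior, then $\partial\Omega$ is not $(s,p)$-null for $s<-1/p'$. (In particular this holds if $\Omega\neq\mathbb{R}^n$ is $C^0$.) (ii) If $\Omega$ is $C^0$ and $s\geq 0$, then $\partial\Omega$ is $(s,p)$-null. (iii) If $\Omega$ is $C^{0,\alpha}$ for some $0<\alpha<1$ and $s>-\alpha/p'$, then $\partial\Omega$ is $(s,p)$-null. (iv) If $\Omega$ is Lipschitz, then $\partial\Omega$ is $(s,p)$-null if and only if $s\geq -1/p'$.
   Context: $p'=p/(p-1)$. For $s\in\mathbb{R}$, $H^{s,p}=H^{s,p}(\mathbb{R}^n)$ is the Bessel potential Sobolev space of tempered distributions $u$ with $\mathcal{F}^{-1}[(1+|\xi|^2)^{s/2}\mathcal{F}u]\in L^p(\mathbb{R}^n)$. A set $E$ is $(s,p)$-null if no non-zero element of $H^{s,p}$ has (distributional) support contained in $E$. A non-empty open set $\Omega\subset\mathbb{R}^n$ is $C^0$ (respectively $C^{0,\alpha}$, respectively Lipschitz) if its boundary can locally be represented, after a suitable rotation, as the graph of a $C^0$ (respectively $C^{0,\alpha}$, respectively Lipschitz) function from $\mathbb{R}^{n-1}$ to $\mathbb{R}$, with $\Omega$ lying locally only on one side of $\partial\Omega$. For $n=1$ all three notions mean that $\Omega$ is a countable union of open intervals whose closures are pairwise disjoint.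
   Formalization: For n=1 the intervals' endpoints must also have no limit point (the complement of a fat Cantor set otherwise refutes (ii) and the remark in (i)); in (iv) Ω≠R^n is assumed, since R^n has empty boundary, which is (s,p)-null for every s. *)

theory Defs
  imports "HOL-Analysis.Analysis"
begin

fun dder :: "'a::euclidean_space list \<Rightarrow> ('a \<Rightarrow> complex) \<Rightarrow> 'a \<Rightarrow> complex" where
  "dder [] f = f"
| "dder (v # vs) f = (\<lambda>x. frechet_derivative (dder vs f) (at x) v)"

definition smooth_fun :: "('a::euclidean_space \<Rightarrow> complex) \<Rightarrow> bool" where
  "smooth_fun f \<longleftrightarrow> (\<forall>vs x. dder vs f differentiable (at x))"

definition schwartz :: "('a::euclidean_space \<Rightarrow> complex) set" where
  "schwartz = {f. smooth_fun f \<and>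
      (\<forall>vs (k::nat). bounded (range (\<lambda>x. norm x ^ k * norm (dder vs f x))))}"

definition schwartz_seminorm :: "nat \<Rightarrow> ('a::euclidean_space \<Rightarrow> complex) \<Rightarrow> real" where
  "schwartz_seminorm N f =
     (SUP kvs \<in> {(k, vs). k \<le> N \<and> set vs \<subseteq> Basis \<and> length vs \<le> N}.
        SUP x. norm x ^ fst kvs * norm (dder (snd kvs) f x))"

text \<open>Tempered distributions: continuous linear functionals on the Schwartz space
  (only their values on Schwartz functions are relevant).\<close>
definition tempered :: "(('a::euclidean_space \<Rightarrow> complex) \<Rightarrow> complex) \<Rightarrow> bool" where
  "tempered u \<longleftrightarrow>
     (\<forall>f\<in>schwartz. \<forall>g\<in>schwartz. u (\<lambda>x. f x + g x) = u f + u g) \<and>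
     (\<forall>f\<in>schwartz. \<forall>c. u (\<lambda>x. c * f x) = c * u f) \<and>
     (\<exists>C N. \<forall>f\<in>schwartz. norm (u f) \<le> C * schwartz_seminorm N f)"

definition fourier :: "('a::euclidean_space \<Rightarrow> complex) \<Rightarrow> 'a \<Rightarrow> complex" where
  "fourier f = (\<lambda>\<xi>. integral\<^sup>L lebesgue (\<lambda>x. cis (- (x \<bullet> \<xi>)) * f x))"

definition inv_fourier :: "('a::euclidean_space \<Rightarrow> complex) \<Rightarrow> 'a \<Rightarrow> complex" where
  "inv_fourier f = (\<lambda>x. complex_of_real ((2 * pi) powr (- real DIM('a))) *
                         integral\<^sup>L lebesgue (\<lambda>\<xi>. cis (x \<bullet> \<xi>) * f \<xi>))"

text \<open>Bessel potential J^s u = F^{-1}[(1+|xi|^2)^{s/2} F u] for a tempered distribution u.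
  Using (F u)(phi) = u(F phi) and (F^{-1} u)(phi) = u(F^{-1} phi), we get
  (J^s u)(phi) = u (F [ (1+|xi|^2)^{s/2} F^{-1} phi ]).\<close>
definition bessel_potential :: "real \<Rightarrow> (('a::euclidean_space \<Rightarrow> complex) \<Rightarrow> complex)
                                  \<Rightarrow> ('a \<Rightarrow> complex) \<Rightarrow> complex" where
  "bessel_potential s u =
     (\<lambda>\<phi>. u (fourier (\<lambda>\<xi>. complex_of_real ((1 + (norm \<xi>)\<^sup>2) powr (s / 2)) * inv_fourier \<phi> \<xi>)))"

definition is_Lp_distribution :: "real \<Rightarrow> (('a::euclidean_space \<Rightarrow> complex) \<Rightarrow> complex) \<Rightarrow> bool" where
  "is_Lp_distribution p v \<longleftrightarrow>
     (\<exists>g. g \<in> borel_measurable lebesgue \<and> integrable lebesgue (\<lambda>x. norm (g x) powr p) \<and>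
          (\<forall>\<phi>\<in>schwartz. v \<phi> = integral\<^sup>L lebesgue (\<lambda>x. g x * \<phi> x)))"

definition in_Hsp :: "real \<Rightarrow> real \<Rightarrow> (('a::euclidean_space \<Rightarrow> complex) \<Rightarrow> complex) \<Rightarrow> bool" where
  "in_Hsp s p u \<longleftrightarrow> tempered u \<and> is_Lp_distribution p (bessel_potential s u)"

definition vanishes_on :: "(('a::euclidean_space \<Rightarrow> complex) \<Rightarrow> complex) \<Rightarrow> 'a set \<Rightarrow> bool" where
  "vanishes_on u U \<longleftrightarrow>
     (\<forall>\<phi>\<in>schwartz. compact (closure {x. \<phi> x \<noteq> 0}) \<and> closure {x. \<phi> x \<noteq> 0} \<subseteq> U \<longrightarrow> u \<phi> = 0)"

definition dist_support :: "(('a::euclidean_space \<Rightarrow> complex) \<Rightarrow> complex) \<Rightarrow> 'a set" where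
  "dist_support u = - \<Union>{U. open U \<and> vanishes_on u U}"

definition sp_null :: "real \<Rightarrow> real \<Rightarrow> 'a::euclidean_space set \<Rightarrow> bool" where
  "sp_null s p E \<longleftrightarrow>
     (\<forall>u. in_Hsp s p u \<and> dist_support u \<subseteq> E \<longrightarrow> (\<forall>\<phi>\<in>schwartz. u \<phi> = 0))"

text \<open>Graph-type domains. After a rotation the last coordinate direction is the unit
  vector e and R^{n-1} is identified (isometrically) with the hyperplane e-perp; the graph
  function f is considered on that hyperplane. P is the regularity class of f.\<close>
definition graph_domain :: "(('a::euclidean_space \<Rightarrow> real) \<Rightarrow> 'a set \<Rightarrow> bool) \<Rightarrow> 'a set \<Rightarrow> bool" where
  "graph_domain P \<Omega> \<longleftrightarrow> \<Omega> \<noteq> {} \<and> open \<Omega> \<and>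
     (\<forall>x\<in>frontier \<Omega>. \<exists>e U f. norm e = 1 \<and> open U \<and> x \<in> U \<and>
         P f {y. y \<bullet> e = 0} \<and>
         \<Omega> \<inter> U = {y \<in> U. y \<bullet> e < f (y - (y \<bullet> e) *\<^sub>R e)})"

definition C0_domain :: "'a::euclidean_space set \<Rightarrow> bool" where
  "C0_domain = graph_domain (\<lambda>f H. continuous_on H f)"

definition holder_on :: "real \<Rightarrow> ('a::euclidean_space \<Rightarrow> real) \<Rightarrow> 'a set \<Rightarrow> bool" where
  "holder_on \<alpha> f H \<longleftrightarrow> (\<exists>C. \<forall>a\<in>H. \<forall>b\<in>H. \<bar>f a - f b\<bar> \<le> C * norm (a - b) powr \<alpha>)"

definition C0alpha_domain :: "real \<Rightarrow> 'a::euclidean_space set \<Rightarrow> bool" where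
  "C0alpha_domain \<alpha> = graph_domain (holder_on \<alpha>)"

definition lipschitz_domain :: "'a::euclidean_space set \<Rightarrow> bool" where
  "lipschitz_domain = graph_domain (holder_on 1)"

definition conj_exp :: "real \<Rightarrow> real" where
  "conj_exp p = p / (p - 1)"

end

theory Submission
  imports Defs "HOL-Probability.Probability"
begin

text \<open>Write \<open>\<sigma> = - s\<close>, \<open>q = p'\<close> and \<open>J\<^sup>\<sigma>\<close> for the Bessel potential. An element \<open>u\<close> of \<open>H\<^sup>s\<^sup>,\<^sup>p\<close> is
  \<open>u \<psi> = \<integral> g (J\<^sup>\<sigma> \<psi>)\<close> for some \<open>g\<close> in \<open>L\<^sup>p\<close>, and \<open>J\<^sup>\<sigma>\<close> is subordinate to the heat semigroup: up to a
  constant it is \<open>\<integral> t\<^bsup>-\<sigma>/2-1\<^esup> (\<psi> - e\<^bsup>-t\<^esup> P\<^sub>t \<psi>) dt\<close> for \<open>0 < \<sigma> < 2\<close> and \<open>\<integral> t\<^bsup>-\<sigma>/2-1\<^esup> e\<^bsup>-t\<^esup> P\<^sub>t \<psi> dt\<close> for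
  \<open>\<sigma> < 0\<close>, where \<open>P\<^sub>t\<close> is a Gaussian average. So no multiplier theorem is needed.

  If \<open>u\<close> is supported in the boundary, then \<open>\<psi>\<close> may be multiplied by a cutoff living in its
  \<open>\<epsilon>\<close>-neighbourhood, which near a graph of class \<open>C\<^bsup>0,\<alpha>\<^esup>\<close> has measure at most \<open>M = C \<epsilon>\<^sup>\<alpha>\<close>. The formula gives
  \<open>\<bar>u \<psi>\<bar> \<le> C \<epsilon>\<^bsup>-\<sigma>\<^esup> sup \<integral>\<^sub>N \<bar>g\<bar>\<close> over sets \<open>N\<close> of measure at most \<open>M\<close>, and the supremum is
  \<open>o(M\<^bsup>1/q\<^esup>)\<close>; therefore \<open>u = 0\<close> as soon as \<open>\<sigma> \<le> \<alpha>/q\<close>, the endpoint included.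

  Conversely, push Lebesgue measure on a ball in the domain forward under the first exit map along
  segments that end in a ball of the exterior. The image \<open>\<mu>\<close> lives on the boundary, and its heat
  extension is bounded by \<open>C t\<^bsup>-1/2\<^esup>\<close> because the projection of \<open>\<mu>\<close> along the segments is bounded
  by a multiple of Lebesgue measure of dimension \<open>n - 1\<close>. Interpolating with the bound of the \<open>L\<^sup>1\<close> norm shows that \<open>J\<^bsup>-\<sigma>\<^esup> \<mu>\<close> is in
  \<open>L\<^sup>p\<close> when \<open>\<sigma> > 1/q\<close>.\<close>

section \<open>Schwartz functions and slowly increasing multipliers\<close>

text \<open>The Gaussian averages enter through two properties only: they are positive, and they are
  averages of translates. A bound for the integral of \<open>G\<close> against every translate of a
  weight \<open>W\<close> therefore survives the averaging. This is why the supremum ranges over all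
  sets of measure at most \<open>M\<close>: the translates of the neighbourhood are such sets, and
  nothing finer is known about them. A cutoff at scale \<epsilon> has Lipschitz constant of order
  1/\<epsilon>, so \<psi> - P_t \<psi> is controlled by min (1, sqrt t / \<epsilon>). Rescaling t by
  \<epsilon>^2 yields the factor \<epsilon>^(-\<sigma>), and convergence at t = 0 requires \<sigma>
  < 1; the range \<sigma> <= \<alpha>/q stays inside because \<alpha> <= 1 < q. In the converse the
  exponent 1/q arises from the heat extension of \<mu>: it is at most C t^(-1/2) pointwise and has
  constant mass, so its L^p norm is at most C t^(-1/(2q)), which is integrable near 0 against
  t^(\<sigma>/2 - 1) exactly when \<sigma> > 1/q.\<close>

abbreviation ddir :: "'a::euclidean_space \<Rightarrow> ('a \<Rightarrow> complex) \<Rightarrow> 'a \<Rightarrow> complex" where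
  "ddir v f \<equiv> (\<lambda>x. frechet_derivative f (at x) v)"

lemma ddir_eqI:
  assumes "\<And>x. (f has_derivative F x) (at x)"
  shows "ddir v f = (\<lambda>x. F x v)"
  using frechet_derivative_at[OF assms] by metis

lemma dder_append: "dder (vs @ ws) f = dder vs (dder ws f)"
  by (induction vs) auto

lemma dder_closed:
  assumes "f \<in> X" and "\<And>f v. f \<in> X \<Longrightarrow> ddir v f \<in> X"
  shows "dder vs f \<in> X"
  using assms by (induction vs) auto

text \<open>Smoothness is proved by coinduction: it suffices to exhibit a class of functions that
  is closed under directional derivatives.\<close>

lemma schwartz_coinduct:
  assumes "f \<in> X" and "\<And>f x. f \<in> X \<Longrightarrow> f differentiable (at x)"
    and "\<And>f v. f \<in> X \<Longrightarrow> ddir v f \<in> X"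
    and "\<And>f k. f \<in> X \<Longrightarrow> bounded (range (\<lambda>x. norm x ^ k * norm (f x)))"
  shows "f \<in> schwartz"
  using assms dder_closed[OF assms(1,3)] by (auto simp: schwartz_def smooth_fun_def)

lemma schwartz_differentiable: "f \<in> schwartz \<Longrightarrow> f differentiable (at x)"
  unfolding schwartz_def smooth_fun_def by (metis (mono_tags, lifting) dder.simps(1) mem_Collect_eq)

lemma schwartz_has_derivative:
  "f \<in> schwartz \<Longrightarrow> (f has_derivative (\<lambda>v. ddir v f x)) (at x)"
  using schwartz_differentiable frechet_derivative_works by fastforce

lemma schwartz_continuous: "f \<in> schwartz \<Longrightarrow> continuous_on A f"
  using schwartz_differentiable
  by (metis continuous_at_imp_continuous_on differentiable_imp_continuous_within)

lemma schwartz_borel [measurable_dest]: "f \<in> schwartz \<Longrightarrow> f \<in> borel_measurable borel"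
  using borel_measurable_continuous_onI schwartz_continuous by blast

lemma schwartz_ddir: "f \<in> schwartz \<Longrightarrow> ddir v f \<in> schwartz"
proof -
  assume f: "f \<in> schwartz"
  have eq: "dder vs (ddir v f) = dder (vs @ [v]) f" for vs
    by (simp add: dder_append)
  show ?thesis
    using f unfolding schwartz_def smooth_fun_def mem_Collect_eq eq by blast
qed

lemma le_one_plus_square: "(t::real) \<le> 1 + t\<^sup>2"
proof -
  have "2 * t \<le> t\<^sup>2 + 1" using zero_le_power2[of "t - 1"] by (auto simp: power2_diff)
  thus ?thesis using zero_le_power2[of t] by linarith
qed

text \<open>The powers of 1 + |x|^2 are at least 1 and grow with the exponent, which the powers of
  |x| in \<open>schwartz\<close> do not; on the Fourier side they are the symbols of the powers of 1
  minus the Laplacian.\<close>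

lemma bounded_range_decay_iff:
  fixes f :: "'a::real_normed_vector \<Rightarrow> complex"
  shows "(\<forall>k. bounded (range (\<lambda>x. norm x ^ k * norm (f x)))) \<longleftrightarrow>
     (\<forall>N. \<exists>C. \<forall>x. (1 + (norm x)\<^sup>2) ^ N * norm (f x) \<le> C)"
proof safe
  fix N assume b: "\<forall>k. bounded (range (\<lambda>x. norm x ^ k * norm (f x)))"
  from b obtain A where A: "norm x ^ 0 * norm (f x) \<le> A" for x
    using b[rule_format, of 0] unfolding bounded_iff by auto
  from b obtain B where B: "norm x ^ (2*N) * norm (f x) \<le> B" for x
    using b[rule_format, of "2*N"] unfolding bounded_iff by (auto simp: abs_mult)
  have "(1 + (norm x)\<^sup>2) ^ N * norm (f x) \<le> 2 ^ N * (A + B)" for x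
  proof -
    have "1 + (norm x)\<^sup>2 \<le> 2 * max 1 ((norm x)\<^sup>2)" by auto
    hence "(1 + (norm x)\<^sup>2) ^ N \<le> (2 * max 1 ((norm x)\<^sup>2)) ^ N"
      by (intro power_mono) auto
    also have "\<dots> = 2 ^ N * (max 1 ((norm x)\<^sup>2)) ^ N" by (simp add: power_mult_distrib)
    also have "(max 1 ((norm x)\<^sup>2)) ^ N \<le> 1 + norm x ^ (2*N)"
      by (auto simp: max_def power_mult)
    finally have "(1 + (norm x)\<^sup>2) ^ N * norm (f x) \<le> 2 ^ N * (1 + norm x ^ (2*N)) * norm (f x)"
      by (intro mult_right_mono) auto
    also have "\<dots> = 2 ^ N * (norm x ^ 0 * norm (f x) + norm x ^ (2*N) * norm (f x))"
      by (simp add: algebra_simps)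
    also have "\<dots> \<le> 2 ^ N * (A + B)" by (intro mult_left_mono add_mono A B) auto
    finally show ?thesis .
  qed
  thus "\<exists>C. \<forall>x. (1 + (norm x)\<^sup>2) ^ N * norm (f x) \<le> C" by blast
next
  fix k assume "\<forall>N. \<exists>C. \<forall>x. (1 + (norm x)\<^sup>2) ^ N * norm (f x) \<le> C"
  then obtain C where C: "(1 + (norm x)\<^sup>2) ^ k * norm (f x) \<le> C" for x by blast
  have "norm x ^ k * norm (f x) \<le> C" for x
  proof -
    have "norm x \<le> 1 + (norm x)\<^sup>2" by (rule le_one_plus_square)
    hence "norm x ^ k \<le> (1 + (norm x)\<^sup>2) ^ k" by (intro power_mono) auto
    hence "norm x ^ k * norm (f x) \<le> (1 + (norm x)\<^sup>2) ^ k * norm (f x)" by (intro mult_right_mono) auto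
    with C[of x] show ?thesis by linarith
  qed
  thus "bounded (range (\<lambda>x. norm x ^ k * norm (f x)))"
    unfolding bounded_iff by (auto simp: abs_mult)
qed

lemma schwartz_decay:
  assumes "f \<in> schwartz"
  obtains C where "C > 0" "\<And>x. (1 + (norm x)\<^sup>2) ^ N * norm (f x) \<le> C"
proof -
  have "\<forall>vs k. bounded (range (\<lambda>x. norm x ^ k * norm (dder vs f x)))"
    using assms unfolding schwartz_def by blast
  from this[rule_format, of _ "[]"] have "\<forall>k. bounded (range (\<lambda>x. norm x ^ k * norm (f x)))"
    by simp
  then obtain C where C: "\<And>x. (1 + (norm x)\<^sup>2) ^ N * norm (f x) \<le> C"
    unfolding bounded_range_decay_iff by blast
  show ?thesis by (rule that[of "max C 1"]) (use C in \<open>auto simp: le_max_iff_disj\<close>)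
qed

lemma schwartzI_decay:
  assumes "f \<in> X" and "\<And>f x. f \<in> X \<Longrightarrow> f differentiable (at x)"
    and "\<And>f v. f \<in> X \<Longrightarrow> ddir v f \<in> X"
    and "\<And>f N. f \<in> X \<Longrightarrow> \<exists>C. \<forall>x. (1 + (norm x)\<^sup>2) ^ N * norm (f x) \<le> C"
  shows "f \<in> schwartz"
  by (rule schwartz_coinduct[OF assms(1-3)]) (use assms(4) bounded_range_decay_iff in blast)+

section \<open>Multipliers of slow growth\<close>

definition slow_growth :: "('a::euclidean_space \<Rightarrow> complex) set" where
  "slow_growth = {g. smooth_fun g \<and>
      (\<forall>vs. \<exists>C N. \<forall>x. norm (dder vs g x) \<le> C * (1 + (norm x)\<^sup>2) ^ N)}"

lemma slow_growthI:
  assumes "f \<in> X" and "\<And>f x. f \<in> X \<Longrightarrow> f differentiable (at x)"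
    and "\<And>f v. f \<in> X \<Longrightarrow> ddir v f \<in> X"
    and "\<And>f. f \<in> X \<Longrightarrow> \<exists>C N. \<forall>x. norm (f x) \<le> C * (1 + (norm x)\<^sup>2) ^ N"
  shows "f \<in> slow_growth"
  using assms dder_closed[OF assms(1,3)] by (auto simp: slow_growth_def smooth_fun_def)

lemma slow_growth_differentiable: "f \<in> slow_growth \<Longrightarrow> f differentiable (at x)"
  unfolding slow_growth_def smooth_fun_def
  by (metis (mono_tags, lifting) dder.simps(1) mem_Collect_eq)

lemma slow_growth_has_derivative:
  "f \<in> slow_growth \<Longrightarrow> (f has_derivative (\<lambda>v. ddir v f x)) (at x)"
  using slow_growth_differentiable frechet_derivative_works by fastforce

lemma slow_growth_ddir: "f \<in> slow_growth \<Longrightarrow> ddir v f \<in> slow_growth"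
proof -
  assume f: "f \<in> slow_growth"
  have eq: "dder vs (ddir v f) = dder (vs @ [v]) f" for vs
    by (simp add: dder_append)
  show ?thesis
    using f unfolding slow_growth_def smooth_fun_def mem_Collect_eq eq by blast
qed

lemma slow_growth_bound:
  assumes "f \<in> slow_growth"
  obtains C N where "C > 0" "\<And>x. norm (f x) \<le> C * (1 + (norm x)\<^sup>2) ^ N"
proof -
  have "\<forall>vs. \<exists>C N. \<forall>x. norm (dder vs f x) \<le> C * (1 + (norm x)\<^sup>2) ^ N"
    using assms unfolding slow_growth_def by blast
  from this[rule_format, of "[]"] obtain C N where C: "\<And>x. norm (f x) \<le> C * (1 + (norm x)\<^sup>2) ^ N"
    by auto
  show ?thesis
  proof (rule that[of "max C 1" N])
    fix x show "norm (f x) \<le> max C 1 * (1 + (norm x)\<^sup>2) ^ N"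
      by (rule order_trans[OF C]) (intro mult_right_mono, auto)
  qed auto
qed

text \<open>The class for \<open>schwartzI_decay\<close> when a multiplier acts: by the Leibniz rule
  the derivative of a product is a sum of two products, so closing the products under addition makes
  the class stable under \<open>ddir\<close>.\<close>

inductive_set slow_schwartz_span :: "('a::euclidean_space \<Rightarrow> complex) set" where
  mult: "g \<in> slow_growth \<Longrightarrow> f \<in> schwartz \<Longrightarrow> (\<lambda>x. g x * f x) \<in> slow_schwartz_span"
| add: "f \<in> slow_schwartz_span \<Longrightarrow> g \<in> slow_schwartz_span \<Longrightarrow>
        (\<lambda>x. f x + g x) \<in> slow_schwartz_span"

lemma decay_mult:
  fixes f g :: "'a::real_normed_vector \<Rightarrow> complex"
  assumes g: "\<And>x. norm (g x) \<le> C * (1 + (norm x)\<^sup>2) ^ M"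
    and f: "\<And>x. (1 + (norm x)\<^sup>2) ^ (N + M) * norm (f x) \<le> D" and "C > 0"
  shows "(1 + (norm x)\<^sup>2) ^ N * norm (g x * f x) \<le> C * D"
proof -
  have "(1 + (norm x)\<^sup>2) ^ N * norm (g x * f x) = ((1 + (norm x)\<^sup>2) ^ N * norm (f x)) * norm (g x)"
    by (simp add: norm_mult)
  also have "\<dots> \<le> ((1 + (norm x)\<^sup>2) ^ N * norm (f x)) * (C * (1 + (norm x)\<^sup>2) ^ M)"
    by (intro mult_left_mono g) auto
  also have "\<dots> = C * ((1 + (norm x)\<^sup>2) ^ (N + M) * norm (f x))" by (simp add: power_add)
  also have "\<dots> \<le> C * D" using f \<open>C > 0\<close> by (intro mult_left_mono) auto
  finally show ?thesis .
qed

lemma slow_schwartz_span_schwartz: "f \<in> slow_schwartz_span \<Longrightarrow> f \<in> schwartz"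
proof (rule schwartzI_decay[of f slow_schwartz_span])
  fix h :: "'a \<Rightarrow> complex" and x assume "h \<in> slow_schwartz_span"
  thus "h differentiable (at x)"
    by induction (auto intro!: differentiable_add differentiable_mult
        intro: slow_growth_differentiable schwartz_differentiable)
next
  fix h :: "'a \<Rightarrow> complex" and v assume h: "h \<in> slow_schwartz_span"
  \<comment> \<open>Differentiability is carried through the induction because
    \<open>frechet_derivative\<close> of a sum splits only when both summands are
    differentiable.\<close>
  have "h \<in> slow_schwartz_span \<and> (\<forall>x. h differentiable (at x)) \<and> ddir v h \<in> slow_schwartz_span"
    using h
  proof induction
    case (mult g f)
    have d: "((\<lambda>x. g x * f x) has_derivative (\<lambda>v. g x * ddir v f x + ddir v g x * f x)) (at x)" for x
      by (rule has_derivative_mult[OF slow_growth_has_derivative schwartz_has_derivative]) fact+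
    have "(\<lambda>x. g x * ddir v f x + ddir v g x * f x) \<in> slow_schwartz_span"
      by (intro slow_schwartz_span.intros slow_growth_ddir schwartz_ddir mult)
    thus ?case unfolding ddir_eqI[OF d] using d mult
      by (auto simp: differentiable_def intro: slow_schwartz_span.intros)
  next
    case (add f g)
    hence "((\<lambda>x. f x + g x) has_derivative (\<lambda>v. ddir v f x + ddir v g x)) (at x)" for x
      using frechet_derivative_works by (intro has_derivative_add) fastforce+
    note d = this
    have "(\<lambda>x. ddir v f x + ddir v g x) \<in> slow_schwartz_span"
      using add by (intro slow_schwartz_span.intros) auto
    thus ?case unfolding ddir_eqI[OF d] using d add
      by (auto simp: differentiable_def intro: slow_schwartz_span.intros)
  qed
  thus "ddir v h \<in> slow_schwartz_span" by blast
next
  fix h :: "'a \<Rightarrow> complex" and N assume "h \<in> slow_schwartz_span"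
  thus "\<exists>C. \<forall>x. (1 + (norm x)\<^sup>2) ^ N * norm (h x) \<le> C"
  proof induction
    case (mult g f)
    from slow_growth_bound[OF mult(1)] obtain C M
      where C: "C > 0" "\<And>x. norm (g x) \<le> C * (1 + (norm x)\<^sup>2) ^ M" by metis
    from schwartz_decay[OF mult(2)] obtain D
      where D: "\<And>x. (1 + (norm x)\<^sup>2) ^ (N + M) * norm (f x) \<le> D" by metis
    show ?case using decay_mult[OF C(2) D C(1)] by blast
  next
    case (add f g)
    then obtain C D where "\<forall>x. (1 + (norm x)\<^sup>2) ^ N * norm (f x) \<le> C"
      "\<forall>x. (1 + (norm x)\<^sup>2) ^ N * norm (g x) \<le> D" by blast
    moreover have "(1 + (norm x)\<^sup>2) ^ N * norm (f x + g x) \<le>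
      (1 + (norm x)\<^sup>2) ^ N * norm (f x) + (1 + (norm x)\<^sup>2) ^ N * norm (g x)" for x
      unfolding distrib_left[symmetric] by (intro mult_left_mono norm_triangle_ineq) auto
    ultimately show ?case by (meson add_mono order_trans)
  qed
qed

lemma schwartz_mult: "g \<in> slow_growth \<Longrightarrow> f \<in> schwartz \<Longrightarrow> (\<lambda>x. g x * f x) \<in> schwartz"
  by (rule slow_schwartz_span_schwartz[OF slow_schwartz_span.mult])

text \<open>Besides the Bessel weights this contains the linear forms, because differentiating the
  weight with exponent \<open>r\<close> along \<open>v\<close> gives 2 r (x . v) times the weight
  with exponent \<open>r - 1\<close>. The class is thus stable under derivatives, and no derivative
  of higher order is ever computed.\<close>

inductive_set symbols :: "('a::euclidean_space \<Rightarrow> complex) set" where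
  lin: "(\<lambda>x. complex_of_real (x \<bullet> v)) \<in> symbols"
| powr: "(\<lambda>x. complex_of_real ((1 + (norm x)\<^sup>2) powr r)) \<in> symbols"
| const: "(\<lambda>x. c) \<in> symbols"
| add: "f \<in> symbols \<Longrightarrow> g \<in> symbols \<Longrightarrow> (\<lambda>x. f x + g x) \<in> symbols"
| mult: "f \<in> symbols \<Longrightarrow> g \<in> symbols \<Longrightarrow> (\<lambda>x. f x * g x) \<in> symbols"

lemma has_derivative_bessel_symbol:
  fixes x :: "'a::euclidean_space"
  shows "((\<lambda>x. complex_of_real ((1 + (norm x)\<^sup>2) powr r)) has_derivative
     (\<lambda>v. complex_of_real (2 * r) * complex_of_real ((1 + (norm x)\<^sup>2) powr (r - 1)) * complex_of_real (x \<bullet> v))) (at x)"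
proof -
  have pos: "1 + x \<bullet> x > 0" for x :: 'a by (simp add: add_pos_nonneg)
  have "((\<lambda>x. complex_of_real ((1 + x \<bullet> x) powr r)) has_derivative
     (\<lambda>v. complex_of_real ((1 + x \<bullet> x) powr r * ((x \<bullet> v + v \<bullet> x) * r / (1 + x \<bullet> x))))) (at x)"
    by (rule derivative_eq_intros pos refl | simp)+
  moreover have "(1 + x \<bullet> x) powr (r - 1) = (1 + x \<bullet> x) powr r / (1 + x \<bullet> x)"
    using pos[of x] by (simp add: powr_diff)
  hence "(1 + x \<bullet> x) powr r * ((x \<bullet> v + v \<bullet> x) * r / (1 + x \<bullet> x)) =
     (2 * r) * (1 + x \<bullet> x) powr (r - 1) * (x \<bullet> v)" for v
    by (simp add: inner_commute)
  ultimately have "((\<lambda>x. complex_of_real ((1 + x \<bullet> x) powr r)) has_derivative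
     (\<lambda>v. complex_of_real ((2 * r) * (1 + x \<bullet> x) powr (r - 1) * (x \<bullet> v)))) (at x)"
    by (simp only:)
  thus ?thesis by (simp add: power2_norm_eq_inner)
qed

lemma symbols_has_derivative:
  assumes "h \<in> symbols"
  shows "\<exists>F. (\<forall>x. (h has_derivative F x) (at x)) \<and> (\<forall>v. (\<lambda>x. F x v) \<in> symbols)"
  using assms
proof induction
  case (lin w)
  show ?case
    by (intro exI[of _ "\<lambda>x v. complex_of_real (v \<bullet> w)"])
      (auto intro!: derivative_eq_intros symbols.intros)
next
  case (powr r)
  show ?case
    by (rule exI, rule conjI, rule allI, rule has_derivative_bessel_symbol) (intro allI symbols.intros)
next
  case (const c)
  show ?case by (intro exI[of _ "\<lambda>x v. 0"]) (auto intro: symbols.intros)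
next
  case (add f g)
  then obtain F G where "\<And>x. (f has_derivative F x) (at x)" "\<And>v. (\<lambda>x. F x v) \<in> symbols"
    "\<And>x. (g has_derivative G x) (at x)" "\<And>v. (\<lambda>x. G x v) \<in> symbols" by blast
  thus ?case
    by (intro exI[of _ "\<lambda>x v. F x v + G x v"]) (auto intro!: has_derivative_add symbols.intros)
next
  case (mult f g)
  then obtain F G where "\<And>x. (f has_derivative F x) (at x)" "\<And>v. (\<lambda>x. F x v) \<in> symbols"
    "\<And>x. (g has_derivative G x) (at x)" "\<And>v. (\<lambda>x. G x v) \<in> symbols" by blast
  thus ?case using mult
    by (intro exI[of _ "\<lambda>x v. f x * G x v + F x v * g x"]) (auto intro!: has_derivative_mult symbols.intros)
qed

lemma symbols_slow_growth: "f \<in> symbols \<Longrightarrow> f \<in> slow_growth"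
proof (rule slow_growthI[of f symbols])
  fix h :: "'a \<Rightarrow> complex" assume h: "h \<in> symbols"
  note * = symbols_has_derivative[OF h]
  show "h differentiable (at x)" for x using * unfolding differentiable_def by blast
  show "ddir v h \<in> symbols" for v using * ddir_eqI[of h _ v] by metis
  show "\<exists>C N. \<forall>x. norm (h x) \<le> C * (1 + (norm x)\<^sup>2) ^ N"
    using h
  proof induction
    case (lin v)
    have "norm (complex_of_real (x \<bullet> v)) \<le> norm v * (1 + (norm x)\<^sup>2) ^ 1" for x
    proof -
      have "\<bar>x \<bullet> v\<bar> \<le> norm x * norm v" by (rule Cauchy_Schwarz_ineq2)
      also have "norm x \<le> 1 + (norm x)\<^sup>2" by (rule le_one_plus_square)
      finally show ?thesis by (simp add: mult.commute mult_right_mono)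
    qed
    thus ?case by blast
  next
    case (powr r)
    have nonneg: "1 \<le> 1 + (norm x)\<^sup>2" for x :: 'a by simp
    \<comment> \<open>For negative \<open>r\<close> the natural exponent is 0, which suffices
      because the base is at least 1.\<close>
    have "norm (complex_of_real ((1 + (norm x)\<^sup>2) powr r)) \<le> 1 * (1 + (norm x)\<^sup>2) ^ nat \<lceil>r\<rceil>" for x :: 'a
    proof -
      have "(1 + (norm x)\<^sup>2) powr r \<le> (1 + (norm x)\<^sup>2) powr real (nat \<lceil>r\<rceil>)"
        by (intro powr_mono nonneg) linarith
      thus ?thesis by (simp add: powr_realpow add_pos_nonneg)
    qed
    thus ?case by blast
  next
    case (const c)
    show ?case by (intro exI[of _ "norm c"] exI[of _ 0]) auto
  next
    case (add f g)
    then obtain C N D M where C: "\<And>x. norm (f x) \<le> C * (1 + (norm x)\<^sup>2) ^ N"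
      and D: "\<And>x. norm (g x) \<le> D * (1 + (norm x)\<^sup>2) ^ M" by blast
    have "norm (f x + g x) \<le> (\<bar>C\<bar> + \<bar>D\<bar>) * (1 + (norm x)\<^sup>2) ^ (N + M)" for x
    proof -
      have "norm (f x + g x) \<le> C * (1 + (norm x)\<^sup>2) ^ N + D * (1 + (norm x)\<^sup>2) ^ M"
        using C[of x] D[of x] norm_triangle_ineq[of "f x" "g x"] by linarith
      also have "\<dots> \<le> \<bar>C\<bar> * (1 + (norm x)\<^sup>2) ^ (N + M) + \<bar>D\<bar> * (1 + (norm x)\<^sup>2) ^ (N + M)"
        by (intro add_mono mult_mono power_increasing) auto
      finally show ?thesis by (simp add: algebra_simps)
    qed
    thus ?case by blast
  next
    case (mult f g)
    then obtain C N D M where C: "\<And>x. norm (f x) \<le> C * (1 + (norm x)\<^sup>2) ^ N"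
      and D: "\<And>x. norm (g x) \<le> D * (1 + (norm x)\<^sup>2) ^ M" by blast
    have "norm (f x * g x) \<le> (C * D) * (1 + (norm x)\<^sup>2) ^ (N + M)" for x
    proof -
      have "norm (f x * g x) \<le> (C * (1 + (norm x)\<^sup>2) ^ N) * (D * (1 + (norm x)\<^sup>2) ^ M)"
        unfolding norm_mult by (intro mult_mono C D order_trans[OF norm_ge_zero C]) auto
      thus ?thesis by (simp add: power_add mult_ac)
    qed
    thus ?case by blast
  qed
qed

lemmas schwartz_symbol_mult = schwartz_mult[OF symbols_slow_growth]

lemma schwartz_cmult: "f \<in> schwartz \<Longrightarrow> (\<lambda>x. c * f x) \<in> schwartz"
  by (rule schwartz_symbol_mult[OF symbols.const])

lemma schwartz_add: "f \<in> schwartz \<Longrightarrow> g \<in> schwartz \<Longrightarrow> (\<lambda>x. f x + g x) \<in> schwartz"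
  using slow_schwartz_span_schwartz[OF slow_schwartz_span.add[OF
      slow_schwartz_span.mult[OF symbols_slow_growth[OF symbols.const[of 1]]]
      slow_schwartz_span.mult[OF symbols_slow_growth[OF symbols.const[of 1]]]]] by simp

lemma schwartz_diff: "f \<in> schwartz \<Longrightarrow> g \<in> schwartz \<Longrightarrow> (\<lambda>x. f x - g x) \<in> schwartz"
  using schwartz_add[OF _ schwartz_cmult[of g "-1"]] by simp

lemma schwartz_uminus_arg: "f \<in> schwartz \<Longrightarrow> (\<lambda>x. f (- x)) \<in> schwartz"
proof (rule schwartzI_decay[of _ "{\<lambda>x. f (- x) | f. f \<in> schwartz}"])
  have d: "((\<lambda>x. h (- x)) has_derivative (\<lambda>v. - ddir v h (- x))) (at x)"
    if h: "h \<in> schwartz" for h and x :: 'a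
  proof -
    have "((h \<circ> uminus) has_derivative (\<lambda>v. ddir v h (- x)) \<circ> uminus) (at x)"
      by (intro diff_chain_at) (auto intro!: derivative_eq_intros schwartz_has_derivative[OF h])
    moreover have "ddir (- v) h (- x) = - ddir v h (- x)" for v
      using linear_neg[OF has_derivative_linear[OF schwartz_has_derivative[OF h, of "- x"]]] by simp
    ultimately show ?thesis by (simp add: o_def)
  qed
  show "g differentiable at x" if "g \<in> {\<lambda>x. f (- x) | f. f \<in> schwartz}" for g and x :: 'a
    using that d unfolding differentiable_def by blast
  show "ddir v g \<in> {\<lambda>x. f (- x) | f. f \<in> schwartz}"
    if G: "g \<in> {\<lambda>x. f (- x) | f. f \<in> schwartz}" for g and v :: 'a
  proof -
    obtain h where h: "h \<in> schwartz" "g = (\<lambda>x. h (- x))" using G by blast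
    have "(\<lambda>x. - ddir v h x) \<in> schwartz" using schwartz_cmult[OF schwartz_ddir[OF h(1)], of "-1"] by simp
    thus ?thesis using h ddir_eqI[OF d[OF h(1)]] by auto
  qed
  show "\<exists>C. \<forall>x. (1 + (norm x)\<^sup>2) ^ N * norm (g x) \<le> C"
    if G: "g \<in> {\<lambda>x. f (- x) | f. f \<in> schwartz}" for g :: "'a \<Rightarrow> complex" and N
  proof -
    obtain h where h: "h \<in> schwartz" "g = (\<lambda>x. h (- x))" using G by blast
    from schwartz_decay[OF h(1), of N] obtain C where "\<And>x. (1 + (norm x)\<^sup>2) ^ N * norm (h x) \<le> C" by metis
    from this[of "- _"] show ?thesis unfolding h by auto
  qed
qed auto

section \<open>The Fourier transform on Schwartz functions\<close>

lemma nn_integral_affine: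
  fixes t :: "'a::euclidean_space"
  assumes [measurable]: "f \<in> borel_measurable borel" and "c \<noteq> 0"
  shows "(\<integral>\<^sup>+x. f x \<partial>lborel) = ennreal (\<bar>c\<bar> ^ DIM('a)) * (\<integral>\<^sup>+x. f (t + c *\<^sub>R x) \<partial>lborel)"
  by (subst lborel_affine[OF \<open>c \<noteq> 0\<close>, of t])
    (simp add: nn_integral_density nn_integral_distr nn_integral_cmult)

lemma lborel_integrable_affine:
  fixes f :: "'a::euclidean_space \<Rightarrow> 'b::{banach, second_countable_topology}"
  assumes f: "integrable lborel f" and "c \<noteq> 0"
  shows "integrable lborel (\<lambda>x. f (t + c *\<^sub>R x))"
  using f f[THEN borel_measurable_integrable] unfolding integrable_iff_bounded
  by (subst (asm) nn_integral_affine[OF _ \<open>c \<noteq> 0\<close>, of _ t]) (use \<open>c \<noteq> 0\<close> in \<open>auto simp: ennreal_mult_less_top\<close>)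

lemma lborel_integral_affine:
  fixes f :: "'a::euclidean_space \<Rightarrow> 'b::{banach, second_countable_topology}"
  assumes [measurable]: "f \<in> borel_measurable borel" and "c \<noteq> 0"
  shows "(\<integral>x. f x \<partial>lborel) = \<bar>c\<bar> ^ DIM('a) *\<^sub>R (\<integral>x. f (t + c *\<^sub>R x) \<partial>lborel)"
  by (subst lborel_affine[OF \<open>c \<noteq> 0\<close>, of t]) (simp add: integral_density integral_distr)

text \<open>The standard majorant: integrable, since each coordinate receives one factor, and
  comparable to its translates by vectors of length at most 1.\<close>

definition decay :: "'a::euclidean_space \<Rightarrow> real" where
  "decay x = inverse ((1 + (norm x)\<^sup>2) ^ DIM('a))"

lemma decay_pos: "0 < decay x" and decay_le_1: "decay x \<le> 1"
  by (auto simp: decay_def add_pos_nonneg zero_less_power intro!: inverse_le_1_iff[THEN iffD2] disjI2 one_le_power)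

lemma decay_borel [measurable]: "decay \<in> borel_measurable borel"
  unfolding decay_def[abs_def] by measurable

lemma nn_integral_inverse_one_plus_square: "(\<integral>\<^sup>+x. ennreal (inverse (1 + x\<^sup>2)) \<partial>lborel) < \<infinity>"
proof -
  have half: "(\<integral>\<^sup>+x. ennreal (inverse (1 + x\<^sup>2)) * indicator {0..} x \<partial>lborel) = ennreal (pi / 2 - arctan 0)"
  proof (rule nn_integral_FTC_atLeast)
    show "DERIV arctan x :> inverse (1 + x\<^sup>2)" for x by (rule DERIV_arctan)
  qed (auto intro: tendsto_arctan_at_top add_nonneg_nonneg)
  have "(\<integral>\<^sup>+x. ennreal (inverse (1 + x\<^sup>2)) * indicator {..0} x \<partial>lborel) =
      (\<integral>\<^sup>+x. ennreal (inverse (1 + x\<^sup>2)) * indicator {0..} x \<partial>lborel)"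
    by (subst nn_integral_real_affine[where c="-1" and t=0])
      (auto intro!: nn_integral_cong split: split_indicator)
  note half' = this[unfolded half]
  have "(\<integral>\<^sup>+x. ennreal (inverse (1 + x\<^sup>2)) \<partial>lborel) \<le>
    (\<integral>\<^sup>+x. ennreal (inverse (1 + x\<^sup>2)) * indicator {0..} x + ennreal (inverse (1 + x\<^sup>2)) * indicator {..0} x \<partial>lborel)"
    by (intro nn_integral_mono) (auto split: split_indicator)
  also have "\<dots> = ennreal (pi / 2 - arctan 0) + ennreal (pi / 2 - arctan 0)"
    by (subst nn_integral_add) (auto simp: half half')
  also have "\<dots> < \<infinity>" by simp
  finally show ?thesis .
qed

text \<open>Each of the n factors 1 + |x|^2 is at least 1 + x_b^2 for its own coordinate b, so the
  integral is bounded by a product of n arctangent integrals.\<close>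

lemma decay_integrable: "integrable lborel (decay :: 'a::euclidean_space \<Rightarrow> real)"
proof (rule integrableI_nonneg)
  have "(\<integral>\<^sup>+x. ennreal (decay (x::'a)) \<partial>lborel) \<le>
     (\<integral>\<^sup>+x. (\<Prod>b\<in>Basis. ennreal (inverse (1 + ((x::'a) \<bullet> b)\<^sup>2))) \<partial>lborel)"
  proof (intro nn_integral_mono)
    fix x :: 'a
    have "decay x = (\<Prod>b\<in>(Basis::'a set). inverse (1 + (norm x)\<^sup>2))"
      by (simp add: decay_def power_inverse)
    also have "\<dots> \<le> (\<Prod>b\<in>(Basis::'a set). inverse (1 + (x \<bullet> b)\<^sup>2))"
    proof (intro prod_mono conjI)
      fix b :: 'a assume "b \<in> Basis"
      hence "\<bar>x \<bullet> b\<bar> \<le> norm x" by (rule Basis_le_norm)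
      hence "(x \<bullet> b)\<^sup>2 \<le> (norm x)\<^sup>2" by (metis abs_norm_cancel power2_abs power_mono abs_ge_zero)
      thus "inverse (1 + (norm x)\<^sup>2) \<le> inverse (1 + (x \<bullet> b)\<^sup>2)"
        by (intro le_imp_inverse_le) (auto simp: add_pos_nonneg)
    qed auto
    finally show "ennreal (decay x) \<le> (\<Prod>b\<in>Basis. ennreal (inverse (1 + (x \<bullet> b)\<^sup>2)))"
      by (subst prod_ennreal) (auto intro!: ennreal_leI)
  qed
  also have "\<dots> = (\<Prod>b\<in>(Basis::'a set). \<integral>\<^sup>+t. ennreal (inverse (1 + t\<^sup>2)) \<partial>lborel)"
    by (rule nn_integral_lborel_prod) auto
  also have "\<dots> < \<infinity>"
    using nn_integral_inverse_one_plus_square by (simp add: less_top[symmetric] power_eq_top_ennreal_iff)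
  finally show "(\<integral>\<^sup>+x. ennreal (decay (x::'a)) \<partial>lborel) < \<infinity>" .
qed (auto intro: decay_pos[THEN less_imp_le])

text \<open>Lets one integrable function dominate the derivatives at all points of a unit ball, as
  differentiation under the integral demands.\<close>

lemma decay_shift:
  fixes x y :: "'a::euclidean_space"
  assumes "norm (x - y) \<le> 1"
  shows "decay x \<le> 3 ^ DIM('a) * decay y"
proof -
  have "norm y \<le> norm x + 1" using assms norm_triangle_ineq2[of y x] by (simp add: norm_minus_commute)
  hence "(norm y)\<^sup>2 \<le> (norm x + 1)\<^sup>2" by (intro power_mono) auto
  also have "\<dots> \<le> 2 * (norm x)\<^sup>2 + 2"
    using zero_le_power2[of "norm x - 1"] by (auto simp: power2_diff power2_sum)
  finally have "(norm y)\<^sup>2 \<le> 2 * (norm x)\<^sup>2 + 2" .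
  moreover have "0 \<le> (norm x)\<^sup>2" by simp
  ultimately have "1 + (norm y)\<^sup>2 \<le> 3 * (1 + (norm x)\<^sup>2)"
    by (smt (verit))
  hence "(1 + (norm y)\<^sup>2) ^ DIM('a) \<le> (3 * (1 + (norm x)\<^sup>2)) ^ DIM('a)"
    by (intro power_mono) auto
  hence "inverse ((3 * (1 + (norm x)\<^sup>2)) ^ DIM('a)) \<le> inverse ((1 + (norm y)\<^sup>2) ^ DIM('a))"
    by (intro le_imp_inverse_le) (auto simp: add_pos_nonneg zero_less_power)
  hence "inverse (3 ^ DIM('a)) * decay x \<le> decay y"
    unfolding decay_def power_mult_distrib by simp
  thus ?thesis by (simp add: field_simps)
qed

lemma schwartz_decay_bound:
  fixes f :: "'a::euclidean_space \<Rightarrow> complex"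
  assumes "f \<in> schwartz"
  obtains C where "C > 0" "\<And>x. norm (f x) \<le> C * decay x"
proof -
  from schwartz_decay[OF assms, of "DIM('a)"] obtain C where
    C: "C > 0" "\<And>x. (1 + (norm x)\<^sup>2) ^ DIM('a) * norm (f x) \<le> C" by metis
  have "norm (f x) \<le> C * decay x" for x
    using C(2)[of x] unfolding decay_def by (simp add: divide_inverse[symmetric] pos_le_divide_eq add_pos_nonneg zero_less_power mult.commute)
  thus ?thesis using C(1) that by blast
qed

lemma schwartz_integrable: "f \<in> schwartz \<Longrightarrow> integrable lborel f"
proof -
  assume f: "f \<in> schwartz"
  from schwartz_decay_bound[OF f] obtain C where C: "C > 0" "\<And>x. norm (f x) \<le> C * decay x" by metis
  show ?thesis
    by (rule Bochner_Integration.integrable_bound[of _ "\<lambda>x. C * decay x"])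
      (use decay_integrable C schwartz_borel[OF f] in \<open>auto simp: abs_of_pos decay_pos\<close>)
qed

text \<open>The spare factor 1 + |x|^2 pays for the multiplication by x when a Fourier transform is
  differentiated, and for the gain 1/R in the tail of a Schwartz function.\<close>

lemma schwartz_decay_bound_strong:
  fixes f :: "'a::euclidean_space \<Rightarrow> complex"
  assumes "f \<in> schwartz"
  obtains C where "C > 0" "\<And>x. (1 + (norm x)\<^sup>2) * norm (f x) \<le> C * decay x"
proof -
  from schwartz_decay_bound[OF schwartz_symbol_mult[OF symbols.powr[of 1] assms]] show ?thesis
    using that unfolding norm_mult norm_of_real by (auto simp: add_nonneg_nonneg)
qed

lemma schwartz_deriv_bound_strong:
  fixes f :: "'a::euclidean_space \<Rightarrow> complex"
  assumes "f \<in> schwartz"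
  obtains C where "C > 0" "\<And>x v. (1 + (norm x)\<^sup>2) * norm (ddir v f x) \<le> C * decay x * norm v"
proof -
  have "\<exists>C>0. \<forall>x. (1 + (norm x)\<^sup>2) * norm (ddir b f x) \<le> C * decay x" for b
    using schwartz_decay_bound_strong[OF schwartz_ddir[OF assms, of b]] by blast
  then obtain C where C: "\<And>b. C b > 0"
    "\<And>b x. (1 + (norm x)\<^sup>2) * norm (ddir b f x) \<le> C b * decay x" by metis
  show ?thesis
  proof (rule that[of "\<Sum>b\<in>Basis. C b"])
    fix x v :: 'a
    have lin: "linear (\<lambda>v. ddir v f x)"
      using schwartz_has_derivative[OF assms] has_derivative_linear by blast
    have "ddir v f x = (\<Sum>b\<in>Basis. (v \<bullet> b) *\<^sub>R ddir b f x)"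
      by (subst euclidean_representation[of v, symmetric])
        (simp only: linear_sum[OF lin] linear_scale[OF lin])
    also have "norm \<dots> \<le> (\<Sum>b\<in>Basis. norm v * norm (ddir b f x))"
      by (rule sum_norm_le) (auto simp: Basis_le_norm intro!: mult_mono)
    finally have "(1 + (norm x)\<^sup>2) * norm (ddir v f x) \<le> (1 + (norm x)\<^sup>2) * (\<Sum>b\<in>Basis. norm v * norm (ddir b f x))"
      by (intro mult_left_mono) auto
    also have "\<dots> = (\<Sum>b\<in>Basis. norm v * ((1 + (norm x)\<^sup>2) * norm (ddir b f x)))"
      by (simp only: sum_distrib_left mult_ac)
    also have "\<dots> \<le> (\<Sum>b\<in>Basis. norm v * (C b * decay x))"
      by (intro sum_mono mult_left_mono C) auto
    also have "\<dots> = (\<Sum>b\<in>Basis. C b) * decay x * norm v"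
      by (simp add: sum_distrib_right sum_distrib_left mult_ac)
    finally show "(1 + (norm x)\<^sup>2) * norm (ddir v f x) \<le> (\<Sum>b\<in>Basis. C b) * decay x * norm v" .
  qed (auto intro!: sum_pos C)
qed

lemma schwartz_deriv_bound:
  fixes f :: "'a::euclidean_space \<Rightarrow> complex"
  assumes "f \<in> schwartz"
  obtains C where "C > 0" "\<And>x v. norm (ddir v f x) \<le> C * decay x * norm v"
proof -
  from schwartz_deriv_bound_strong[OF assms] obtain C where
    C: "C > 0" "\<And>x v. (1 + (norm x)\<^sup>2) * norm (ddir v f x) \<le> C * decay x * norm v" by metis
  have "1 * norm (ddir v f x) \<le> (1 + (norm x)\<^sup>2) * norm (ddir v f x)" for x v
    by (intro mult_right_mono) auto
  from order_trans[OF this C(2)] show ?thesis using that C(1) by simp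
qed

text \<open>The single majorant \<open>W\<close> does two things: at \<open>y0\<close> it makes the
  candidate derivative a bounded linear map, and on the unit ball, by the mean value inequality, it
  dominates the difference quotients.\<close>

lemma has_derivative_integral:
  fixes k :: "'a::euclidean_space \<Rightarrow> 'b \<Rightarrow> complex"
  assumes der: "\<And>x y. ((\<lambda>y. k y x) has_derivative k' y x) (at y)"
    and int: "\<And>y. integrable M (k y)"
    and W: "integrable M W"
    and bound: "\<And>x y v. dist y y0 < 1 \<Longrightarrow> norm (k' y x v) \<le> W x * norm v"
    and meas: "\<And>v. (\<lambda>x. k' y0 x v) \<in> borel_measurable M"
  shows "((\<lambda>y. \<integral>x. k y x \<partial>M) has_derivative (\<lambda>v. \<integral>x. k' y0 x v \<partial>M)) (at y0)"
proof -
  have b0: "norm (k' y0 x v) \<le> W x * norm v" for x v by (intro bound) simp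
  have int': "integrable M (\<lambda>x. k' y0 x v)" for v
    by (rule Bochner_Integration.integrable_bound[of _ "\<lambda>x. W x * norm v"])
      (use W meas b0 in \<open>auto intro: order_trans[OF b0 abs_ge_self] simp: abs_mult[symmetric]\<close>)
  have lin: "linear (k' y0 x)" for x using der has_derivative_linear by blast
  have bl: "bounded_linear (\<lambda>v. \<integral>x. k' y0 x v \<partial>M)"
  proof (rule bounded_linear_intro)
    show "(\<integral>x. k' y0 x (v + w) \<partial>M) = (\<integral>x. k' y0 x v \<partial>M) + (\<integral>x. k' y0 x w \<partial>M)" for v w
      by (simp add: linear_add[OF lin] Bochner_Integration.integral_add int')
    show "(\<integral>x. k' y0 x (r *\<^sub>R v) \<partial>M) = r *\<^sub>R (\<integral>x. k' y0 x v \<partial>M)" for r v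
      by (simp add: linear_scale[OF lin])
    show "norm (\<integral>x. k' y0 x v \<partial>M) \<le> norm v * (\<integral>x. W x \<partial>M)" for v
    proof -
      have "norm (\<integral>x. k' y0 x v \<partial>M) \<le> (\<integral>x. W x * norm v \<partial>M)"
        by (rule order_trans[OF integral_norm_bound integral_mono]) (use int' W b0 in auto)
      thus ?thesis by (simp add: mult.commute)
    qed
  qed
  have diff: "norm (k (y0 + h) x - k y0 x) \<le> W x * norm h" if "norm h < 1" for h x
  proof -
    have "norm (k (y0 + h) x - k y0 x) \<le> W x * norm (y0 + h - y0)"
    proof (rule differentiable_bound[of "ball y0 1"])
      show "((\<lambda>y. k y x) has_derivative k' y x) (at y within ball y0 1)" for y
        using der has_derivative_at_withinI by blast
      show "onorm (k' y x) \<le> W x" if "y \<in> ball y0 1" for y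
      proof (rule onorm_bound)
        have *: "norm (k' y x v) \<le> W x * norm v" for v
          by (rule bound) (use that in \<open>auto simp: dist_commute\<close>)
        thus "norm (k' y x v) \<le> W x * norm v" for v .
        \<comment> \<open>\<open>onorm_bound\<close> asks for \<open>0 \<le> W x\<close>, which is
          read off from the bound at a unit vector.\<close>
        obtain b :: 'a where "norm b = 1" using vector_choose_size[of 1] by auto
        thus "0 \<le> W x" using order_trans[OF norm_ge_zero *[of b]] by simp
      qed
    qed (use that in \<open>auto simp: dist_norm\<close>)
    thus ?thesis by simp
  qed
  let ?q = "\<lambda>h x. (k (y0 + h) x - k y0 x - k' y0 x h) /\<^sub>R norm h"
  have lim: "((\<lambda>h. \<integral>x. ?q h x \<partial>M) \<longlongrightarrow> (\<integral>x. 0 \<partial>M)) (at 0)"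
    unfolding tendsto_at_iff_sequentially
  proof (intro allI impI)
    fix X :: "nat \<Rightarrow> 'a" assume X: "\<forall>i. X i \<in> UNIV - {0}" "X \<longlonglongrightarrow> 0"
    then obtain N where N: "\<And>n. n \<ge> N \<Longrightarrow> norm (X n) < 1"
      by (metis LIMSEQ_iff diff_zero zero_less_one)
    \<comment> \<open>From the index \<open>N\<close> on the increments lie in the unit ball where
      \<open>W\<close> dominates. The majorant is \<open>2 * W\<close>: one \<open>W\<close> for the
      increment and one for the linear term.\<close>
    have "(\<lambda>n. \<integral>x. ?q (X (n + N)) x \<partial>M) \<longlonglongrightarrow> (\<integral>x. 0 \<partial>M)"
    proof (rule integral_dominated_convergence[where w="\<lambda>x. 2 * W x"])
      show "AE x in M. (\<lambda>n. ?q (X (n + N)) x) \<longlonglongrightarrow> 0"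
      proof (rule AE_I2)
        fix x
        from der[of x y0] have "((\<lambda>h. norm (k (y0 + h) x - k y0 x - k' y0 x h) / norm h) \<longlongrightarrow> 0) (at 0)"
          unfolding has_derivative_at by simp
        hence "((\<lambda>h. ?q h x) \<longlongrightarrow> 0) (at 0)"
          by (subst tendsto_norm_zero_iff[symmetric]) (simp add: divide_inverse mult.commute)
        hence "(\<lambda>n. ?q (X n) x) \<longlonglongrightarrow> 0"
          unfolding tendsto_at_iff_sequentially using X by (auto simp: o_def)
        thus "(\<lambda>n. ?q (X (n + N)) x) \<longlonglongrightarrow> 0" by (rule LIMSEQ_ignore_initial_segment)
      qed
      show "AE x in M. norm (?q (X (n + N)) x) \<le> 2 * W x" for n
      proof (rule AE_I2)
        fix x
        have "norm (k (y0 + X (n + N)) x - k y0 x - k' y0 x (X (n + N))) \<le>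
          W x * norm (X (n + N)) + W x * norm (X (n + N))"
          by (rule order_trans[OF norm_triangle_ineq4 add_mono[OF diff b0]]) (use N in auto)
        moreover have "X (n + N) \<noteq> 0" using X(1) by auto
        ultimately show "norm (?q (X (n + N)) x) \<le> 2 * W x"
          by (simp add: pos_divide_le_eq divide_inverse_commute[symmetric])
      qed
      note [measurable] = borel_measurable_integrable[OF int] meas
      show "(\<lambda>x. ?q (X (n + N)) x) \<in> borel_measurable M" for n by measurable
    qed (use W in auto)
    hence "(\<lambda>n. \<integral>x. ?q (X n) x \<partial>M) \<longlonglongrightarrow> (\<integral>x. 0 \<partial>M)" by (rule LIMSEQ_offset)
    thus "((\<lambda>h. \<integral>x. ?q h x \<partial>M) \<circ> X) \<longlonglongrightarrow> (\<integral>x. 0 \<partial>M)" by (simp add: o_def)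
  qed
  have eq: "(\<integral>x. ?q h x \<partial>M) = ((\<integral>x. k (y0 + h) x \<partial>M) - (\<integral>x. k y0 x \<partial>M) - (\<integral>x. k' y0 x h \<partial>M)) /\<^sub>R norm h" for h
    by (simp add: int int' Bochner_Integration.integral_diff)
  show ?thesis
    unfolding has_derivative_at
  proof
    have "((\<lambda>h. norm (\<integral>x. ?q h x \<partial>M)) \<longlongrightarrow> 0) (at 0)"
      using lim by (intro tendsto_norm_zero) simp
    thus "((\<lambda>h. norm ((\<integral>x. k (y0 + h) x \<partial>M) - (\<integral>x. k y0 x \<partial>M) - (\<integral>x. k' y0 x h \<partial>M)) / norm h) \<longlongrightarrow> 0) (at 0)"
      unfolding eq by (simp add: divide_inverse mult.commute)
  qed (rule bl)
qed

lemma correlation_integrable: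
  fixes f :: "'a::euclidean_space \<Rightarrow> complex"
  assumes f: "f \<in> schwartz" and [measurable]: "h \<in> borel_measurable borel"
    and B: "\<And>x. norm (h x) \<le> B"
  shows "integrable lborel (\<lambda>x. h x * f (x + y) :: complex)"
proof (rule Bochner_Integration.integrable_bound[of _ "\<lambda>x. B * f (x + y)"])
  have "integrable lborel (\<lambda>x. f (y + 1 *\<^sub>R x))"
    using lborel_integrable_affine[OF schwartz_integrable[OF f], of 1 y] by simp
  thus "integrable lborel (\<lambda>x. B * f (x + y))" by (simp add: add.commute)
  note [measurable] = schwartz_borel[OF f]
  show "(\<lambda>x. h x * f (x + y)) \<in> borel_measurable lborel" by measurable
qed (auto simp: norm_mult intro!: mult_right_mono order_trans[OF B abs_ge_self])

text \<open>Used with \<open>h\<close> a character, to transform derivatives, and with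
  \<open>h\<close> a reflected Lipschitz function, to show that mollification produces smooth
  functions. All derivatives fall on \<open>f\<close>, so \<open>h\<close> contributes its bound and
  no regularity.\<close>

lemma correlation_has_derivative:
  fixes f :: "'a::euclidean_space \<Rightarrow> complex"
  assumes f: "f \<in> schwartz" and h[measurable]: "h \<in> borel_measurable borel"
    and B: "\<And>x. norm (h x) \<le> B"
  shows "((\<lambda>y. \<integral>x. h x * f (x + y) \<partial>lborel) has_derivative
    (\<lambda>v. \<integral>x. h x * ddir v f (x + y0) \<partial>lborel)) (at y0)"
proof -
  have "0 \<le> B" using order_trans[OF norm_ge_zero B] .
  from schwartz_deriv_bound[OF f] obtain C where
    C: "C > 0" "\<And>x v. norm (ddir v f x) \<le> C * decay x * norm v" by metis
  show ?thesis
  proof (rule has_derivative_integral[where W="\<lambda>x. B * C * 3 ^ DIM('a) * decay (x + y0)"])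
    fix x y
    have "((f \<circ> (+) x) has_derivative (\<lambda>v. ddir v f (x + y)) \<circ> (\<lambda>v. v)) (at y)"
      by (intro diff_chain_at schwartz_has_derivative[OF f]) (auto intro!: derivative_eq_intros)
    thus "((\<lambda>y. h x * f (x + y)) has_derivative (\<lambda>v. h x * ddir v f (x + y))) (at y)"
      by (auto simp: o_def intro!: has_derivative_mult_right)
  next
    fix x y v :: 'a assume y: "dist y y0 < 1"
    have "norm (h x * ddir v f (x + y)) \<le> B * (C * decay (x + y) * norm v)"
      unfolding norm_mult by (intro mult_mono B C \<open>0 \<le> B\<close>) auto
    also have "\<dots> \<le> B * (C * (3 ^ DIM('a) * decay (x + y0)) * norm v)"
      using y C(1) \<open>0 \<le> B\<close>
      by (intro mult_left_mono mult_right_mono decay_shift) (auto simp: dist_norm)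
    finally show "norm (h x * ddir v f (x + y)) \<le> B * C * 3 ^ DIM('a) * decay (x + y0) * norm v"
      by (simp add: mult_ac)
  next
    show "integrable lborel (\<lambda>x. B * C * 3 ^ DIM('a) * decay (x + y0))"
      using lborel_integrable_affine[OF decay_integrable, of 1 y0] by (simp add: add.commute)
    fix v
    note [measurable] = schwartz_borel[OF schwartz_ddir[OF f, of v]]
    show "(\<lambda>x. h x * ddir v f (x + y0)) \<in> borel_measurable lborel" by measurable
  qed (rule correlation_integrable[OF f h B])
qed

section \<open>Derivatives, the Laplacian and invariance of the Schwartz space\<close>

lemma cis_borel [measurable]:
  "f \<in> borel_measurable M \<Longrightarrow> (\<lambda>x. cis (f x)) \<in> borel_measurable M"
  unfolding cis_conv_exp by measurable

text \<open>Replaces the completed measure of the definition by \<open>lborel\<close>, over which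
  the product measures of the Fubini arguments are formed.\<close>

lemma fourier_lborel:
  assumes [measurable]: "f \<in> borel_measurable borel"
  shows "fourier f \<xi> = (\<integral>x. cis (- (x \<bullet> \<xi>)) * f x \<partial>lborel)"
  unfolding fourier_def by (rule integral_completion) measurable

lemma inv_fourier_eq:
  fixes f :: "'a::euclidean_space \<Rightarrow> complex"
  shows "inv_fourier f x = complex_of_real ((2 * pi) powr (- real DIM('a))) * fourier f (- x)"
  by (simp add: inv_fourier_def fourier_def inner_commute)

lemma fourier_integrand_integrable:
  "f \<in> schwartz \<Longrightarrow> integrable lborel (\<lambda>x. cis (- (x \<bullet> \<xi>)) * f x)"
  by (rule correlation_integrable[of f "\<lambda>x. cis (- (x \<bullet> \<xi>))" 1 0, simplified]) auto

lemma fourier_has_derivative: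
  assumes f: "f \<in> schwartz"
  shows "(fourier f has_derivative (\<lambda>v. fourier (\<lambda>x. (- \<i>) * (complex_of_real (x \<bullet> v) * f x)) \<xi>)) (at \<xi>)"
proof -
  have xf: "(\<lambda>x. (- \<i>) * (complex_of_real (x \<bullet> v) * f x)) \<in> schwartz" for v
    by (intro schwartz_cmult schwartz_symbol_mult[OF symbols.lin] f)
  note eq = fourier_lborel[OF schwartz_borel]
  from schwartz_decay_bound_strong[OF f] obtain C where
    C: "C > 0" "\<And>x. (1 + (norm x)\<^sup>2) * norm (f x) \<le> C * decay x" by metis
  have "((\<lambda>\<xi>. \<integral>x. cis (- (x \<bullet> \<xi>)) * f x \<partial>lborel) has_derivative
    (\<lambda>v. \<integral>x. cis (- (x \<bullet> \<xi>)) * ((- \<i>) * (complex_of_real (x \<bullet> v) * f x)) \<partial>lborel)) (at \<xi>)"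
  proof (rule has_derivative_integral[where W="\<lambda>x. C * decay x"])
    fix x y
    show "((\<lambda>\<xi>. cis (- (x \<bullet> \<xi>)) * f x) has_derivative
        (\<lambda>v. cis (- (x \<bullet> y)) * ((- \<i>) * (complex_of_real (x \<bullet> v) * f x)))) (at y)"
      by (auto intro!: derivative_eq_intros simp: scaleR_conv_of_real)
  next
    fix x y v
    have "norm (complex_of_real (x \<bullet> v) * f x) \<le> (norm x * norm v) * norm (f x)"
      unfolding norm_mult norm_of_real by (intro mult_right_mono Cauchy_Schwarz_ineq2) auto
    also have "\<dots> \<le> (1 + (norm x)\<^sup>2) * norm (f x) * norm v"
      using mult_right_mono[OF le_one_plus_square[of "norm x"], of "norm (f x) * norm v"]
      by (simp add: mult_ac)
    also have "\<dots> \<le> C * decay x * norm v" by (intro mult_right_mono C) auto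
    finally show "norm (cis (- (x \<bullet> y)) * ((- \<i>) * (complex_of_real (x \<bullet> v) * f x))) \<le> C * decay x * norm v"
      by (simp add: norm_mult)
  next
    note [measurable] = schwartz_borel[OF f]
    show "(\<lambda>x. cis (- (x \<bullet> \<xi>)) * ((- \<i>) * (complex_of_real (x \<bullet> v) * f x))) \<in> borel_measurable lborel" for v
      by measurable
  qed (use fourier_integrand_integrable[OF f] decay_integrable in auto)
  moreover have "fourier f = (\<lambda>\<xi>. \<integral>x. cis (- (x \<bullet> \<xi>)) * f x \<partial>lborel)" by (rule ext) (rule eq[OF f])
  moreover note eq[OF xf]
  ultimately show ?thesis by simp
qed

text \<open>Integration by parts is avoided: the integral of
  \<open>cis (- (x \<bullet> \<xi>)) * f (x + y)\<close>, as a function of \<open>y\<close>, equals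
  \<open>cis (y \<bullet> \<xi>) * fourier f \<xi>\<close> by translation, and the derivatives of
  the two expressions at \<open>y = 0\<close> are compared.\<close>

lemma fourier_ddir:
  assumes f: "f \<in> schwartz"
  shows "fourier (ddir v f) \<xi> = \<i> * complex_of_real (v \<bullet> \<xi>) * fourier f \<xi>"
proof -
  have D: "((\<lambda>y. \<integral>x. cis (- (x \<bullet> \<xi>)) * f (x + y) \<partial>lborel) has_derivative
    (\<lambda>v. \<integral>x. cis (- (x \<bullet> \<xi>)) * ddir v f (x + 0) \<partial>lborel)) (at 0)"
    by (rule correlation_has_derivative[OF f, where B=1]) auto
  have E: "(\<lambda>y. \<integral>x. cis (- (x \<bullet> \<xi>)) * f (x + y) \<partial>lborel) = (\<lambda>y. cis (y \<bullet> \<xi>) * fourier f \<xi>)"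
  proof
    fix y
    note [measurable] = schwartz_borel[OF f]
    have "(\<integral>x. cis (- (x \<bullet> \<xi>)) * f (x + y) \<partial>lborel) =
       (\<integral>x. cis (- ((- y + 1 *\<^sub>R x) \<bullet> \<xi>)) * f ((- y + 1 *\<^sub>R x) + y) \<partial>lborel)"
      by (subst lborel_integral_affine[of _ 1 "-y"]) auto
    also have "\<dots> = (\<integral>x. cis (y \<bullet> \<xi>) * (cis (- (x \<bullet> \<xi>)) * f x) \<partial>lborel)"
      by (intro Bochner_Integration.integral_cong refl)
        (simp add: inner_diff_left cis_mult mult.assoc[symmetric] minus_diff_eq)
    also have "\<dots> = cis (y \<bullet> \<xi>) * fourier f \<xi>"
      by (simp add: fourier_lborel[OF schwartz_borel[OF f]])
    finally show "(\<integral>x. cis (- (x \<bullet> \<xi>)) * f (x + y) \<partial>lborel) = cis (y \<bullet> \<xi>) * fourier f \<xi>" .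
  qed
  have F: "((\<lambda>y. cis (y \<bullet> \<xi>) * fourier f \<xi>) has_derivative
    (\<lambda>v. \<i> * complex_of_real (v \<bullet> \<xi>) * fourier f \<xi>)) (at 0)"
    by (auto intro!: derivative_eq_intros simp: scaleR_conv_of_real)
  have "(\<lambda>v. \<integral>x. cis (- (x \<bullet> \<xi>)) * ddir v f (x + 0) \<partial>lborel) =
     (\<lambda>v. \<i> * complex_of_real (v \<bullet> \<xi>) * fourier f \<xi>)"
    by (rule has_derivative_unique[OF D[unfolded E] F])
  from fun_cong[OF this, of v] show ?thesis
    by (simp add: fourier_lborel[OF schwartz_borel[OF schwartz_ddir[OF f]]])
qed

lemma schwartz_sum:
  assumes "finite A" "\<And>a. a \<in> A \<Longrightarrow> f a \<in> schwartz" "A \<noteq> {}"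
  shows "(\<lambda>x. \<Sum>a\<in>A. f a x) \<in> schwartz"
  using assms(1,3,2) by (induction A rule: finite_ne_induct) (auto intro!: schwartz_add)

text \<open>\<open>g\<close> is \<open>f\<close> minus its Laplacian. Iteration yields the decay of
  a transform to every order.\<close>

lemma fourier_laplacian:
  fixes f :: "'a::euclidean_space \<Rightarrow> complex"
  assumes f: "f \<in> schwartz"
  obtains g where "g \<in> schwartz" "\<And>\<xi>. complex_of_real (1 + (norm \<xi>)\<^sup>2) * fourier f \<xi> = fourier g \<xi>"
proof -
  let ?L = "\<lambda>x. \<Sum>b\<in>(Basis::'a set). ddir b (ddir b f) x"
  have L: "?L \<in> schwartz" by (intro schwartz_sum schwartz_ddir f) auto
  have *: "fourier (\<lambda>x. f x - ?L x) \<xi> = complex_of_real (1 + (norm \<xi>)\<^sup>2) * fourier f \<xi>" for \<xi>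
  proof -
    have "fourier (\<lambda>x. f x - ?L x) \<xi> = fourier f \<xi> - (\<integral>x. cis (- (x \<bullet> \<xi>)) * ?L x \<partial>lborel)"
      by (simp add: fourier_lborel schwartz_borel schwartz_diff f L right_diff_distrib
          Bochner_Integration.integral_diff fourier_integrand_integrable)
    also have "(\<integral>x. cis (- (x \<bullet> \<xi>)) * ?L x \<partial>lborel) = (\<Sum>b\<in>Basis. fourier (ddir b (ddir b f)) \<xi>)"
      by (simp add: fourier_lborel schwartz_borel schwartz_ddir f sum_distrib_left
          Bochner_Integration.integral_sum fourier_integrand_integrable)
    also have "\<dots> = (\<Sum>b\<in>Basis. - (complex_of_real ((\<xi> \<bullet> b) * (\<xi> \<bullet> b)) * fourier f \<xi>))"
      by (intro sum.cong) (auto simp: fourier_ddir schwartz_ddir f inner_commute algebra_simps)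
    also have "\<dots> = - (complex_of_real ((norm \<xi>)\<^sup>2) * fourier f \<xi>)"
      by (simp add: power2_norm_eq_inner euclidean_inner[of \<xi> \<xi>] sum_negf sum_distrib_right)
    finally show ?thesis by (simp add: algebra_simps)
  qed
  show ?thesis by (rule that[OF schwartz_diff[OF f L]]) (simp only: *)
qed

text \<open>The coinductive class is the image of \<open>fourier\<close>: a derivative of a
  transform is again a transform, and so is a transform times a power of 1 + |\<xi>|^2, which is
  therefore bounded by an L^1 norm.\<close>

lemma fourier_schwartz:
  fixes f :: "'a::euclidean_space \<Rightarrow> complex"
  assumes "f \<in> schwartz"
  shows "fourier f \<in> schwartz"
proof (rule schwartzI_decay[of _ "fourier ` schwartz"])
  fix h :: "'a \<Rightarrow> complex" assume "h \<in> fourier ` schwartz"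
  then obtain g where g: "g \<in> schwartz" "h = fourier g" by blast
  note d = fourier_has_derivative[OF g(1)]
  show "h differentiable (at x)" for x unfolding g differentiable_def using d by blast
  show "ddir v h \<in> fourier ` schwartz" for v
    unfolding g(2) ddir_eqI[OF d]
    by (intro imageI schwartz_cmult schwartz_symbol_mult[OF symbols.lin] g)
  have "\<exists>g'\<in>schwartz. \<forall>\<xi>. complex_of_real ((1 + (norm \<xi>)\<^sup>2) ^ N) * fourier g \<xi> = fourier g' \<xi>" for N
  proof (induction N)
    case 0 thus ?case using g(1) by auto
  next
    case (Suc N)
    then obtain g' where g': "g' \<in> schwartz"
      "\<And>\<xi>. complex_of_real ((1 + (norm \<xi>)\<^sup>2) ^ N) * fourier g \<xi> = fourier g' \<xi>" by blast
    from fourier_laplacian[OF g'(1)] obtain g'' where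
      "g'' \<in> schwartz" "\<And>\<xi>. complex_of_real (1 + (norm \<xi>)\<^sup>2) * fourier g' \<xi> = fourier g'' \<xi>" by metis
    thus ?case by (intro bexI[of _ g'']) (auto simp: g'(2)[symmetric] mult_ac)
  qed
  then obtain G where G: "\<And>N. G N \<in> schwartz"
    "\<And>N \<xi>. complex_of_real ((1 + (norm \<xi>)\<^sup>2) ^ N) * fourier g \<xi> = fourier (G N) \<xi>" by metis
  show "\<exists>C. \<forall>x. (1 + (norm x)\<^sup>2) ^ N * norm (h x) \<le> C" for N
  proof (intro exI allI)
    fix \<xi>
    have "(1 + (norm \<xi>)\<^sup>2) ^ N * norm (h \<xi>) = norm (complex_of_real ((1 + (norm \<xi>)\<^sup>2) ^ N) * fourier g \<xi>)"
      unfolding g(2) norm_mult norm_of_real by (simp add: add_nonneg_nonneg)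
    also have "\<dots> = norm (\<integral>x. cis (- (x \<bullet> \<xi>)) * G N x \<partial>lborel)"
      unfolding G by (simp add: fourier_lborel schwartz_borel G)
    also have "\<dots> \<le> (\<integral>x. norm (G N x) \<partial>lborel)"
      by (rule order_trans[OF integral_norm_bound]) (simp add: norm_mult)
    finally show "(1 + (norm \<xi>)\<^sup>2) ^ N * norm (h \<xi>) \<le> (\<integral>x. norm (G N x) \<partial>lborel)" .
  qed
qed (use assms in auto)

lemma inv_fourier_schwartz:
  assumes "f \<in> schwartz" shows "inv_fourier f \<in> schwartz"
proof -
  have "inv_fourier f = (\<lambda>x. complex_of_real ((2 * pi) powr (- real DIM('a))) * fourier f (- x))"
    by (rule ext) (rule inv_fourier_eq)
  thus ?thesis using schwartz_cmult[OF schwartz_uminus_arg[OF fourier_schwartz[OF assms]]] by simp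
qed

section \<open>Gaussian averages and Fourier inversion\<close>

lemma integral_lborel_prod:
  fixes f :: "'a::euclidean_space \<Rightarrow> real \<Rightarrow> complex"
  assumes "\<And>b. b \<in> Basis \<Longrightarrow> integrable lborel (f b)"
  shows "(\<integral>x. (\<Prod>b\<in>Basis. f b (x \<bullet> b)) \<partial>lborel) = (\<Prod>b\<in>Basis. (\<integral>x. f b x \<partial>lborel))"
proof -
  have [measurable]: "f b \<in> borel_measurable borel" if "b \<in> Basis" for b
    using assms[OF that] by (simp add: borel_measurable_integrable)
  interpret product_sigma_finite "\<lambda>_::'a. lborel :: real measure" ..
  have "(\<integral>x. (\<Prod>b\<in>Basis. f b (x \<bullet> b)) \<partial>lborel) =
     (\<integral>g. (\<Prod>b\<in>Basis. f b ((\<Sum>c\<in>Basis. g c *\<^sub>R c) \<bullet> b)) \<partial>(\<Pi>\<^sub>M b\<in>(Basis::'a set). lborel))"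
    by (subst lborel_eq) (simp add: integral_distr)
  also have "\<dots> = (\<integral>g. (\<Prod>b\<in>Basis. f b (g b)) \<partial>(\<Pi>\<^sub>M b\<in>(Basis::'a set). lborel))"
    by simp
  also have "\<dots> = (\<Prod>b\<in>Basis. (\<integral>x. f b x \<partial>lborel))"
    by (rule product_integral_prod) (auto intro: assms)
  finally show ?thesis .
qed

text \<open>The standard Gaussian, kept as a product so that its mass and its transform reduce to
  known facts about the normal distribution on the line.\<close>

definition gauss_density :: "'a::euclidean_space \<Rightarrow> real" where
  "gauss_density x = (\<Prod>b\<in>Basis. std_normal_density (x \<bullet> b))"

lemma gauss_density_borel [measurable]: "gauss_density \<in> borel_measurable borel"
  unfolding gauss_density_def[abs_def] by measurable

lemma sum_Basis_square: "(\<Sum>b\<in>Basis. - (x \<bullet> b)\<^sup>2 / 2) = - (norm (x::'a::euclidean_space))\<^sup>2 / 2"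
proof -
  have "(norm x)\<^sup>2 = (\<Sum>b\<in>Basis. (x \<bullet> b)\<^sup>2)"
    unfolding power2_norm_eq_inner by (subst euclidean_inner) (simp add: power2_eq_square)
  thus ?thesis by (simp add: sum_negf sum_divide_distrib[symmetric])
qed

lemma gauss_density_eq:
  "gauss_density (x::'a::euclidean_space) = (2 * pi) powr (- real DIM('a) / 2) * exp (- (norm x)\<^sup>2 / 2)"
proof -
  have "gauss_density x = (\<Prod>b\<in>(Basis::'a set). inverse (sqrt (2 * pi)) * exp (- (x \<bullet> b)\<^sup>2 / 2))"
    by (simp add: gauss_density_def std_normal_density_def inverse_eq_divide)
  also have "\<dots> = inverse (sqrt (2 * pi)) ^ DIM('a) * exp (\<Sum>b\<in>(Basis::'a set). - (x \<bullet> b)\<^sup>2 / 2)"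
    by (simp add: prod.distrib exp_sum)
  also have "(\<Sum>b\<in>(Basis::'a set). - (x \<bullet> b)\<^sup>2 / 2) = - (norm x)\<^sup>2 / 2"
    by (rule sum_Basis_square)
  also have "inverse (sqrt (2 * pi)) ^ DIM('a) = (2 * pi) powr (- real DIM('a) / 2)"
    by (simp add: powr_half_sqrt[symmetric] powr_minus[symmetric] powr_realpow[symmetric] powr_powr)
  finally show ?thesis .
qed

lemma gauss_density_pos: "0 < gauss_density x"
  by (simp add: gauss_density_def prod_pos normal_density_pos)

lemma nn_integral_gauss_density:
  "(\<integral>\<^sup>+x. ennreal (gauss_density (x::'a::euclidean_space)) \<partial>lborel) = 1"
proof -
  have 1: "(\<integral>\<^sup>+x. ennreal (std_normal_density x) \<partial>lborel) = 1"
    using prob_space.emeasure_space_1[OF prob_space_normal_density[of 1 0]]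
    by (simp add: emeasure_density)
  have "(\<integral>\<^sup>+x. ennreal (gauss_density (x::'a)) \<partial>lborel) =
     (\<integral>\<^sup>+x. (\<Prod>b\<in>Basis. ennreal (std_normal_density ((x::'a) \<bullet> b))) \<partial>lborel)"
    by (simp add: gauss_density_def prod_ennreal normal_density_nonneg)
  also have "\<dots> = (\<Prod>b\<in>(Basis::'a set). (\<integral>\<^sup>+x. ennreal (std_normal_density x) \<partial>lborel))"
    by (rule nn_integral_lborel_prod) auto
  finally show ?thesis by (simp add: 1)
qed

lemma gauss_density_integrable: "integrable lborel gauss_density"
  by (rule integrableI_nonneg) (auto simp: nn_integral_gauss_density less_imp_le[OF gauss_density_pos])

lemma integral_gauss_density: "(\<integral>x. gauss_density x \<partial>lborel) = 1"
  by (subst integral_eq_nn_integral) (auto simp: nn_integral_gauss_density less_imp_le[OF gauss_density_pos])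

lemma fourier_gauss_density:
  fixes \<xi> :: "'a::euclidean_space"
  shows "(\<integral>x. cis (x \<bullet> \<xi>) * complex_of_real (gauss_density x) \<partial>lborel) =
    complex_of_real (exp (- (norm \<xi>)\<^sup>2 / 2))"
proof -
  let ?f = "\<lambda>b t. cis (t * (\<xi> \<bullet> b)) * complex_of_real (std_normal_density t)"
  have 1: "(\<integral>t. ?f b t \<partial>lborel) = complex_of_real (exp (- (\<xi> \<bullet> b)\<^sup>2 / 2))" for b
  proof -
    have "complex_of_real (exp (- (\<xi> \<bullet> b)\<^sup>2 / 2)) = char std_normal_distribution (\<xi> \<bullet> b)"
      by (simp add: char_std_normal_distribution)
    also have "\<dots> = (\<integral>t. std_normal_density t *\<^sub>R iexp ((\<xi> \<bullet> b) * t) \<partial>lborel)"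
      unfolding char_def by (subst integral_density) auto
    finally show ?thesis by (simp add: cis_conv_exp scaleR_conv_of_real mult.commute)
  qed
  have "(\<integral>x. cis (x \<bullet> \<xi>) * complex_of_real (gauss_density x) \<partial>lborel) =
      (\<integral>x. (\<Prod>b\<in>Basis. ?f b (x \<bullet> b)) \<partial>lborel)"
  proof (intro Bochner_Integration.integral_cong refl)
    fix x :: 'a
    have "cis (x \<bullet> \<xi>) = (\<Prod>b\<in>Basis. cis ((x \<bullet> b) * (\<xi> \<bullet> b)))"
      by (subst euclidean_inner[of x \<xi>])
        (simp add: cis_conv_exp exp_sum[symmetric] sum_distrib_left)
    thus "cis (x \<bullet> \<xi>) * complex_of_real (gauss_density x) = (\<Prod>b\<in>Basis. ?f b (x \<bullet> b))"
      by (simp add: gauss_density_def prod.distrib)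
  qed
  also have "\<dots> = (\<Prod>b\<in>Basis. \<integral>t. ?f b t \<partial>lborel)"
  proof (rule integral_lborel_prod)
    show "integrable lborel (?f b)" for b
      by (rule Bochner_Integration.integrable_bound[of _ "std_normal_density"])
        (auto simp: norm_mult intro: integrable_normal_density)
  qed
  also have "\<dots> = complex_of_real (exp (\<Sum>b\<in>(Basis::'a set). - (\<xi> \<bullet> b)\<^sup>2 / 2))"
    by (simp add: 1 exp_sum)
  also have "(\<Sum>b\<in>(Basis::'a set). - (\<xi> \<bullet> b)\<^sup>2 / 2) = - (norm \<xi>)\<^sup>2 / 2"
    by (rule sum_Basis_square)
  finally show ?thesis .
qed

lemma integral_cis_gauss:
  fixes y :: "'a::euclidean_space"
  assumes "c > 0"
  shows "(\<integral>\<xi>. cis (y \<bullet> \<xi>) * complex_of_real (exp (- (c * norm \<xi>)\<^sup>2 / 2)) \<partial>lborel) =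
     complex_of_real ((2 * pi) ^ DIM('a) * inverse (c ^ DIM('a)) * gauss_density (y /\<^sub>R c))"
proof -
  \<comment> \<open>\<open>?K\<close> occurs twice, once when the exponential is written as a
    density and once when its transform is; the resulting power of \<open>2 * pi\<close> later
    cancels the constant in \<open>inv_fourier\<close>.\<close>
  let ?K = "(2 * pi) powr (real DIM('a) / 2)"
  have K: "exp (- (norm x)\<^sup>2 / 2) = ?K * gauss_density x" for x :: 'a
    unfolding gauss_density_eq by (simp add: powr_minus field_simps)
  have "(\<integral>\<xi>. cis (y \<bullet> \<xi>) * complex_of_real (exp (- (c * norm \<xi>)\<^sup>2 / 2)) \<partial>lborel) =
     \<bar>inverse c\<bar> ^ DIM('a) *\<^sub>R
     (\<integral>\<xi>. cis (y \<bullet> (0 + inverse c *\<^sub>R \<xi>)) * complex_of_real (exp (- (c * norm (0 + inverse c *\<^sub>R \<xi>))\<^sup>2 / 2)) \<partial>lborel)"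
    by (rule lborel_integral_affine) (use assms in auto)
  also have "(\<integral>\<xi>. cis (y \<bullet> (0 + inverse c *\<^sub>R \<xi>)) * complex_of_real (exp (- (c * norm (0 + inverse c *\<^sub>R \<xi>))\<^sup>2 / 2)) \<partial>lborel) =
     (\<integral>\<xi>. complex_of_real ?K * (cis (\<xi> \<bullet> (y /\<^sub>R c)) * complex_of_real (gauss_density \<xi>)) \<partial>lborel)"
  proof (intro Bochner_Integration.integral_cong refl)
    fix \<xi> :: 'a
    have "c * norm (0 + inverse c *\<^sub>R \<xi>) = norm \<xi>" using assms by simp
    moreover have "y \<bullet> (0 + inverse c *\<^sub>R \<xi>) = \<xi> \<bullet> (y /\<^sub>R c)" by (simp add: inner_commute)
    ultimately show "cis (y \<bullet> (0 + inverse c *\<^sub>R \<xi>)) * complex_of_real (exp (- (c * norm (0 + inverse c *\<^sub>R \<xi>))\<^sup>2 / 2))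
      = complex_of_real ?K * (cis (\<xi> \<bullet> (y /\<^sub>R c)) * complex_of_real (gauss_density \<xi>))"
      by (simp only: K) (simp add: mult_ac)
  qed
  also have "\<dots> = complex_of_real ?K * complex_of_real (exp (- (norm (y /\<^sub>R c))\<^sup>2 / 2))"
    by (simp only: Bochner_Integration.integral_mult_right_zero fourier_gauss_density)
  also have "\<dots> = complex_of_real (?K * ?K * gauss_density (y /\<^sub>R c))"
    unfolding K by simp
  also have "?K * ?K = (2 * pi) ^ DIM('a)"
    unfolding powr_add[symmetric] by (simp only: field_sum_of_halves) (simp add: powr_realpow)
  finally show ?thesis
    using assms by (simp add: scaleR_conv_of_real power_inverse mult_ac)
qed

definition gauss_mean :: "real \<Rightarrow> ('a::euclidean_space \<Rightarrow> complex) \<Rightarrow> 'a \<Rightarrow> complex" where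
  "gauss_mean c f x = (\<integral>z. f (x + c *\<^sub>R z) * complex_of_real (gauss_density z) \<partial>lborel)"

lemma integrable_exp_norm_square:
  assumes "c > 0"
  shows "integrable lborel (\<lambda>\<xi>::'a::euclidean_space. exp (- (c * norm \<xi>)\<^sup>2 / 2))"
proof -
  have "integrable lborel (\<lambda>\<xi>. (2 * pi) powr (real DIM('a) / 2) * gauss_density (0 + c *\<^sub>R (\<xi>::'a)))"
    using assms by (intro integrable_mult_right lborel_integrable_affine gauss_density_integrable) auto
  moreover have "(2 * pi) powr (real DIM('a) / 2) * gauss_density (0 + c *\<^sub>R \<xi>) = exp (- (c * norm \<xi>)\<^sup>2 / 2)" for \<xi> :: 'a
    using assms unfolding gauss_density_eq by (simp add: powr_minus field_simps)
  ultimately show ?thesis by (simp only:)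
qed

text \<open>Fubini turns the Gaussian regularisation of the inversion integral into a
  Gaussian average, which is both the heat semigroup formula and, as \<open>c\<close> tends to 0,
  the inversion theorem.\<close>

lemma gauss_multiplier:
  fixes f :: "'a::euclidean_space \<Rightarrow> complex"
  assumes f: "f \<in> schwartz" and c: "c > 0"
  shows "(\<integral>\<xi>. cis (- (x \<bullet> \<xi>)) * (complex_of_real (exp (- (c * norm \<xi>)\<^sup>2 / 2)) * inv_fourier f \<xi>) \<partial>lborel) =
    gauss_mean c f x"
proof -
  note [measurable] = schwartz_borel[OF f]
  let ?e = "\<lambda>\<xi>::'a. exp (- (c * norm \<xi>)\<^sup>2 / 2)"
  let ?P = "(2 * pi) powr (- real DIM('a))"
  let ?F = "\<lambda>\<xi> y. complex_of_real ?P * (f y * (cis ((y - x) \<bullet> \<xi>) * complex_of_real (?e \<xi>)))"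
  have int: "integrable (lborel \<Otimes>\<^sub>M lborel) (\<lambda>(\<xi>, y). ?F \<xi> y)"
  proof (rule lborel_pair.Fubini_integrable)
    show "(\<lambda>(\<xi>, y). ?F \<xi> y) \<in> borel_measurable (lborel \<Otimes>\<^sub>M lborel)" by measurable
    have "integrable lborel (\<lambda>\<xi>. (?P * (\<integral>y. norm (f y) \<partial>lborel)) * ?e \<xi>)"
      by (intro integrable_mult_right integrable_exp_norm_square c)
    thus "integrable lborel (\<lambda>\<xi>. \<integral>y. norm (case (\<xi>, y) of (\<xi>, y) \<Rightarrow> ?F \<xi> y) \<partial>lborel)"
      by (simp add: norm_mult mult_ac)
    have "integrable lborel (\<lambda>y. ?F \<xi> y)" for \<xi>
      using fourier_integrand_integrable[OF f, of "-\<xi>"]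
      by (intro integrable_mult_right)
        (simp add: inner_diff_left cis_divide[symmetric] mult.assoc[symmetric] mult.commute)
    thus "AE \<xi> in lborel. integrable lborel (\<lambda>y. case (\<xi>, y) of (\<xi>, y) \<Rightarrow> ?F \<xi> y)" by simp
  qed
  have "(\<integral>\<xi>. cis (- (x \<bullet> \<xi>)) * (complex_of_real (?e \<xi>) * inv_fourier f \<xi>) \<partial>lborel) =
      (\<integral>\<xi>. (\<integral>y. ?F \<xi> y \<partial>lborel) \<partial>lborel)"
  proof (intro Bochner_Integration.integral_cong refl)
    fix \<xi> :: 'a
    have "inv_fourier f \<xi> = complex_of_real ?P * (\<integral>y. cis (y \<bullet> \<xi>) * f y \<partial>lborel)"
      unfolding inv_fourier_eq by (subst fourier_lborel) auto
    hence "cis (- (x \<bullet> \<xi>)) * (complex_of_real (?e \<xi>) * inv_fourier f \<xi>) =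
      (\<integral>y. (cis (- (x \<bullet> \<xi>)) * (complex_of_real (?e \<xi>) * complex_of_real ?P)) * (cis (y \<bullet> \<xi>) * f y) \<partial>lborel)"
      by (simp add: mult.assoc)
    also have "\<dots> = (\<integral>y. ?F \<xi> y \<partial>lborel)"
    proof (intro Bochner_Integration.integral_cong refl)
      fix y
      have "cis ((y - x) \<bullet> \<xi>) = cis (- (x \<bullet> \<xi>)) * cis (y \<bullet> \<xi>)"
        by (simp add: cis_mult inner_diff_left)
      thus "(cis (- (x \<bullet> \<xi>)) * (complex_of_real (?e \<xi>) * complex_of_real ?P)) * (cis (y \<bullet> \<xi>) * f y) = ?F \<xi> y"
        by (simp add: mult_ac)
    qed
    finally show "cis (- (x \<bullet> \<xi>)) * (complex_of_real (?e \<xi>) * inv_fourier f \<xi>) = (\<integral>y. ?F \<xi> y \<partial>lborel)" .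
  qed
  also have "\<dots> = (\<integral>y. (\<integral>\<xi>. ?F \<xi> y \<partial>lborel) \<partial>lborel)"
    by (rule lborel_pair.Fubini_integral[symmetric, OF int])
  also have "\<dots> = (\<integral>y. complex_of_real (inverse (c ^ DIM('a))) * (f y * complex_of_real (gauss_density ((y - x) /\<^sub>R c))) \<partial>lborel)"
  proof (intro Bochner_Integration.integral_cong refl)
    fix y
    have P: "?P * (2 * pi) ^ DIM('a) = 1"
      unfolding powr_minus by (subst powr_realpow) (auto simp: field_simps)
    have "(\<integral>\<xi>. ?F \<xi> y \<partial>lborel) = complex_of_real ?P * (f y * complex_of_real ((2 * pi) ^ DIM('a) * inverse (c ^ DIM('a)) * gauss_density ((y - x) /\<^sub>R c)))"
      by (simp only: Bochner_Integration.integral_mult_right_zero integral_cis_gauss[OF c])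
    also have "\<dots> = complex_of_real (?P * (2 * pi) ^ DIM('a)) * (complex_of_real (inverse (c ^ DIM('a))) * (f y * complex_of_real (gauss_density ((y - x) /\<^sub>R c))))"
      by (simp only: of_real_mult mult_ac)
    finally show "(\<integral>\<xi>. ?F \<xi> y \<partial>lborel) = complex_of_real (inverse (c ^ DIM('a))) * (f y * complex_of_real (gauss_density ((y - x) /\<^sub>R c)))"
      by (simp only: P) simp
  qed
  also have "\<dots> = complex_of_real (inverse (c ^ DIM('a))) * (\<integral>y. f y * complex_of_real (gauss_density ((y - x) /\<^sub>R c)) \<partial>lborel)"
    by simp
  also have "(\<integral>y. f y * complex_of_real (gauss_density ((y - x) /\<^sub>R c)) \<partial>lborel) =
    \<bar>c\<bar> ^ DIM('a) *\<^sub>R (\<integral>z. f (x + c *\<^sub>R z) * complex_of_real (gauss_density ((x + c *\<^sub>R z - x) /\<^sub>R c)) \<partial>lborel)"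
    by (rule lborel_integral_affine) (use c in auto)
  also have "(\<integral>z. f (x + c *\<^sub>R z) * complex_of_real (gauss_density ((x + c *\<^sub>R z - x) /\<^sub>R c)) \<partial>lborel) = gauss_mean c f x"
    using c by (simp add: gauss_mean_def)
  finally show ?thesis using c by (simp add: scaleR_conv_of_real)
qed

lemma schwartz_bounded:
  fixes f :: "'a::euclidean_space \<Rightarrow> complex"
  assumes "f \<in> schwartz"
  obtains C where "C > 0" "\<And>x. norm (f x) \<le> C"
proof -
  from schwartz_decay_bound[OF assms] obtain C where C: "C > 0" "\<And>x. norm (f x) \<le> C * decay x" by metis
  have "norm (f x) \<le> C" for x
    using C(2)[of x] mult_left_mono[OF decay_le_1, of C x] C(1) by (smt (verit) mult.right_neutral)
  thus ?thesis using that C(1) by blast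
qed

theorem fourier_inv_fourier:
  fixes f :: "'a::euclidean_space \<Rightarrow> complex"
  assumes f: "f \<in> schwartz"
  shows "fourier (inv_fourier f) x = f x"
proof -
  note [measurable] = schwartz_borel[OF f] schwartz_borel[OF inv_fourier_schwartz[OF f]]
  define c where "c n = inverse (real (Suc n))" for n
  have c: "c n > 0" for n by (simp add: c_def)
  have c0: "c \<longlonglongrightarrow> 0" unfolding c_def by (rule LIMSEQ_inverse_real_of_nat)
  have A: "(\<lambda>n. \<integral>\<xi>. cis (- (x \<bullet> \<xi>)) * (complex_of_real (exp (- (c n * norm \<xi>)\<^sup>2 / 2)) * inv_fourier f \<xi>) \<partial>lborel)
    \<longlonglongrightarrow> (\<integral>\<xi>. cis (- (x \<bullet> \<xi>)) * inv_fourier f \<xi> \<partial>lborel)"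
  proof (rule integral_dominated_convergence[where w="\<lambda>\<xi>. norm (inv_fourier f \<xi>)"])
    have "(\<lambda>n. cis (- (x \<bullet> \<xi>)) * (complex_of_real (exp (- (c n * norm \<xi>)\<^sup>2 / 2)) * inv_fourier f \<xi>))
      \<longlonglongrightarrow> cis (- (x \<bullet> \<xi>)) * (complex_of_real (exp (- (0 * norm \<xi>)\<^sup>2 / 2)) * inv_fourier f \<xi>)" for \<xi>
      by (intro tendsto_intros c0)  simp
    thus "AE \<xi> in lborel. (\<lambda>n. cis (- (x \<bullet> \<xi>)) * (complex_of_real (exp (- (c n * norm \<xi>)\<^sup>2 / 2)) * inv_fourier f \<xi>))
      \<longlonglongrightarrow> cis (- (x \<bullet> \<xi>)) * inv_fourier f \<xi>" by simp
    show "AE \<xi> in lborel. norm (cis (- (x \<bullet> \<xi>)) * (complex_of_real (exp (- (c n * norm \<xi>)\<^sup>2 / 2)) * inv_fourier f \<xi>))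
      \<le> norm (inv_fourier f \<xi>)" for n
      by (auto simp: norm_mult intro!: mult_left_le_one_le)
  qed (use schwartz_integrable[OF inv_fourier_schwartz[OF f]] in auto)
  have B: "(\<lambda>n. gauss_mean (c n) f x) \<longlonglongrightarrow> (\<integral>z. f x * complex_of_real (gauss_density (z::'a)) \<partial>lborel)"
    unfolding gauss_mean_def
  proof -
    from schwartz_bounded[OF f] obtain C where C: "C > 0" "\<And>x. norm (f x) \<le> C" by metis
    show "(\<lambda>n. \<integral>z. f (x + c n *\<^sub>R z) * complex_of_real (gauss_density z) \<partial>lborel)
      \<longlonglongrightarrow> (\<integral>z. f x * complex_of_real (gauss_density (z::'a)) \<partial>lborel)"
    proof (rule integral_dominated_convergence[where w="\<lambda>z. C * gauss_density z"
          and f="\<lambda>z. f x * complex_of_real (gauss_density z)"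
          and s="\<lambda>n z. f (x + c n *\<^sub>R z) * complex_of_real (gauss_density z)"])
      have "(\<lambda>n. f (x + c n *\<^sub>R z) * complex_of_real (gauss_density z)) \<longlonglongrightarrow> f x * complex_of_real (gauss_density z)" for z
      proof (intro tendsto_intros)
        have "(\<lambda>n. x + c n *\<^sub>R z) \<longlonglongrightarrow> x + 0 *\<^sub>R z" by (intro tendsto_intros c0)
        moreover have "isCont f x" using schwartz_differentiable[OF f] differentiable_imp_continuous_within by blast
        ultimately show "(\<lambda>n. f (x + c n *\<^sub>R z)) \<longlonglongrightarrow> f x" by (auto intro: isCont_tendsto_compose)
      qed
      thus "AE z in lborel. (\<lambda>n. f (x + c n *\<^sub>R z) * complex_of_real (gauss_density z)) \<longlonglongrightarrow> f x * complex_of_real (gauss_density z)"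
        by simp
      show "AE z in lborel. norm (f (x + c n *\<^sub>R z) * complex_of_real (gauss_density z)) \<le> C * gauss_density z" for n
        using C by (auto simp: norm_mult abs_of_pos gauss_density_pos intro!: mult_right_mono less_imp_le[OF gauss_density_pos])
    qed (use gauss_density_integrable in auto)
  qed
  have "(\<integral>\<xi>. cis (- (x \<bullet> \<xi>)) * inv_fourier f \<xi> \<partial>lborel) = (\<integral>z. f x * complex_of_real (gauss_density (z::'a)) \<partial>lborel)"
    by (rule LIMSEQ_unique[OF A]) (use B in \<open>simp only: gauss_multiplier[OF f c]\<close>)
  also have "\<dots> = f x" by (simp add: integral_gauss_density)
  finally show ?thesis by (simp add: fourier_lborel inner_commute)
qed

lemma inv_fourier_fourier:
  fixes f :: "'a::euclidean_space \<Rightarrow> complex"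
  assumes f: "f \<in> schwartz"
  shows "inv_fourier (fourier f) x = f x"
proof -
  let ?P = "complex_of_real ((2 * pi) powr (- real DIM('a)))"
  note [measurable] = schwartz_borel[OF f] schwartz_borel[OF fourier_schwartz[OF f]]
  have "f x = (\<integral>\<xi>. cis (- (x \<bullet> \<xi>)) * (?P * fourier f (- \<xi>)) \<partial>lborel)"
    unfolding fourier_inv_fourier[OF f, of x, symmetric]
      fourier_lborel[OF schwartz_borel[OF inv_fourier_schwartz[OF f]]] inv_fourier_eq[symmetric]
    by (simp add: inner_commute)
  also have "\<dots> = ?P * (\<integral>\<xi>. cis (- (x \<bullet> \<xi>)) * fourier f (- \<xi>) \<partial>lborel)"
    by (subst Bochner_Integration.integral_mult_right_zero[symmetric]) (simp add: mult_ac)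
  also have "(\<integral>\<xi>. cis (- (x \<bullet> \<xi>)) * fourier f (- \<xi>) \<partial>lborel) = (\<integral>\<xi>. cis (x \<bullet> \<xi>) * fourier f \<xi> \<partial>lborel)"
    by (subst lborel_integral_affine[of _ "-1" 0]) auto
  also have "?P * \<dots> = inv_fourier (fourier f) x"
    by (simp add: inv_fourier_eq fourier_lborel[of "fourier f"] inner_commute)
  finally show ?thesis by simp
qed

section \<open>Subordination of Bessel potentials to the heat semigroup\<close>

definition bessel :: "real \<Rightarrow> ('a::euclidean_space \<Rightarrow> complex) \<Rightarrow> 'a \<Rightarrow> complex" where
  "bessel s \<phi> = fourier (\<lambda>\<xi>. complex_of_real ((1 + (norm \<xi>)\<^sup>2) powr (s / 2)) * inv_fourier \<phi> \<xi>)"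

lemma bessel_potential_eq: "bessel_potential s u \<phi> = u (bessel s \<phi>)"
  by (simp add: bessel_potential_def bessel_def)

lemma bessel_schwartz: "\<phi> \<in> schwartz \<Longrightarrow> bessel s \<phi> \<in> schwartz"
  unfolding bessel_def by (intro fourier_schwartz schwartz_symbol_mult[OF symbols.powr] inv_fourier_schwartz)

text \<open>Makes a distribution in H^{s,p} computable through its L^p representative:
  \<open>u \<phi>\<close> is \<open>bessel_potential s u\<close> evaluated at
  \<open>bessel (- s) \<phi>\<close>.\<close>

lemma bessel_inverse:
  fixes \<phi> :: "'a::euclidean_space \<Rightarrow> complex"
  assumes "\<phi> \<in> schwartz"
  shows "bessel s (bessel (- s) \<phi>) = \<phi>"
proof
  fix x
  have S: "(\<lambda>\<xi>. complex_of_real ((1 + (norm \<xi>)\<^sup>2) powr (- s / 2)) * inv_fourier \<phi> \<xi>) \<in> schwartz"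
    by (intro schwartz_symbol_mult[OF symbols.powr] inv_fourier_schwartz assms)
  have "complex_of_real ((1 + (norm \<xi>)\<^sup>2) powr (s / 2)) * inv_fourier (bessel (- s) \<phi>) \<xi> = inv_fourier \<phi> \<xi>" for \<xi> :: 'a
  proof -
    have "(1 + (norm \<xi>)\<^sup>2) powr (s / 2) * (1 + (norm \<xi>)\<^sup>2) powr (- s / 2) = 1"
      using add_pos_nonneg[of 1 "(norm \<xi>)\<^sup>2"] by (simp add: powr_add[symmetric])
    thus ?thesis
      unfolding bessel_def inv_fourier_fourier[OF S]
      by (metis (no_types, lifting) mult.assoc mult_1 of_real_1 of_real_mult)
  qed
  thus "bessel s (bessel (- s) \<phi>) x = \<phi> x"
    using fourier_inv_fourier[OF assms, of x] unfolding bessel_def[of s] by simp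
qed

lemma bessel_zero: "\<phi> \<in> schwartz \<Longrightarrow> bessel 0 \<phi> = \<phi>"
  using fourier_inv_fourier by (auto simp: bessel_def add_pos_nonneg[THEN less_imp_neq, symmetric])

text \<open>The Mellin weight. A potential of order \<open>s\<close> will use
  \<open>a = - s / 2\<close>, so both signs of \<open>a\<close> occur. The indicator lets integrals
  over positive times be taken over the whole line.\<close>

definition pow_weight :: "real \<Rightarrow> real \<Rightarrow> real" where
  "pow_weight a t = indicator {0<..} t * t powr (a - 1)"

lemma pow_weight_borel [measurable]: "pow_weight a \<in> borel_measurable borel"
  unfolding pow_weight_def[abs_def] by measurable

lemma pow_weight_nonneg: "0 \<le> pow_weight a t"
  by (simp add: pow_weight_def)

text \<open>Rescaling time turns any profile \<open>E\<close> into the power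
  \<open>l powr (- a)\<close>, where l will be 1 + |\<xi>|^2 or 2 / \<epsilon>^2. Only the constant
  depends on \<open>E\<close>, so any profile with a convergent integral may be chosen.\<close>

lemma nn_integral_pow_weight_scale:
  assumes [measurable]: "E \<in> borel_measurable borel" and l: "l > 0"
  shows "(\<integral>\<^sup>+t. ennreal (pow_weight a t * E (t * l)) \<partial>lborel) =
     ennreal (l powr (- a)) * (\<integral>\<^sup>+t. ennreal (pow_weight a t * E t) \<partial>lborel)"
proof -
  have "(\<integral>\<^sup>+t. ennreal (pow_weight a t * E t) \<partial>lborel) =
     ennreal l * (\<integral>\<^sup>+t. ennreal (pow_weight a (0 + l * t) * E (0 + l * t)) \<partial>lborel)"
    using l by (subst nn_integral_real_affine[where c=l and t=0]) auto
  also have "(\<integral>\<^sup>+t. ennreal (pow_weight a (0 + l * t) * E (0 + l * t)) \<partial>lborel) =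
     (\<integral>\<^sup>+t. ennreal (l powr (a - 1)) * ennreal (pow_weight a t * E (t * l)) \<partial>lborel)"
    using l by (intro nn_integral_cong)
      (auto simp: pow_weight_def powr_mult ennreal_mult'[symmetric] mult_ac zero_less_mult_iff split: split_indicator)
  also have "\<dots> = ennreal (l powr (a - 1)) * (\<integral>\<^sup>+t. ennreal (pow_weight a t * E (t * l)) \<partial>lborel)"
    by (rule nn_integral_cmult) measurable
  finally have *: "(\<integral>\<^sup>+t. ennreal (pow_weight a t * E t) \<partial>lborel) =
    ennreal (l * l powr (a - 1)) * (\<integral>\<^sup>+t. ennreal (pow_weight a t * E (t * l)) \<partial>lborel)"
    using l by (simp add: ennreal_mult mult.assoc)
  have "l powr (- a) * (l * l powr (a - 1)) = 1"
    using l by (simp add: powr_diff powr_minus field_simps)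
  hence "ennreal (l powr (- a)) * ennreal (l * l powr (a - 1)) = 1"
    using l by (simp add: ennreal_mult[symmetric])
  thus ?thesis unfolding * by (simp add: mult.assoc[symmetric])
qed

lemma nn_integral_pow_weight_exp:
  assumes "a > 0"
  shows "(\<integral>\<^sup>+t. ennreal (pow_weight a t * exp (- t)) \<partial>lborel) = ennreal (Gamma a)"
proof -
  have "ennreal (Gamma a) = (\<integral>\<^sup>+t. ennreal (indicator {0..} t * t powr (a - 1) / exp t) \<partial>lborel)"
    by (rule Gamma_conv_nn_integral_real[OF assms])
  also have "\<dots> = (\<integral>\<^sup>+t. ennreal (pow_weight a t * exp (- t)) \<partial>lborel)"
    by (intro nn_integral_cong) (auto simp: pow_weight_def exp_minus divide_inverse split: split_indicator)
  finally show ?thesis ..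
qed

text \<open>Convergence at 0 comes from \<open>0 < a + b\<close>, at infinity from
  \<open>a < 0\<close>. On the unit interval the power is compared with a Gamma integrand at the
  price of the factor \<open>exp 1\<close>.\<close>

lemma nn_integral_pow_weight_min:
  assumes "a < 0" "0 < a + b"
  shows "(\<integral>\<^sup>+t. ennreal (pow_weight a t * min 1 (t powr b)) \<partial>lborel) < \<infinity>"
proof -
  have "(\<integral>\<^sup>+t. ennreal (pow_weight a t * min 1 (t powr b)) \<partial>lborel) \<le>
    (\<integral>\<^sup>+t. ennreal (exp 1) * ennreal (pow_weight (a + b) t * exp (- t)) + ennreal (t powr (a - 1)) * indicator {1..} t \<partial>lborel)"
  proof (intro nn_integral_mono)
    fix t :: real
    consider "t \<le> 0" | "0 < t" "t \<le> 1" | "1 < t" by linarith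
    thus "ennreal (pow_weight a t * min 1 (t powr b)) \<le>
      ennreal (exp 1) * ennreal (pow_weight (a + b) t * exp (- t)) + ennreal (t powr (a - 1)) * indicator {1..} t"
    proof cases
      case 1 thus ?thesis by (simp add: pow_weight_def)
    next
      case 2
      have "pow_weight a t * min 1 (t powr b) \<le> t powr (a - 1) * t powr b"
        using 2 by (simp add: pow_weight_def)
      also have "\<dots> = pow_weight (a + b) t * 1"
        using 2 by (simp add: pow_weight_def powr_add[symmetric] algebra_simps)
      also have "\<dots> \<le> pow_weight (a + b) t * (exp 1 * exp (- t))"
        using 2 by (intro mult_left_mono pow_weight_nonneg) (simp add: exp_add[symmetric])
      finally have "ennreal (pow_weight a t * min 1 (t powr b)) \<le> ennreal (exp 1) * ennreal (pow_weight (a + b) t * exp (- t))"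
        by (subst ennreal_mult[symmetric]) (auto simp: pow_weight_nonneg mult_ac intro!: ennreal_leI)
      thus ?thesis by (rule order_trans) simp
    next
      case 3
      hence "pow_weight a t * min 1 (t powr b) \<le> t powr (a - 1)"
        by (simp add: pow_weight_def mult_left_le)
      hence "ennreal (pow_weight a t * min 1 (t powr b)) \<le> ennreal (t powr (a - 1)) * indicator {1..} t"
        using 3 by (simp add: ennreal_leI)
      thus ?thesis by (rule order_trans) simp
    qed
  qed
  also have "\<dots> = ennreal (exp 1) * ennreal (Gamma (a + b)) + (\<integral>\<^sup>+t. ennreal (t powr (a - 1)) * indicator {1..} t \<partial>lborel)"
    by (simp add: nn_integral_add nn_integral_cmult nn_integral_pow_weight_exp[OF assms(2)])
  also have "(\<integral>\<^sup>+t. ennreal (t powr (a - 1)) * indicator {1..} t \<partial>lborel) = ennreal (0 - 1 powr a / a)"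
  proof (rule nn_integral_FTC_atLeast)
    fix t :: real assume "1 \<le> t"
    thus "DERIV (\<lambda>t. t powr a / a) t :> t powr (a - 1)"
      using assms(1) by (auto intro!: derivative_eq_intros simp: powr_diff)
  next
    have "((\<lambda>t. t powr a / a) \<longlongrightarrow> 0 / a) at_top"
      by (intro tendsto_divide tendsto_neg_powr tendsto_const filterlim_ident) (use assms in auto)
    thus "((\<lambda>t. t powr a / a) \<longlongrightarrow> 0) at_top" by simp
  qed auto
  finally show ?thesis by (rule order.strict_trans1) (simp add: ennreal_mult_less_top)
qed

text \<open>For negative \<open>a\<close> the exponential profile diverges at 0, and 1 - exp (-t)
  takes its place. The constant is minus Gamma of \<open>a\<close>, but its finiteness and
  positivity are all that later steps ask for; the interval from 1 to 2 provides the latter.\<close>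

lemma pow_weight_one_minus_exp:
  assumes "- 1 < a" "a < 0"
  obtains K where "K > 0" "(\<integral>\<^sup>+t. ennreal (pow_weight a t * (1 - exp (- t))) \<partial>lborel) = ennreal K"
proof -
  let ?I = "\<integral>\<^sup>+t. ennreal (pow_weight a t * (1 - exp (- t))) \<partial>lborel"
  have "?I \<le> (\<integral>\<^sup>+t. ennreal (pow_weight a t * min 1 (t powr 1)) \<partial>lborel)"
  proof (intro nn_integral_mono ennreal_leI)
    fix t :: real
    show "pow_weight a t * (1 - exp (- t)) \<le> pow_weight a t * min 1 (t powr 1)"
    proof (cases "t > 0")
      case True
      have "1 - exp (- t) \<le> t" using exp_ge_add_one_self[of "- t"] by linarith
      with True show ?thesis by (intro mult_left_mono pow_weight_nonneg) auto
    qed (simp add: pow_weight_def)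
  qed
  also have "\<dots> < \<infinity>" using assms by (intro nn_integral_pow_weight_min) auto
  finally have fin: "?I < \<infinity>" .
  have "0 < ennreal (2 powr (a - 1) * (1 - exp (- 1))) * emeasure lborel {1..2::real}"
    by (simp add: ennreal_zero_less_mult_iff)
  also have "\<dots> = (\<integral>\<^sup>+t. ennreal (2 powr (a - 1) * (1 - exp (- 1))) * indicator {1..2::real} t \<partial>lborel)"
    by (simp add: nn_integral_cmult_indicator)
  also have "\<dots> \<le> ?I"
  proof (intro nn_integral_mono)
    fix t :: real
    show "ennreal (2 powr (a - 1) * (1 - exp (- 1))) * indicator {1..2} t \<le> ennreal (pow_weight a t * (1 - exp (- t)))"
    proof (cases "t \<in> {1..2}")
      case True
      hence "2 powr (a - 1) \<le> t powr (a - 1)" using assms by (intro powr_mono2') auto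
      with True show ?thesis by (auto simp: pow_weight_def intro!: ennreal_leI mult_mono)
    qed simp
  qed
  finally have "?I > 0" .
  with fin show ?thesis
    by (intro that[of "enn2real ?I"]) (auto simp: enn2real_positive_iff)
qed

text \<open>One Fubini argument for both signs of the order: \<open>h t l\<close> will be the Mellin
  weight times exp (-t l) or times 1 - exp (-t l). The variable \<open>l\<close> stands for 1 +
  |\<xi>|^2, hence the restriction to \<open>l \<ge> 1\<close>.\<close>

lemma subordination:
  fixes \<psi> :: "'a::euclidean_space \<Rightarrow> complex" and h :: "real \<Rightarrow> real \<Rightarrow> real" and x :: 'a
  assumes \<psi>: "\<psi> \<in> schwartz"
    and h[measurable]: "(\<lambda>(t, l). h t l) \<in> borel_measurable (borel \<Otimes>\<^sub>M borel)"
    and nonneg: "\<And>t l. 0 \<le> h t l"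
    and m: "\<And>l. l \<ge> 1 \<Longrightarrow> (\<integral>\<^sup>+t. ennreal (h t l) \<partial>lborel) = ennreal (c * l powr r)" and c: "c \<ge> 0"
  defines "J t \<equiv> (\<integral>\<xi>. cis (- (x \<bullet> \<xi>)) * (complex_of_real (h t (1 + (norm \<xi>)\<^sup>2)) * \<psi> \<xi>) \<partial>lborel)"
  shows "integrable lborel J"
    and "complex_of_real c * fourier (\<lambda>\<xi>. complex_of_real ((1 + (norm \<xi>)\<^sup>2) powr r) * \<psi> \<xi>) x = (\<integral>t. J t \<partial>lborel)"
proof -
  note [measurable] = schwartz_borel[OF \<psi>]
  let ?L = "\<lambda>\<xi>::'a. 1 + (norm \<xi>)\<^sup>2"
  let ?F = "\<lambda>\<xi> t. cis (- (x \<bullet> \<xi>)) * (complex_of_real (h t (?L \<xi>)) * \<psi> \<xi>)"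
  have S: "(\<lambda>\<xi>. complex_of_real (?L \<xi> powr r) * \<psi> \<xi>) \<in> schwartz"
    by (intro schwartz_symbol_mult[OF symbols.powr] \<psi>)
  have L1: "1 \<le> ?L \<xi>" for \<xi> by simp
  have ht: "integrable lborel (\<lambda>t. h t l)" if "l \<ge> 1" for l
    by (rule integrableI_nonneg) (auto simp: nonneg m[OF that])
  have hi: "(\<integral>t. h t l \<partial>lborel) = c * l powr r" if "l \<ge> 1" for l
    using c by (subst integral_eq_nn_integral) (auto simp: nonneg m[OF that])
  have int: "integrable (lborel \<Otimes>\<^sub>M lborel) (\<lambda>(\<xi>, t). ?F \<xi> t)"
  proof (rule lborel_pair.Fubini_integrable)
    show "(\<lambda>(\<xi>, t). ?F \<xi> t) \<in> borel_measurable (lborel \<Otimes>\<^sub>M lborel)" by measurable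
    have "integrable lborel (\<lambda>\<xi>. c * norm (complex_of_real (?L \<xi> powr r) * \<psi> \<xi>))"
      by (intro integrable_mult_right integrable_norm schwartz_integrable S)
    thus "integrable lborel (\<lambda>\<xi>. \<integral>t. norm (case (\<xi>, t) of (\<xi>, t) \<Rightarrow> ?F \<xi> t) \<partial>lborel)"
      by (simp add: norm_mult nonneg hi[OF L1] mult.assoc)
    show "AE \<xi> in lborel. integrable lborel (\<lambda>t. case (\<xi>, t) of (\<xi>, t) \<Rightarrow> ?F \<xi> t)"
      using ht[OF L1] by (auto intro!: integrable_mult_right integrable_mult_left integrable_of_real)
  qed
  show "integrable lborel J"
    unfolding J_def[abs_def] using lborel_pair.integrable_snd[OF int] by simp
  have "complex_of_real c * fourier (\<lambda>\<xi>. complex_of_real (?L \<xi> powr r) * \<psi> \<xi>) x =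
     (\<integral>\<xi>. complex_of_real c * (cis (- (x \<bullet> \<xi>)) * (complex_of_real (?L \<xi> powr r) * \<psi> \<xi>)) \<partial>lborel)"
    by (subst fourier_lborel[OF schwartz_borel[OF S]])
      (simp only: Bochner_Integration.integral_mult_right_zero inner_commute)
  also have "\<dots> = (\<integral>\<xi>. (\<integral>t. ?F \<xi> t \<partial>lborel) \<partial>lborel)"
    by (simp add: integral_complex_of_real hi[OF L1] mult_ac)
  also have "\<dots> = (\<integral>t. J t \<partial>lborel)"
    unfolding J_def by (rule lborel_pair.Fubini_integral[symmetric, OF int])
  finally show "complex_of_real c * fourier (\<lambda>\<xi>. complex_of_real (?L \<xi> powr r) * \<psi> \<xi>) x = (\<integral>t. J t \<partial>lborel)" .
qed

text \<open>A Gaussian average of width c has the multiplier exp (-c^2 |\<xi>|^2 / 2), so time t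
  corresponds to c = sqrt (2 t). The 1 in 1 + |\<xi>|^2 contributes the damping factor exp
  (-t).\<close>

lemma heat_multiplier:
  fixes \<phi> :: "'a::euclidean_space \<Rightarrow> complex"
  assumes "\<phi> \<in> schwartz" "t > 0"
  shows "(\<integral>\<xi>. cis (- (x \<bullet> \<xi>)) * (complex_of_real (exp (- (t * (1 + (norm \<xi>)\<^sup>2)))) * inv_fourier \<phi> \<xi>) \<partial>lborel) =
    complex_of_real (exp (- t)) * gauss_mean (sqrt (2 * t)) \<phi> x"
proof -
  have "exp (- (t * (1 + (norm \<xi>)\<^sup>2))) = exp (- t) * exp (- (sqrt (2 * t) * norm \<xi>)\<^sup>2 / 2)" for \<xi> :: 'a
    using assms(2) by (simp add: exp_add[symmetric] power_mult_distrib algebra_simps)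
  hence "(\<integral>\<xi>. cis (- (x \<bullet> \<xi>)) * (complex_of_real (exp (- (t * (1 + (norm \<xi>)\<^sup>2)))) * inv_fourier \<phi> \<xi>) \<partial>lborel) =
    (\<integral>\<xi>. complex_of_real (exp (- t)) * (cis (- (x \<bullet> \<xi>)) * (complex_of_real (exp (- (sqrt (2 * t) * norm \<xi>)\<^sup>2 / 2)) * inv_fourier \<phi> \<xi>)) \<partial>lborel)"
    by (simp add: mult_ac)
  also have "\<dots> = complex_of_real (exp (- t)) * gauss_mean (sqrt (2 * t)) \<phi> x"
    using assms by (simp only: Bochner_Integration.integral_mult_right_zero gauss_multiplier real_sqrt_gt_zero)
  finally show ?thesis .
qed

lemma bessel_negative_order:
  fixes \<phi> :: "'a::euclidean_space \<Rightarrow> complex" and x :: 'a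
  assumes \<phi>: "\<phi> \<in> schwartz" and a: "a > 0"
  defines "J t \<equiv> complex_of_real (pow_weight a t * exp (- t)) * gauss_mean (sqrt (2 * t)) \<phi> x"
  shows "integrable lborel J"
    and "complex_of_real (Gamma a) * bessel (- 2 * a) \<phi> x = (\<integral>t. J t \<partial>lborel)"
proof -
  let ?h = "\<lambda>t l. pow_weight a t * exp (- (t * l))"
  have J: "(\<integral>\<xi>. cis (- (x \<bullet> \<xi>)) * (complex_of_real (?h t (1 + (norm \<xi>)\<^sup>2)) * inv_fourier \<phi> \<xi>) \<partial>lborel) = J t" for t
  proof (cases "t > 0")
    case True
    have "(\<integral>\<xi>. cis (- (x \<bullet> \<xi>)) * (complex_of_real (?h t (1 + (norm \<xi>)\<^sup>2)) * inv_fourier \<phi> \<xi>) \<partial>lborel) =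
      (\<integral>\<xi>. complex_of_real (pow_weight a t) * (cis (- (x \<bullet> \<xi>)) * (complex_of_real (exp (- (t * (1 + (norm \<xi>)\<^sup>2)))) * inv_fourier \<phi> \<xi>)) \<partial>lborel)"
      by (simp add: mult_ac)
    also have "\<dots> = J t"
      by (simp only: Bochner_Integration.integral_mult_right_zero heat_multiplier[OF \<phi> True]) (simp add: J_def)
    finally show ?thesis .
  qed (simp add: pow_weight_def J_def)
  have m: "(\<integral>\<^sup>+t. ennreal (?h t l) \<partial>lborel) = ennreal (Gamma a * l powr (- a))" if "l \<ge> 1" for l
    using nn_integral_pow_weight_scale[of "\<lambda>t. exp (- t)" l a] that a Gamma_real_pos[OF a]
    by (simp add: nn_integral_pow_weight_exp ennreal_mult[symmetric] mult.commute)
  note sub = subordination[OF inv_fourier_schwartz[OF \<phi>], of ?h "Gamma a" "- a" x, unfolded J]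
  show "integrable lborel J"
    by (rule sub(1)) (use m Gamma_real_pos[OF a] in \<open>auto simp: pow_weight_nonneg\<close>)
  have "complex_of_real (Gamma a) * fourier (\<lambda>\<xi>. complex_of_real ((1 + (norm \<xi>)\<^sup>2) powr (- a)) * inv_fourier \<phi> \<xi>) x = (\<integral>t. J t \<partial>lborel)"
    by (rule sub(2)) (use m Gamma_real_pos[OF a] in \<open>auto simp: pow_weight_nonneg\<close>)
  thus "complex_of_real (Gamma a) * bessel (- 2 * a) \<phi> x = (\<integral>t. J t \<partial>lborel)"
    by (simp add: bessel_def)
qed

lemma bessel_positive_order:
  fixes \<phi> :: "'a::euclidean_space \<Rightarrow> complex" and x :: 'a
  assumes \<phi>: "\<phi> \<in> schwartz" and K: "(\<integral>\<^sup>+t. ennreal (pow_weight a t * (1 - exp (- t))) \<partial>lborel) = ennreal K" "K > 0"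
  defines "J t \<equiv> complex_of_real (pow_weight a t) * (\<phi> x - complex_of_real (exp (- t)) * gauss_mean (sqrt (2 * t)) \<phi> x)"
  shows "integrable lborel J"
    and "complex_of_real K * bessel (- 2 * a) \<phi> x = (\<integral>t. J t \<partial>lborel)"
proof -
  \<comment> \<open>\<open>subordination\<close> requires nonnegativity for all \<open>l\<close>,
    negative ones included; on the range \<open>l \<ge> 1\<close> the maximum changes
    nothing.\<close>
  let ?h = "\<lambda>t l. pow_weight a t * max 0 (1 - exp (- (t * l)))"
  have J: "(\<integral>\<xi>. cis (- (x \<bullet> \<xi>)) * (complex_of_real (?h t (1 + (norm \<xi>)\<^sup>2)) * inv_fourier \<phi> \<xi>) \<partial>lborel) = J t" for t
  proof (cases "t > 0")
    case True
    note [measurable] = schwartz_borel[OF inv_fourier_schwartz[OF \<phi>]]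
    have I1: "integrable lborel (\<lambda>\<xi>. cis (- (x \<bullet> \<xi>)) * inv_fourier \<phi> \<xi>)"
      using fourier_integrand_integrable[OF inv_fourier_schwartz[OF \<phi>], of x] by (simp add: inner_commute)
    have I2: "integrable lborel (\<lambda>\<xi>. cis (- (x \<bullet> \<xi>)) * (complex_of_real (exp (- (t * (1 + (norm \<xi>)\<^sup>2)))) * inv_fourier \<phi> \<xi>))"
      by (rule Bochner_Integration.integrable_bound[OF I1])
        (use True in \<open>auto simp: norm_mult intro!: mult_left_le_one_le mult_nonneg_nonneg add_nonneg_nonneg\<close>)
    have "(\<integral>\<xi>. cis (- (x \<bullet> \<xi>)) * (complex_of_real (?h t (1 + (norm \<xi>)\<^sup>2)) * inv_fourier \<phi> \<xi>) \<partial>lborel) =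
      (\<integral>\<xi>. complex_of_real (pow_weight a t) * (cis (- (x \<bullet> \<xi>)) * inv_fourier \<phi> \<xi> -
        cis (- (x \<bullet> \<xi>)) * (complex_of_real (exp (- (t * (1 + (norm \<xi>)\<^sup>2)))) * inv_fourier \<phi> \<xi>)) \<partial>lborel)"
    proof (intro Bochner_Integration.integral_cong refl)
      fix \<xi> :: 'a
      have "max 0 (1 - exp (- (t * (1 + (norm \<xi>)\<^sup>2)))) = 1 - exp (- (t * (1 + (norm \<xi>)\<^sup>2)))"
        using True by (auto simp: max_def intro!: mult_nonneg_nonneg add_nonneg_nonneg)
      thus "cis (- (x \<bullet> \<xi>)) * (complex_of_real (?h t (1 + (norm \<xi>)\<^sup>2)) * inv_fourier \<phi> \<xi>) =
        complex_of_real (pow_weight a t) * (cis (- (x \<bullet> \<xi>)) * inv_fourier \<phi> \<xi> -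
        cis (- (x \<bullet> \<xi>)) * (complex_of_real (exp (- (t * (1 + (norm \<xi>)\<^sup>2)))) * inv_fourier \<phi> \<xi>))"
        by (simp only: of_real_mult of_real_diff of_real_1 left_diff_distrib right_diff_distrib mult_1_left mult_ac)
    qed
    also have "\<dots> = complex_of_real (pow_weight a t) * ((\<integral>\<xi>. cis (- (x \<bullet> \<xi>)) * inv_fourier \<phi> \<xi> \<partial>lborel) -
      (\<integral>\<xi>. cis (- (x \<bullet> \<xi>)) * (complex_of_real (exp (- (t * (1 + (norm \<xi>)\<^sup>2)))) * inv_fourier \<phi> \<xi>) \<partial>lborel))"
      by (simp only: Bochner_Integration.integral_mult_right_zero Bochner_Integration.integral_diff[OF I1 I2])
    also have "(\<integral>\<xi>. cis (- (x \<bullet> \<xi>)) * inv_fourier \<phi> \<xi> \<partial>lborel) = \<phi> x"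
      using fourier_inv_fourier[OF \<phi>, of x] by (simp add: fourier_lborel inner_commute)
    finally show ?thesis by (simp only: heat_multiplier[OF \<phi> True] J_def)
  qed (simp add: pow_weight_def J_def)
  have m: "(\<integral>\<^sup>+t. ennreal (?h t l) \<partial>lborel) = ennreal (K * l powr (- a))" if "l \<ge> 1" for l
  proof -
    have eq: "pow_weight a t * max 0 (1 - exp (- t)) = pow_weight a t * (1 - exp (- t))" for t
      by (cases "0 < t") (auto simp: pow_weight_def max_def)
    show ?thesis
      using nn_integral_pow_weight_scale[of "\<lambda>t. max 0 (1 - exp (- t))" l a] that K(2)
      by (simp add: eq K ennreal_mult[symmetric] mult.commute)
  qed
  note sub = subordination[OF inv_fourier_schwartz[OF \<phi>], of ?h K "- a" x, unfolded J]
  show "integrable lborel J"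
    by (rule sub(1)) (use m K(2) in \<open>auto simp: pow_weight_nonneg\<close>)
  have "complex_of_real K * fourier (\<lambda>\<xi>. complex_of_real ((1 + (norm \<xi>)\<^sup>2) powr (- a)) * inv_fourier \<phi> \<xi>) x = (\<integral>t. J t \<partial>lborel)"
    by (rule sub(2)) (use m K(2) in \<open>auto simp: pow_weight_nonneg\<close>)
  thus "complex_of_real K * bessel (- 2 * a) \<phi> x = (\<integral>t. J t \<partial>lborel)"
    by (simp add: bessel_def)
qed

section \<open>Estimates for Bessel potentials\<close>

lemma gauss_first_moment:
  "(\<integral>\<^sup>+z. ennreal ((1 + norm z) * gauss_density (z::'a::euclidean_space)) \<partial>lborel) < \<infinity>"
proof -
  \<comment> \<open>The factor \<open>1 + norm z\<close> is absorbed into 2 exp (|z|^2 / 4). What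
    remains is exp (-|z|^2 / 4), the Gaussian of parameter c with c^2 = 1/2.\<close>
  let ?c = "sqrt (1/2)" and ?P = "(2 * pi) powr (- real DIM('a) / 2)"
  have "(\<integral>\<^sup>+z. ennreal ((1 + norm z) * gauss_density (z::'a)) \<partial>lborel) \<le>
     (\<integral>\<^sup>+z. ennreal (norm (2 * ?P * exp (- (?c * norm (z::'a))\<^sup>2 / 2))) \<partial>lborel)"
  proof (intro nn_integral_mono ennreal_leI)
    fix z :: 'a
    have "1 + norm z \<le> 2 * (1 + (norm z)\<^sup>2 / 4)"
      using zero_le_power2[of "norm z - 1"] by (simp add: power2_diff)
    also have "\<dots> \<le> 2 * exp ((norm z)\<^sup>2 / 4)"
      by (intro mult_left_mono exp_ge_add_one_self) auto
    finally have "(1 + norm z) * gauss_density z \<le> 2 * exp ((norm z)\<^sup>2 / 4) * (?P * exp (- (norm z)\<^sup>2 / 2))"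
      unfolding gauss_density_eq by (intro mult_right_mono) auto
    also have "\<dots> = 2 * ?P * exp ((norm z)\<^sup>2 / 4 + - (norm z)\<^sup>2 / 2)"
      by (simp only: exp_add mult_ac)
    also have "(norm z)\<^sup>2 / 4 + - (norm z)\<^sup>2 / 2 = - (?c * norm z)\<^sup>2 / 2"
      by (simp add: power_mult_distrib)
    finally show "(1 + norm z) * gauss_density z \<le> norm (2 * ?P * exp (- (?c * norm z)\<^sup>2 / 2))"
      by simp
  qed
  also have "\<dots> < \<infinity>"
  proof -
    have "integrable lborel (\<lambda>z::'a. 2 * ?P * exp (- (?c * norm z)\<^sup>2 / 2))"
      by (intro integrable_mult_right integrable_exp_norm_square) auto
    thus ?thesis unfolding integrable_iff_bounded by blast
  qed
  finally show ?thesis .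
qed

section \<open>Pointwise domination by Gaussian averages\<close>

lemma integrable_gauss_shift:
  fixes \<phi> :: "'a::euclidean_space \<Rightarrow> complex"
  assumes \<phi>: "\<phi> \<in> schwartz"
  shows "integrable lborel (\<lambda>z. \<phi> (x + c *\<^sub>R z) * complex_of_real (gauss_density z))"
proof -
  note [measurable] = schwartz_borel[OF \<phi>]
  from schwartz_bounded[OF \<phi>] obtain C where C: "C > 0" "\<And>x. norm (\<phi> x) \<le> C" by metis
  show ?thesis
    by (rule Bochner_Integration.integrable_bound[of _ "\<lambda>z. C * gauss_density z"])
      (use C gauss_density_integrable in \<open>auto simp: norm_mult abs_of_pos gauss_density_pos intro!: mult_right_mono less_imp_le[OF gauss_density_pos]\<close>)
qed

lemma norm_gauss_mean_le:
  fixes \<phi> :: "'a::euclidean_space \<Rightarrow> complex"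
  assumes \<phi>: "\<phi> \<in> schwartz"
  shows "ennreal (norm (gauss_mean c \<phi> x)) \<le> (\<integral>\<^sup>+z. ennreal (gauss_density z) * ennreal (norm (\<phi> (x + c *\<^sub>R z))) \<partial>lborel)"
  unfolding gauss_mean_def
  by (rule order_trans[OF integral_norm_bound_ennreal[OF integrable_gauss_shift[OF \<phi>]]])
    (auto simp: norm_mult ennreal_mult[symmetric] mult.commute gauss_density_pos abs_of_pos less_imp_le[OF gauss_density_pos])

lemma norm_diff_gauss_mean_le:
  fixes \<phi> :: "'a::euclidean_space \<Rightarrow> complex"
  assumes \<phi>: "\<phi> \<in> schwartz"
  shows "ennreal (norm (\<phi> x - gauss_mean c \<phi> x)) \<le> (\<integral>\<^sup>+z. ennreal (gauss_density z) * ennreal (norm (\<phi> (x + c *\<^sub>R z) - \<phi> x)) \<partial>lborel)"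
proof -
  have i: "integrable lborel (\<lambda>z. \<phi> x * complex_of_real (gauss_density (z::'a)))"
    by (intro integrable_mult_right integrable_of_real gauss_density_integrable)
  have "gauss_mean c \<phi> x - \<phi> x = (\<integral>z. \<phi> (x + c *\<^sub>R z) * complex_of_real (gauss_density z) - \<phi> x * complex_of_real (gauss_density z) \<partial>lborel)"
    by (subst Bochner_Integration.integral_diff[OF integrable_gauss_shift[OF \<phi>] i])
      (simp add: gauss_mean_def integral_complex_of_real integral_gauss_density)
  hence "norm (\<phi> x - gauss_mean c \<phi> x) = norm (\<integral>z. \<phi> (x + c *\<^sub>R z) * complex_of_real (gauss_density z) - \<phi> x * complex_of_real (gauss_density z) \<partial>lborel)"
    by (metis norm_minus_commute)
  also have "ennreal \<dots> \<le> (\<integral>\<^sup>+z. ennreal (norm (\<phi> (x + c *\<^sub>R z) * complex_of_real (gauss_density z) - \<phi> x * complex_of_real (gauss_density z))) \<partial>lborel)"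
    by (rule integral_norm_bound_ennreal[OF Bochner_Integration.integrable_diff[OF integrable_gauss_shift[OF \<phi>] i]])
  also have "\<dots> = (\<integral>\<^sup>+z. ennreal (gauss_density z) * ennreal (norm (\<phi> (x + c *\<^sub>R z) - \<phi> x)) \<partial>lborel)"
    by (intro nn_integral_cong)
      (simp only: left_diff_distrib[symmetric], simp add: norm_mult ennreal_mult[symmetric] mult.commute abs_of_pos gauss_density_pos less_imp_le[OF gauss_density_pos])
  finally show ?thesis .
qed

lemma bessel_negative_order_bound:
  fixes \<phi> :: "'a::euclidean_space \<Rightarrow> complex"
  assumes \<phi>: "\<phi> \<in> schwartz" and a: "a > 0"
  shows "ennreal (Gamma a) * ennreal (norm (bessel (- 2 * a) \<phi> x)) \<le>
    (\<integral>\<^sup>+t. ennreal (pow_weight a t * exp (- t)) *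
       (\<integral>\<^sup>+z. ennreal (gauss_density z) * ennreal (norm (\<phi> (x + sqrt (2 * t) *\<^sub>R z))) \<partial>lborel) \<partial>lborel)"
proof -
  have "ennreal (Gamma a) * ennreal (norm (bessel (- 2 * a) \<phi> x)) =
      ennreal (norm (complex_of_real (Gamma a) * bessel (- 2 * a) \<phi> x))"
    using Gamma_real_pos[OF a] by (simp add: norm_mult ennreal_mult)
  also have "\<dots> \<le> (\<integral>\<^sup>+t. ennreal (norm (complex_of_real (pow_weight a t * exp (- t)) * gauss_mean (sqrt (2 * t)) \<phi> x)) \<partial>lborel)"
    unfolding bessel_negative_order(2)[OF \<phi> a]
    by (rule integral_norm_bound_ennreal[OF bessel_negative_order(1)[OF \<phi> a]])
  also have "\<dots> = (\<integral>\<^sup>+t. ennreal (pow_weight a t * exp (- t)) * ennreal (norm (gauss_mean (sqrt (2 * t)) \<phi> x)) \<partial>lborel)"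
    by (intro nn_integral_cong) (simp add: norm_mult ennreal_mult pow_weight_nonneg)
  also have "\<dots> \<le> (\<integral>\<^sup>+t. ennreal (pow_weight a t * exp (- t)) *
       (\<integral>\<^sup>+z. ennreal (gauss_density z) * ennreal (norm (\<phi> (x + sqrt (2 * t) *\<^sub>R z))) \<partial>lborel) \<partial>lborel)"
    by (intro nn_integral_mono mult_left_mono norm_gauss_mean_le[OF \<phi>]) auto
  finally show ?thesis .
qed

text \<open>The integrand is split as (1 - e^(-t)) \<phi> + e^(-t) (\<phi> - P_t \<phi>): the first
  part integrates to \<open>K\<close> times |\<phi>|, and only the second sees the oscillation of
  \<phi>.\<close>

lemma bessel_positive_order_bound:
  fixes \<phi> :: "'a::euclidean_space \<Rightarrow> complex"
  assumes \<phi>: "\<phi> \<in> schwartz" and K: "(\<integral>\<^sup>+t. ennreal (pow_weight a t * (1 - exp (- t))) \<partial>lborel) = ennreal K" "K > 0"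
  shows "ennreal K * ennreal (norm (bessel (- 2 * a) \<phi> x)) \<le>
    (\<integral>\<^sup>+t. ennreal (pow_weight a t * (1 - exp (- t))) * ennreal (norm (\<phi> x)) + ennreal (pow_weight a t) *
       (\<integral>\<^sup>+z. ennreal (gauss_density z) * ennreal (norm (\<phi> (x + sqrt (2 * t) *\<^sub>R z) - \<phi> x)) \<partial>lborel) \<partial>lborel)"
proof -
  have "ennreal K * ennreal (norm (bessel (- 2 * a) \<phi> x)) =
      ennreal (norm (complex_of_real K * bessel (- 2 * a) \<phi> x))"
    using K(2) by (simp add: norm_mult ennreal_mult)
  also have "\<dots> \<le> (\<integral>\<^sup>+t. ennreal (norm (complex_of_real (pow_weight a t) *
      (\<phi> x - complex_of_real (exp (- t)) * gauss_mean (sqrt (2 * t)) \<phi> x))) \<partial>lborel)"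
    unfolding bessel_positive_order(2)[OF \<phi> K]
    by (rule integral_norm_bound_ennreal[OF bessel_positive_order(1)[OF \<phi> K]])
  also have "\<dots> \<le> (\<integral>\<^sup>+t. ennreal (pow_weight a t * (1 - exp (- t))) * ennreal (norm (\<phi> x)) + ennreal (pow_weight a t) *
       ennreal (norm (\<phi> x - gauss_mean (sqrt (2 * t)) \<phi> x)) \<partial>lborel)"
  proof (intro nn_integral_mono)
    fix t :: real
    let ?m = "gauss_mean (sqrt (2 * t)) \<phi> x"
    show "ennreal (norm (complex_of_real (pow_weight a t) * (\<phi> x - complex_of_real (exp (- t)) * ?m))) \<le>
      ennreal (pow_weight a t * (1 - exp (- t))) * ennreal (norm (\<phi> x)) + ennreal (pow_weight a t) * ennreal (norm (\<phi> x - ?m))"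
    proof (cases "t > 0")
      case True
      have "norm (\<phi> x - complex_of_real (exp (- t)) * ?m) =
        norm (complex_of_real (1 - exp (- t)) * \<phi> x + complex_of_real (exp (- t)) * (\<phi> x - ?m))"
        by (simp add: algebra_simps)
      also have "\<dots> \<le> (1 - exp (- t)) * norm (\<phi> x) + exp (- t) * norm (\<phi> x - ?m)"
        by (rule order_trans[OF norm_triangle_ineq]) (use True in \<open>simp only: norm_mult norm_of_real, simp\<close>)
      also have "\<dots> \<le> (1 - exp (- t)) * norm (\<phi> x) + norm (\<phi> x - ?m)"
        using True by (intro add_left_mono mult_left_le_one_le) auto
      finally have "pow_weight a t * norm (\<phi> x - complex_of_real (exp (- t)) * ?m) \<le>
        pow_weight a t * ((1 - exp (- t)) * norm (\<phi> x) + norm (\<phi> x - ?m))"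
        by (intro mult_left_mono pow_weight_nonneg)
      also have "\<dots> = (pow_weight a t * (1 - exp (- t))) * norm (\<phi> x) + pow_weight a t * norm (\<phi> x - ?m)"
        by (simp add: algebra_simps)
      finally have "norm (complex_of_real (pow_weight a t) * (\<phi> x - complex_of_real (exp (- t)) * ?m)) \<le>
        (pow_weight a t * (1 - exp (- t))) * norm (\<phi> x) + pow_weight a t * norm (\<phi> x - ?m)"
        by (simp add: norm_mult pow_weight_nonneg)
      hence "ennreal (norm (complex_of_real (pow_weight a t) * (\<phi> x - complex_of_real (exp (- t)) * ?m))) \<le>
        ennreal ((pow_weight a t * (1 - exp (- t))) * norm (\<phi> x) + pow_weight a t * norm (\<phi> x - ?m))"
        by (rule ennreal_leI)
      moreover have "0 \<le> pow_weight a t * (1 - exp (- t))"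
        using True by (intro mult_nonneg_nonneg pow_weight_nonneg) auto
      ultimately show ?thesis
        by (simp only: ennreal_plus ennreal_mult mult_nonneg_nonneg norm_ge_zero pow_weight_nonneg)
    qed (simp add: pow_weight_def)
  qed
  also have "\<dots> \<le> (\<integral>\<^sup>+t. ennreal (pow_weight a t * (1 - exp (- t))) * ennreal (norm (\<phi> x)) + ennreal (pow_weight a t) *
       (\<integral>\<^sup>+z. ennreal (gauss_density z) * ennreal (norm (\<phi> (x + sqrt (2 * t) *\<^sub>R z) - \<phi> x)) \<partial>lborel) \<partial>lborel)"
    by (intro nn_integral_mono add_left_mono mult_left_mono norm_diff_gauss_mean_le[OF \<phi>]) auto
  finally show ?thesis .
qed

text \<open>The hypotheses on \<open>W\<close> say that \<open>\<phi>\<close> has size \<open>W\<close> and oscillates at scale \<open>\<epsilon>\<close>;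
  \<open>G\<close> plays the part of a function in \<open>L\<^sup>p\<close>.\<close>

lemma bessel_estimate_negative:
  fixes \<phi> :: "'a::euclidean_space \<Rightarrow> complex" and G W :: "'a \<Rightarrow> ennreal"
  assumes \<phi>: "\<phi> \<in> schwartz" and [measurable]: "G \<in> borel_measurable borel"
    and s: "s < 0"
    and W: "\<And>x. ennreal (norm (\<phi> x)) \<le> W x"
    and B: "\<And>h. (\<integral>\<^sup>+x. G x * W (x + h) \<partial>lborel) \<le> B"
  shows "(\<integral>\<^sup>+x. G x * ennreal (norm (bessel s \<phi> x)) \<partial>lborel) \<le> B"
proof -
  define a where "a = - s / 2"
  have a: "a > 0" and sa: "s = - 2 * a" using s by (auto simp: a_def)
  note [measurable] = schwartz_borel[OF \<phi>] schwartz_borel[OF bessel_schwartz[OF \<phi>]]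
  have "ennreal (Gamma a) * (\<integral>\<^sup>+x. G x * ennreal (norm (bessel s \<phi> x)) \<partial>lborel) =
     (\<integral>\<^sup>+x. G x * (ennreal (Gamma a) * ennreal (norm (bessel s \<phi> x))) \<partial>lborel)"
    by (subst nn_integral_cmult[symmetric]) (auto simp: mult_ac)
  also have "\<dots> \<le> (\<integral>\<^sup>+x. G x * (\<integral>\<^sup>+t. ennreal (pow_weight a t * exp (- t)) *
       (\<integral>\<^sup>+z. ennreal (gauss_density z) * ennreal (norm (\<phi> (x + sqrt (2 * t) *\<^sub>R z))) \<partial>lborel) \<partial>lborel) \<partial>lborel)"
    unfolding sa by (intro nn_integral_mono mult_left_mono bessel_negative_order_bound \<phi> a) auto
  also have "\<dots> = (\<integral>\<^sup>+x. (\<integral>\<^sup>+t. (\<integral>\<^sup>+z. ennreal (pow_weight a t * exp (- t)) * (ennreal (gauss_density z) *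
      (G x * ennreal (norm (\<phi> (x + sqrt (2 * t) *\<^sub>R z))))) \<partial>lborel) \<partial>lborel) \<partial>lborel)"
    by (subst nn_integral_cmult[symmetric], measurable)+ (simp add: mult_ac)
  also have "\<dots> = (\<integral>\<^sup>+t. (\<integral>\<^sup>+x. (\<integral>\<^sup>+z. ennreal (pow_weight a t * exp (- t)) * (ennreal (gauss_density z) *
      (G x * ennreal (norm (\<phi> (x + sqrt (2 * t) *\<^sub>R z))))) \<partial>lborel) \<partial>lborel) \<partial>lborel)"
    by (rule lborel_pair.Fubini') measurable
  also have "\<dots> = (\<integral>\<^sup>+t. (\<integral>\<^sup>+z. (\<integral>\<^sup>+x. ennreal (pow_weight a t * exp (- t)) * (ennreal (gauss_density z) *
      (G x * ennreal (norm (\<phi> (x + sqrt (2 * t) *\<^sub>R z))))) \<partial>lborel) \<partial>lborel) \<partial>lborel)"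
    by (intro nn_integral_cong lborel_pair.Fubini') measurable
  also have "\<dots> = (\<integral>\<^sup>+t. (\<integral>\<^sup>+z. ennreal (pow_weight a t * exp (- t)) * (ennreal (gauss_density z) *
      (\<integral>\<^sup>+x. G x * ennreal (norm (\<phi> (x + sqrt (2 * t) *\<^sub>R z))) \<partial>lborel)) \<partial>lborel) \<partial>lborel)"
    by (subst nn_integral_cmult, measurable)+
  also have "\<dots> \<le> (\<integral>\<^sup>+t. (\<integral>\<^sup>+z. ennreal (pow_weight a t * exp (- t)) * (ennreal (gauss_density (z::'a)) * B) \<partial>lborel) \<partial>lborel)"
  proof (intro nn_integral_mono mult_left_mono)
    fix t :: real and z :: 'a
    show "(\<integral>\<^sup>+x. G x * ennreal (norm (\<phi> (x + sqrt (2 * t) *\<^sub>R z))) \<partial>lborel) \<le> B"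
      by (rule order_trans[OF nn_integral_mono[OF mult_left_mono[OF W]] B]) auto
  qed auto
  also have "\<dots> = ennreal (Gamma a) * B"
    by (simp add: nn_integral_cmult nn_integral_multc nn_integral_gauss_density nn_integral_pow_weight_exp[OF a])
  finally show ?thesis
    using Gamma_real_pos[OF a] by (simp add: ennreal_mult_le_mult_iff)
qed

text \<open>With h = sqrt (2 t) z the oscillation factor is at most 1 + |z| times min 1 (sqrt (2 t)
  / \<epsilon>). Against \<open>pow_weight a\<close> with a = -s/2 this converges at 0 because s <
  1, and the scaling rule with l = 2 / \<epsilon>^2 produces \<epsilon>^(-s). The constant precedes
  all other quantifiers, since the cutoffs it is applied to vary with \<epsilon>.\<close>

lemma bessel_estimate_positive:
  assumes s: "0 < s" "s < 1"
  obtains K where "K > 0"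
    "\<And>(\<phi> :: 'a::euclidean_space \<Rightarrow> complex) G W B \<epsilon>. \<phi> \<in> schwartz \<Longrightarrow> G \<in> borel_measurable borel \<Longrightarrow> W \<in> borel_measurable borel \<Longrightarrow>
       0 < \<epsilon> \<Longrightarrow> \<epsilon> \<le> 1 \<Longrightarrow> (\<And>x. ennreal (norm (\<phi> x)) \<le> W x) \<Longrightarrow>
       (\<And>x h. ennreal (norm (\<phi> (x + h) - \<phi> x)) \<le> ennreal (min 1 (norm h / \<epsilon>)) * (W x + W (x + h))) \<Longrightarrow>
       (\<And>h. (\<integral>\<^sup>+x. G x * W (x + h) \<partial>lborel) \<le> B) \<Longrightarrow>
       (\<integral>\<^sup>+x. G x * ennreal (norm (bessel s \<phi> x)) \<partial>lborel) \<le> ennreal (K * \<epsilon> powr (- max s 0)) * B"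
proof -
  define a where "a = - s / 2"
  have a: "- 1 < a" "a < 0" "0 < a + 1/2" and sa: "s = - 2 * a" using s by (auto simp: a_def)
  obtain K where K: "K > 0" "(\<integral>\<^sup>+t. ennreal (pow_weight a t * (1 - exp (- t))) \<partial>lborel) = ennreal K"
    using pow_weight_one_minus_exp[OF a(1,2)] by metis
  obtain M where M: "M \<ge> 0" "(\<integral>\<^sup>+z. ennreal ((1 + norm z) * gauss_density (z::'a)) \<partial>lborel) = ennreal M"
    using gauss_first_moment[where 'a='a] less_top_ennreal by (metis infinity_ennreal_def)
  obtain L where L: "L \<ge> 0" "(\<integral>\<^sup>+t. ennreal (pow_weight a t * min 1 (t powr (1/2))) \<partial>lborel) = ennreal L"
    using nn_integral_pow_weight_min[OF a(2,3)] less_top_ennreal by (metis infinity_ennreal_def)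
  \<comment> \<open>The first \<open>K\<close> stems from the damping term. In the other summand, 2
    counts the two copies of \<open>W\<close>, \<open>M\<close> is the Gaussian moment,
    \<open>L\<close> the time integral at unit scale, and \<open>2 powr (- a)\<close> a part of the
    scaling factor. Division by \<open>K\<close> undoes the normalisation of the potential.\<close>
  define R where "R = (K + 2 * M * (2 powr (- a) * L)) / K"
  have R: "R > 0" using K M L by (auto simp: R_def intro!: divide_pos_pos add_pos_nonneg)
  have RK: "R * K = K + 2 * M * (2 powr (- a) * L)" using K by (simp add: R_def)
  show ?thesis
  proof (rule that[OF R])
    fix \<phi> :: "'a \<Rightarrow> complex" and G W :: "'a \<Rightarrow> ennreal" and B :: ennreal and \<epsilon> :: real
    assume \<phi>: "\<phi> \<in> schwartz" and [measurable]: "G \<in> borel_measurable borel" "W \<in> borel_measurable borel"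
      and \<epsilon>: "0 < \<epsilon>" "\<epsilon> \<le> 1"
      and W: "\<And>x. ennreal (norm (\<phi> x)) \<le> W x"
      and osc: "\<And>x h. ennreal (norm (\<phi> (x + h) - \<phi> x)) \<le> ennreal (min 1 (norm h / \<epsilon>)) * (W x + W (x + h))"
      and B: "\<And>h. (\<integral>\<^sup>+x. G x * W (x + h) \<partial>lborel) \<le> B"
    note [measurable] = schwartz_borel[OF \<phi>] schwartz_borel[OF bessel_schwartz[OF \<phi>]]
    let ?w = "\<lambda>t. ennreal (pow_weight a t)" and ?v = "\<lambda>t. ennreal (pow_weight a t * (1 - exp (- t)))"
    let ?g = "\<lambda>z::'a. ennreal (gauss_density z)"
    let ?D = "\<lambda>t x z. ennreal (norm (\<phi> (x + sqrt (2 * t) *\<^sub>R z) - \<phi> x))"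
    have GW: "(\<integral>\<^sup>+x. G x * W x \<partial>lborel) \<le> B" using B[of 0] by simp
    have inner: "(\<integral>\<^sup>+x. G x * ?D t x z \<partial>lborel) \<le> ennreal ((1 + norm z) * min 1 (sqrt (2 * t) / \<epsilon>)) * (2 * B)"
      if t: "t > 0" for t z
    proof -
      have "(\<integral>\<^sup>+x. G x * ?D t x z \<partial>lborel) \<le>
        (\<integral>\<^sup>+x. ennreal (min 1 (norm (sqrt (2 * t) *\<^sub>R z) / \<epsilon>)) * (G x * W x + G x * W (x + sqrt (2 * t) *\<^sub>R z)) \<partial>lborel)"
        by (intro nn_integral_mono order_trans[OF mult_left_mono[OF osc]]) (auto simp: algebra_simps)
      also have "\<dots> = ennreal (min 1 (norm (sqrt (2 * t) *\<^sub>R z) / \<epsilon>)) *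
        ((\<integral>\<^sup>+x. G x * W x \<partial>lborel) + (\<integral>\<^sup>+x. G x * W (x + sqrt (2 * t) *\<^sub>R z) \<partial>lborel))"
        by (simp add: nn_integral_cmult nn_integral_add)
      also have "\<dots> \<le> ennreal ((1 + norm z) * min 1 (sqrt (2 * t) / \<epsilon>)) * (B + B)"
      proof (intro mult_mono add_mono GW B ennreal_leI)
        let ?q = "sqrt (2 * t) / \<epsilon>"
        have q: "?q \<ge> 0" using t \<epsilon> by simp
        have "norm (sqrt (2 * t) *\<^sub>R z) / \<epsilon> = norm z * ?q" using t by simp
        \<comment> \<open>Separates \<open>z\<close> from \<open>t\<close>, so that the two
          integrals factor.\<close>
        also have "min 1 (norm z * ?q) \<le> (1 + norm z) * min 1 ?q"
        proof (cases "?q \<le> 1")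
          case True thus ?thesis using q by (auto simp: min_def algebra_simps)
        next
          case False
          hence "min 1 ?q = 1" by simp
          moreover have "min 1 (norm z * ?q) \<le> 1 + norm z" by (rule order_trans[OF min.cobounded1]) simp
          ultimately show ?thesis by simp
        qed
        finally show "min 1 (norm (sqrt (2 * t) *\<^sub>R z) / \<epsilon>) \<le> (1 + norm z) * min 1 (sqrt (2 * t) / \<epsilon>)" .
      qed auto
      finally show ?thesis by (simp only: mult_2)
    qed
    have "ennreal K * (\<integral>\<^sup>+x. G x * ennreal (norm (bessel s \<phi> x)) \<partial>lborel) =
       (\<integral>\<^sup>+x. G x * (ennreal K * ennreal (norm (bessel s \<phi> x))) \<partial>lborel)"
      by (subst nn_integral_cmult[symmetric]) (auto simp: mult_ac)
    also have "\<dots> \<le> (\<integral>\<^sup>+x. G x * (\<integral>\<^sup>+t. ?v t * ennreal (norm (\<phi> x)) + ?w t * (\<integral>\<^sup>+z. ?g z * ?D t x z \<partial>lborel) \<partial>lborel) \<partial>lborel)"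
      unfolding sa by (intro nn_integral_mono mult_left_mono bessel_positive_order_bound \<phi> K) auto
    also have "\<dots> = (\<integral>\<^sup>+x. (\<integral>\<^sup>+t. ?v t * (G x * ennreal (norm (\<phi> x))) + (\<integral>\<^sup>+z. ?w t * (?g z * (G x * ?D t x z)) \<partial>lborel) \<partial>lborel) \<partial>lborel)"
      by (subst nn_integral_cmult[symmetric], measurable)+ (simp add: mult_ac distrib_left nn_integral_cmult[symmetric])
    also have "\<dots> = (\<integral>\<^sup>+t. (\<integral>\<^sup>+x. ?v t * (G x * ennreal (norm (\<phi> x))) + (\<integral>\<^sup>+z. ?w t * (?g z * (G x * ?D t x z)) \<partial>lborel) \<partial>lborel) \<partial>lborel)"
      by (rule lborel_pair.Fubini') measurable
    also have "\<dots> = (\<integral>\<^sup>+t. ?v t * (\<integral>\<^sup>+x. G x * ennreal (norm (\<phi> x)) \<partial>lborel) + (\<integral>\<^sup>+x. (\<integral>\<^sup>+z. ?w t * (?g z * (G x * ?D t x z)) \<partial>lborel) \<partial>lborel) \<partial>lborel)"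
      by (simp add: nn_integral_add nn_integral_cmult)
    also have "\<dots> = (\<integral>\<^sup>+t. ?v t * (\<integral>\<^sup>+x. G x * ennreal (norm (\<phi> x)) \<partial>lborel) + (\<integral>\<^sup>+z. (\<integral>\<^sup>+x. ?w t * (?g z * (G x * ?D t x z)) \<partial>lborel) \<partial>lborel) \<partial>lborel)"
      by (intro nn_integral_cong arg_cong2[where f="(+)"] refl lborel_pair.Fubini') measurable
    also have "\<dots> = (\<integral>\<^sup>+t. ?v t * (\<integral>\<^sup>+x. G x * ennreal (norm (\<phi> x)) \<partial>lborel) + ?w t * (\<integral>\<^sup>+z. ?g z * (\<integral>\<^sup>+x. G x * ?D t x z \<partial>lborel) \<partial>lborel) \<partial>lborel)"
      by (simp add: nn_integral_cmult)
    also have "\<dots> \<le> (\<integral>\<^sup>+t. ?v t * B + ennreal (pow_weight a t * min 1 ((t * (2 / \<epsilon>\<^sup>2)) powr (1/2))) * (ennreal M * (2 * B)) \<partial>lborel)"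
    proof (intro nn_integral_mono add_mono mult_left_mono)
      show "(\<integral>\<^sup>+x. G x * ennreal (norm (\<phi> x)) \<partial>lborel) \<le> B"
        by (rule order_trans[OF nn_integral_mono[OF mult_left_mono[OF W]] GW]) auto
      fix t :: real
      show "?w t * (\<integral>\<^sup>+z. ?g z * (\<integral>\<^sup>+x. G x * ?D t x z \<partial>lborel) \<partial>lborel) \<le>
        ennreal (pow_weight a t * min 1 ((t * (2 / \<epsilon>\<^sup>2)) powr (1/2))) * (ennreal M * (2 * B))"
      proof (cases "t > 0")
        case t: True
        have "(\<integral>\<^sup>+z. ?g z * (\<integral>\<^sup>+x. G x * ?D t x z \<partial>lborel) \<partial>lborel) \<le>
          (\<integral>\<^sup>+z. ?g z * (ennreal ((1 + norm z) * min 1 (sqrt (2 * t) / \<epsilon>)) * (2 * B)) \<partial>lborel)"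
          by (intro nn_integral_mono mult_left_mono inner t) auto
        also have "\<dots> = (\<integral>\<^sup>+z. ennreal ((1 + norm z) * gauss_density (z::'a)) * (ennreal (min 1 (sqrt (2 * t) / \<epsilon>)) * (2 * B)) \<partial>lborel)"
          using t \<epsilon> by (intro nn_integral_cong) (simp add: ennreal_mult less_imp_le[OF gauss_density_pos] mult_ac)
        also have "\<dots> = ennreal M * (ennreal (min 1 (sqrt (2 * t) / \<epsilon>)) * (2 * B))"
          by (simp add: nn_integral_multc M)
        also have "sqrt (2 * t) / \<epsilon> = (t * (2 / \<epsilon>\<^sup>2)) powr (1/2)"
          using t \<epsilon> by (simp add: powr_half_sqrt real_sqrt_divide mult.commute)
        finally have "?w t * (\<integral>\<^sup>+z. ?g z * (\<integral>\<^sup>+x. G x * ?D t x z \<partial>lborel) \<partial>lborel) \<le>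
          ?w t * (ennreal M * (ennreal (min 1 ((t * (2 / \<epsilon>\<^sup>2)) powr (1/2))) * (2 * B)))"
          by (intro mult_left_mono) auto
        thus ?thesis using t \<epsilon> by (simp add: ennreal_mult pow_weight_nonneg mult_ac)
      qed (simp add: pow_weight_def)
    qed auto
    also have "\<dots> = ennreal K * B + (\<integral>\<^sup>+t. ennreal (pow_weight a t * min 1 ((t * (2 / \<epsilon>\<^sup>2)) powr (1/2))) \<partial>lborel) * (ennreal M * (2 * B))"
      by (simp add: nn_integral_add nn_integral_multc K)
    also have "(\<integral>\<^sup>+t. ennreal (pow_weight a t * min 1 ((t * (2 / \<epsilon>\<^sup>2)) powr (1/2))) \<partial>lborel) = ennreal ((2 / \<epsilon>\<^sup>2) powr (- a)) * ennreal L"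
      using nn_integral_pow_weight_scale[of "\<lambda>t. min 1 (t powr (1/2))" "2 / \<epsilon>\<^sup>2" a] \<epsilon> by (simp add: L)
    also have "(2 / \<epsilon>\<^sup>2) powr (- a) = 2 powr (- a) * \<epsilon> powr (- s)"
    proof -
      have "\<epsilon>\<^sup>2 powr (- a) = \<epsilon> powr s"
        using \<epsilon> powr_powr[of \<epsilon> 2 "- a"] by (simp add: sa)
      thus ?thesis
        using \<epsilon> powr_divide[of 2 "\<epsilon>\<^sup>2" "- a"] powr_minus[of \<epsilon> s] by (simp only: divide_inverse)
    qed
    also have "ennreal K * B + ennreal (2 powr (- a) * \<epsilon> powr (- s)) * ennreal L * (ennreal M * (2 * B)) \<le>
      ennreal (K * \<epsilon> powr (- s)) * B + ennreal (2 powr (- a) * \<epsilon> powr (- s)) * ennreal L * (ennreal M * (2 * B))"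
    proof (intro add_right_mono mult_right_mono ennreal_leI)
      \<comment> \<open>Since \<epsilon> is at most 1, the term without a power of \<epsilon> is
        absorbed into the one with it.\<close>
      have "1 \<le> \<epsilon> powr (- s)" using powr_mono2'[of "- s" \<epsilon> 1] s \<epsilon> by simp
      thus "K \<le> K * \<epsilon> powr (- s)" using K by simp
    qed auto
    also have "\<dots> = ennreal (K * \<epsilon> powr (- s)) * B + ennreal (2 * M * (2 powr (- a) * L) * \<epsilon> powr (- s)) * B"
    proof -
      have "ennreal (2 powr (- a) * \<epsilon> powr (- s)) * ennreal L * (ennreal M * (2 * B)) =
        (ennreal (2 powr (- a) * \<epsilon> powr (- s)) * ennreal L * ennreal M * ennreal 2) * B"
        by (simp add: mult_ac)
      also have "ennreal (2 powr (- a) * \<epsilon> powr (- s)) * ennreal L * ennreal M * ennreal 2 =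
        ennreal (2 powr (- a) * \<epsilon> powr (- s) * L * M * 2)"
        using L M by (simp only: ennreal_mult[symmetric] mult_nonneg_nonneg powr_ge_zero zero_le_numeral)
      finally show ?thesis by (simp add: mult_ac)
    qed
    also have "\<dots> = ennreal (R * K * \<epsilon> powr (- s)) * B"
      unfolding RK using K L M by (subst distrib_right[symmetric], subst ennreal_plus[symmetric]) (auto simp: distrib_right)
    also have "\<dots> = ennreal K * (ennreal (R * \<epsilon> powr (- s)) * B)"
    proof -
      have "ennreal (R * K * \<epsilon> powr (- s)) = ennreal K * ennreal (R * \<epsilon> powr (- s))"
        using K R by (subst ennreal_mult[symmetric]) (auto simp: mult_ac)
      thus ?thesis by (simp only: mult.assoc)
    qed
    finally have "(\<integral>\<^sup>+x. G x * ennreal (norm (bessel s \<phi> x)) \<partial>lborel) \<le> ennreal (R * \<epsilon> powr (- s)) * B"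
      using K by (simp add: ennreal_mult_le_mult_iff)
    thus "(\<integral>\<^sup>+x. G x * ennreal (norm (bessel s \<phi> x)) \<partial>lborel) \<le> ennreal (R * \<epsilon> powr (- max s 0)) * B"
      using s by (simp add: max_def)
  qed
qed

text \<open>Joins the ranges of the order: for s <= 0 the potential is the identity or is dominated
  by an average of translates of total mass 1, and no power of \<epsilon> is lost.\<close>

lemma bessel_estimate:
  assumes s: "s < 1"
  obtains K where "K > 0"
    "\<And>(\<phi> :: 'a::euclidean_space \<Rightarrow> complex) G W B \<epsilon>. \<phi> \<in> schwartz \<Longrightarrow> G \<in> borel_measurable borel \<Longrightarrow> W \<in> borel_measurable borel \<Longrightarrow>
       0 < \<epsilon> \<Longrightarrow> \<epsilon> \<le> 1 \<Longrightarrow> (\<And>x. ennreal (norm (\<phi> x)) \<le> W x) \<Longrightarrow>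
       (\<And>x h. ennreal (norm (\<phi> (x + h) - \<phi> x)) \<le> ennreal (min 1 (norm h / \<epsilon>)) * (W x + W (x + h))) \<Longrightarrow>
       (\<And>h. (\<integral>\<^sup>+x. G x * W (x + h) \<partial>lborel) \<le> B) \<Longrightarrow>
       (\<integral>\<^sup>+x. G x * ennreal (norm (bessel s \<phi> x)) \<partial>lborel) \<le> ennreal (K * \<epsilon> powr (- max s 0)) * B"
proof (cases "s > 0")
  case True
  show ?thesis by (rule bessel_estimate_positive[OF True s, where 'a='a]) (fact that)
next
  case False
  show ?thesis
  proof (rule that[of 1])
    fix \<phi> :: "'a \<Rightarrow> complex" and G W :: "'a \<Rightarrow> ennreal" and B :: ennreal and \<epsilon> :: real
    assume \<phi>: "\<phi> \<in> schwartz" and G: "G \<in> borel_measurable borel" and \<epsilon>: "0 < \<epsilon>"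
      and W: "\<And>x. ennreal (norm (\<phi> x)) \<le> W x"
      and B: "\<And>h. (\<integral>\<^sup>+x. G x * W (x + h) \<partial>lborel) \<le> B"
    have "(\<integral>\<^sup>+x. G x * ennreal (norm (bessel s \<phi> x)) \<partial>lborel) \<le> B"
    proof (cases "s = 0")
      case True
      have "(\<integral>\<^sup>+x. G x * ennreal (norm (\<phi> x)) \<partial>lborel) \<le> (\<integral>\<^sup>+x. G x * W (x + 0) \<partial>lborel)"
        by (intro nn_integral_mono mult_left_mono) (auto intro: W)
      thus ?thesis using B[of 0] unfolding True bessel_zero[OF \<phi>] by (rule order_trans)
    qed (use False in \<open>auto intro!: bessel_estimate_negative[OF \<phi> G _ W B]\<close>)
    thus "(\<integral>\<^sup>+x. G x * ennreal (norm (bessel s \<phi> x)) \<partial>lborel) \<le> ennreal (1 * \<epsilon> powr (- max s 0)) * B"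
      using False \<epsilon> by (simp add: max_def)
  qed simp
qed

section \<open>Smooth cutoffs and supports of distributions\<close>

text \<open>This is exp (-1/t) / t^k, extended by 0. The index \<open>k\<close> makes the family
  closed under differentiation up to linear combinations, so smoothness at 0 costs one
  computation.\<close>

definition flat :: "nat \<Rightarrow> real \<Rightarrow> real" where
  "flat k t = (if t > 0 then exp (- inverse t) * inverse t ^ k else 0)"

lemma power_le_fact_exp:
  fixes u :: real
  assumes "u \<ge> 0"
  shows "u ^ k \<le> fact k * exp u"
proof -
  have "(\<Sum>n\<in>{k}. u ^ n /\<^sub>R fact n) \<le> (\<Sum>n. u ^ n /\<^sub>R fact n)"
    using assms by (intro sum_le_suminf summable_exp_generic) auto
  thus ?thesis by (simp add: exp_def field_simps)
qed

lemma flat_nonneg: "0 \<le> flat k t"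
  by (simp add: flat_def)

lemma flat_bound: "flat k t \<le> fact k"
proof (cases "t > 0")
  case True
  hence "inverse t ^ k \<le> fact k * exp (inverse t)" by (intro power_le_fact_exp) simp
  hence "exp (- inverse t) * inverse t ^ k \<le> exp (- inverse t) * (fact k * exp (inverse t))"
    by (intro mult_left_mono) auto
  also have "\<dots> = fact k" by (simp add: exp_minus)
  finally show ?thesis using True by (simp add: flat_def)
qed (simp add: flat_def)

text \<open>A factor t^2 is bought with two steps in the index. Vanishing to second order gives the
  derivative 0 at the point where the two branches meet.\<close>

lemma flat_small: "t > 0 \<Longrightarrow> flat k t \<le> fact (k + 2) * t\<^sup>2"
proof -
  assume t: "t > 0"
  have "flat k t = flat (k + 2) t * t\<^sup>2"
    using t by (simp add: flat_def power_add field_simps power2_eq_square)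
  also have "\<dots> \<le> fact (k + 2) * t\<^sup>2" by (intro mult_right_mono flat_bound) auto
  finally show ?thesis .
qed

lemma flat_has_derivative: "(flat k has_real_derivative (flat (k + 2) t - real k * flat (k + 1) t)) (at t)"
proof -
  consider "t > 0" | "t < 0" | "t = 0" by linarith
  thus ?thesis
  proof cases
    case 1
    have pow: "n \<noteq> 0 \<Longrightarrow> t * t ^ (n - Suc 0) = t ^ n" for n by (cases n) auto
    have "((\<lambda>t. exp (- inverse t) * inverse t ^ k) has_real_derivative
       (flat (k + 2) t - real k * flat (k + 1) t)) (at t)"
      using 1 by (cases k; cases "k - 1"; auto intro!: derivative_eq_intros simp: flat_def field_simps power2_eq_square; metis pow)
    moreover have "\<forall>\<^sub>F x in nhds t. x > 0" using 1 by (intro order_tendstoD(1)[OF filterlim_ident])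
    ultimately show ?thesis
      by (subst DERIV_cong_ev[OF refl _ refl, where g="\<lambda>t. exp (- inverse t) * inverse t ^ k"])
        (auto simp: flat_def elim!: eventually_mono)
  next
    case 2
    have "\<forall>\<^sub>F x in nhds t. x < 0" using 2 by (intro order_tendstoD(2)[OF filterlim_ident])
    thus ?thesis using 2
      by (subst DERIV_cong_ev[OF refl _ refl, where g="\<lambda>t. 0"])
        (auto simp: flat_def elim!: eventually_mono)
  next
    case 3
    have "((\<lambda>h. flat k h / h) \<longlongrightarrow> 0) (at 0)"
    proof (rule tendsto_rabs_zero_cancel, rule tendsto_sandwich[of "\<lambda>_. 0"])
      show "\<forall>\<^sub>F h in at 0. \<bar>flat k h / h\<bar> \<le> fact (k + 2) * \<bar>h\<bar>"
      proof (intro always_eventually allI)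
        fix h :: real
        show "\<bar>flat k h / h\<bar> \<le> fact (k + 2) * \<bar>h\<bar>"
        proof (cases "h > 0")
          case True
          with flat_small[OF True, of k] flat_nonneg[of k h] show ?thesis
            by (simp add: divide_le_eq power2_eq_square mult.assoc)
        next
          case False
          hence "\<bar>flat k h / h\<bar> = 0" by (simp add: flat_def)
          thus ?thesis using mult_nonneg_nonneg[OF fact_ge_zero abs_ge_zero] by (simp only:)
        qed
      qed
      show "((\<lambda>h::real. fact (k + 2) * \<bar>h\<bar>) \<longlongrightarrow> 0) (at 0)"
        by (auto intro!: tendsto_eq_intros)
    qed auto
    thus ?thesis using 3 by (simp add: DERIV_def flat_def)
  qed
qed

text \<open>Derivatives of the bump flat 0 (\<delta>^2 - |x|^2) are sums of polynomials times flat
  functions of higher index. Allowing all symbols as coefficients reuses their closure under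
  derivatives, and every member still vanishes off the ball of radius \<delta>.\<close>

inductive_set bump_span :: "real \<Rightarrow> ('a::euclidean_space \<Rightarrow> complex) set" for \<delta> where
  mult: "g \<in> symbols \<Longrightarrow> (\<lambda>x. g x * complex_of_real (flat k (\<delta>\<^sup>2 - (norm x)\<^sup>2))) \<in> bump_span \<delta>"
| add: "f \<in> bump_span \<delta> \<Longrightarrow> g \<in> bump_span \<delta> \<Longrightarrow> (\<lambda>x. f x + g x) \<in> bump_span \<delta>"

lemma bump_span_has_derivative:
  assumes "h \<in> bump_span \<delta>"
  shows "\<exists>F. (\<forall>x. (h has_derivative F x) (at x)) \<and> (\<forall>v. (\<lambda>x. F x v) \<in> bump_span \<delta>)"
  using assms
proof induction
  case (mult g k)
  obtain G where G: "\<And>x. (g has_derivative G x) (at x)" "\<And>v. (\<lambda>x. G x v) \<in> symbols"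
    using symbols_has_derivative[OF mult] by blast
  let ?t = "\<lambda>x::'a. \<delta>\<^sup>2 - (norm x)\<^sup>2"
  let ?e = "\<lambda>j x. complex_of_real (flat j (?t x))"
  have e: "(?e k has_derivative (\<lambda>v. complex_of_real (- 2 * (x \<bullet> v)) * (?e (k + 2) x - complex_of_real (real k) * ?e (k + 1) x))) (at x)" for x
  proof -
    have "((\<lambda>x. flat k (\<delta>\<^sup>2 - x \<bullet> x)) has_derivative
      (\<lambda>v. (0 - (x \<bullet> v + v \<bullet> x)) * (flat (k + 2) (\<delta>\<^sup>2 - x \<bullet> x) - real k * flat (k + 1) (\<delta>\<^sup>2 - x \<bullet> x)))) (at x)"
      by (rule DERIV_compose_FDERIV[OF flat_has_derivative]) (intro derivative_intros)
    from has_derivative_of_real[OF this, where 'a=complex] show ?thesis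
      by (simp add: power2_norm_eq_inner inner_commute)
  qed
  show ?case
  proof (intro exI conjI allI)
    fix x
    show "((\<lambda>x. g x * ?e k x) has_derivative (\<lambda>v. g x * (complex_of_real (- 2 * (x \<bullet> v)) * (?e (k + 2) x - complex_of_real (real k) * ?e (k + 1) x))
        + G x v * ?e k x)) (at x)"
      by (rule has_derivative_mult[OF G(1) e])
  next
    fix v
    have "(\<lambda>x. ((- 2) * (complex_of_real (x \<bullet> v) * g x)) * ?e (k + 2) x +
      (((2 * complex_of_real (real k)) * (complex_of_real (x \<bullet> v) * g x)) * ?e (k + 1) x + G x v * ?e k x)) \<in> bump_span \<delta>"
      by (intro bump_span.intros symbols.mult[OF symbols.const] symbols.mult[OF symbols.lin] mult G)
    thus "(\<lambda>x. g x * (complex_of_real (- 2 * (x \<bullet> v)) * (?e (k + 2) x - complex_of_real (real k) * ?e (k + 1) x))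
        + G x v * ?e k x) \<in> bump_span \<delta>"
      by (simp add: algebra_simps)
  qed
next
  case (add f g)
  then obtain F G where "\<And>x. (f has_derivative F x) (at x)" "\<And>v. (\<lambda>x. F x v) \<in> bump_span \<delta>"
    "\<And>x. (g has_derivative G x) (at x)" "\<And>v. (\<lambda>x. G x v) \<in> bump_span \<delta>" by blast
  thus ?case
    by (intro exI[of _ "\<lambda>x v. F x v + G x v"]) (auto intro!: has_derivative_add bump_span.intros)
qed

lemma bump_span_bounded:
  assumes "h \<in> bump_span \<delta>" "\<delta> > 0"
  shows "(\<exists>C. \<forall>x. norm (h x) \<le> C) \<and> (\<forall>x. norm x \<ge> \<delta> \<longrightarrow> h x = 0)"
  using assms
proof induction
  case (mult g k)
  from slow_growth_bound[OF symbols_slow_growth[OF mult(1)]] obtain C N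
    where C: "C > 0" "\<And>x. norm (g x) \<le> C * (1 + (norm x)\<^sup>2) ^ N" by metis
  have zero: "flat k (\<delta>\<^sup>2 - (norm x)\<^sup>2) = 0" if "norm x \<ge> \<delta>" for x :: 'a
  proof -
    have "\<not> 0 < \<delta>\<^sup>2 - (norm x)\<^sup>2" using power_mono[OF that, of 2] mult(2) by linarith
    thus ?thesis by (simp only: flat_def if_False)
  qed
  have "norm (g x * complex_of_real (flat k (\<delta>\<^sup>2 - (norm x)\<^sup>2))) \<le> C * (1 + \<delta>\<^sup>2) ^ N * fact k" for x
  proof (cases "norm x \<ge> \<delta>")
    case True
    thus ?thesis using C(1) by (simp add: zero)
  next
    case False
    have "norm (g x) \<le> C * (1 + (norm x)\<^sup>2) ^ N" by (rule C)
    also have "\<dots> \<le> C * (1 + \<delta>\<^sup>2) ^ N"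
      using C(1) False by (intro mult_left_mono power_mono add_left_mono) auto
    finally show ?thesis unfolding norm_mult norm_of_real
      using flat_bound[of k] flat_nonneg[of k] C(1) by (intro mult_mono) auto
  qed
  thus ?case using zero by auto
next
  case (add f g)
  then obtain C D where "\<And>x. norm (f x) \<le> C" "\<And>x. norm (g x) \<le> D" by blast
  hence "norm (f x + g x) \<le> C + D" for x by (meson add_mono norm_triangle_le)
  thus ?case using add by auto
qed

lemma bump_span_schwartz:
  assumes "\<delta> > 0" "h \<in> bump_span \<delta>"
  shows "h \<in> schwartz"
proof (rule schwartzI_decay[of h "bump_span \<delta>"])
  fix f :: "'a \<Rightarrow> complex" assume f: "f \<in> bump_span \<delta>"
  note * = bump_span_has_derivative[OF f]
  show "f differentiable (at x)" for x using * unfolding differentiable_def by blast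
  show "ddir v f \<in> bump_span \<delta>" for v using * ddir_eqI[of f _ v] by metis
  fix N
  obtain C where C: "\<And>x. norm (f x) \<le> C" "\<And>x. norm x \<ge> \<delta> \<Longrightarrow> f x = 0"
    using bump_span_bounded[OF f assms(1)] by blast
  have "0 \<le> C" using order_trans[OF norm_ge_zero C(1)] .
  have "(1 + (norm x)\<^sup>2) ^ N * norm (f x) \<le> (1 + \<delta>\<^sup>2) ^ N * C" for x
  proof (cases "norm x \<ge> \<delta>")
    case True
    thus ?thesis using \<open>0 \<le> C\<close> by (simp add: C(2))
  next
    case False
    thus ?thesis by (intro mult_mono power_mono add_left_mono C) auto
  qed
  thus "\<exists>C. \<forall>x. (1 + (norm x)\<^sup>2) ^ N * norm (f x) \<le> C" by blast
qed (use assms in auto)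

section \<open>Mollification and cutoffs\<close>

lemma mollifier_exists:
  assumes "\<delta> > 0"
  obtains \<kappa> :: "'a::euclidean_space \<Rightarrow> real"
  where "(\<lambda>x. complex_of_real (\<kappa> x)) \<in> schwartz" "\<And>x. 0 \<le> \<kappa> x" "integrable lborel \<kappa>"
    "(\<integral>x. \<kappa> x \<partial>lborel) = 1" "\<And>x. norm x \<ge> \<delta> \<Longrightarrow> \<kappa> x = 0"
proof -
  let ?b = "\<lambda>x::'a. flat 0 (\<delta>\<^sup>2 - (norm x)\<^sup>2)"
  have "(\<lambda>x. 1 * complex_of_real (?b x)) \<in> bump_span \<delta>"
    by (intro bump_span.mult symbols.const)
  hence S: "(\<lambda>x. complex_of_real (?b x)) \<in> schwartz" using bump_span_schwartz[OF assms] by simp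
  have int: "integrable lborel ?b"
    using integrable_Re[OF schwartz_integrable[OF S]] by simp
  have pos: "?b x > 0 \<longleftrightarrow> norm x < \<delta>" for x
    using assms by (auto simp: flat_def power_strict_mono) (meson assms less_imp_le not_le power_mono)
  have "(\<integral>x. ?b x \<partial>lborel) \<noteq> 0"
  proof
    assume "(\<integral>x. ?b x \<partial>lborel) = 0"
    hence "AE x in lborel. ?b x = 0"
      using integral_nonneg_eq_0_iff_AE[OF int] flat_nonneg by auto
    hence "AE x in lborel. x \<notin> ball (0::'a) \<delta>"
      by eventually_elim (metis pos less_irrefl mem_ball_0)
    hence "emeasure lborel (ball (0::'a) \<delta>) = 0"
      by (subst (asm) AE_iff_measurable[of "ball 0 \<delta>"]) auto
    thus False using assms unit_ball_vol_pos[of "real DIM('a)"] by (simp add: emeasure_ball)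
  qed
  moreover have "(\<integral>x. ?b x \<partial>lborel) \<ge> 0" by (intro Bochner_Integration.integral_nonneg) (simp add: flat_nonneg)
  ultimately have c: "(\<integral>x. ?b x \<partial>lborel) > 0" (is "?c > 0") by linarith
  show ?thesis
  proof (rule that[of "\<lambda>x. inverse ?c * ?b x"])
    show "(\<lambda>x. complex_of_real (inverse ?c * ?b x)) \<in> schwartz"
      using schwartz_cmult[OF S, of "complex_of_real (inverse ?c)"] by simp
    show "0 \<le> inverse ?c * ?b x" for x using c flat_nonneg by simp
    show "integrable lborel (\<lambda>x. inverse ?c * ?b x)" by (intro integrable_mult_right int)
    show "(\<integral>x. inverse ?c * ?b x \<partial>lborel) = 1" using c by simp
    show "inverse ?c * ?b x = 0" if "norm x \<ge> \<delta>" for x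
      using pos[of x] flat_nonneg[of 0 "\<delta>\<^sup>2 - (norm x)\<^sup>2"] that by auto
  qed
qed

lemma correlation_slow_growth:
  fixes f :: "'a::euclidean_space \<Rightarrow> complex"
  assumes f: "f \<in> schwartz" and h: "h \<in> borel_measurable borel" and B: "\<And>x. norm (h x) \<le> B"
  shows "(\<lambda>y. \<integral>x. h x * f (x + y) \<partial>lborel) \<in> slow_growth"
proof (rule slow_growthI[of _ "(\<lambda>f y. \<integral>x. h x * f (x + y) \<partial>lborel) ` schwartz"])
  fix F assume "F \<in> (\<lambda>f y. \<integral>x. h x * f (x + y) \<partial>lborel) ` schwartz"
  then obtain g where g: "g \<in> schwartz" "F = (\<lambda>y. \<integral>x. h x * g (x + y) \<partial>lborel)" by blast
  note d = correlation_has_derivative[OF g(1) h B]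
  show "F differentiable (at x)" for x unfolding g(2) differentiable_def using d by blast
  show "ddir v F \<in> (\<lambda>f y. \<integral>x. h x * f (x + y) \<partial>lborel) ` schwartz" for v
    unfolding g(2) ddir_eqI[OF d] by (intro imageI schwartz_ddir g)
  have "norm (F y) \<le> B * (\<integral>x. norm (g x) \<partial>lborel)" for y
  proof -
    have gi: "integrable lborel (\<lambda>x. norm (g (x + y)))"
      using lborel_integrable_affine[OF integrable_norm[OF schwartz_integrable[OF g(1)]], of 1 y]
      by (simp add: add.commute)
    have "norm (F y) \<le> (\<integral>x. norm (h x * g (x + y)) \<partial>lborel)"
      unfolding g(2) by (rule integral_norm_bound)
    also have "\<dots> \<le> (\<integral>x. B * norm (g (x + y)) \<partial>lborel)"
      by (intro integral_mono integrable_norm correlation_integrable[OF g(1) h B] integrable_mult_right gi)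
        (auto simp: norm_mult intro!: mult_right_mono B)
    also have "\<dots> = B * (\<integral>x. norm (g x) \<partial>lborel)"
      using lborel_integral_affine[of "\<lambda>x. norm (g x)" 1 y] schwartz_borel[OF g(1)]
      by (simp add: add.commute)
    finally show ?thesis .
  qed
  thus "\<exists>C N. \<forall>x. norm (F x) \<le> C * (1 + (norm x)\<^sup>2) ^ N"
    by (intro exI[of _ "B * (\<integral>x. norm (g x) \<partial>lborel)"] exI[of _ 0]) simp
qed (use f in auto)

text \<open>Mollification keeps Lipschitz constants, so no derivative of the cutoff has to be estimated.\<close>

lemma smooth_approximation:
  fixes \<rho> :: "'a::euclidean_space \<Rightarrow> real"
  assumes lip: "\<And>x y. \<bar>\<rho> x - \<rho> y\<bar> \<le> L * norm (x - y)" and \<rho>: "\<And>x. 0 \<le> \<rho> x" "\<And>x. \<rho> x \<le> 1" and "\<delta> > 0"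
  obtains \<eta> where "(\<lambda>x. complex_of_real (\<eta> x)) \<in> slow_growth"
    "\<And>x. 0 \<le> \<eta> x" "\<And>x. \<eta> x \<le> 1" "\<And>x y. \<bar>\<eta> x - \<eta> y\<bar> \<le> L * norm (x - y)"
    "\<And>x c. (\<And>y. dist x y < \<delta> \<Longrightarrow> \<rho> y = c) \<Longrightarrow> \<eta> x = c"
proof -
  obtain \<kappa> :: "'a \<Rightarrow> real" where \<kappa>: "(\<lambda>x. complex_of_real (\<kappa> x)) \<in> schwartz" "\<And>x. 0 \<le> \<kappa> x" "integrable lborel \<kappa>"
    "(\<integral>x. \<kappa> x \<partial>lborel) = 1" "\<And>x. norm x \<ge> \<delta> \<Longrightarrow> \<kappa> x = 0"
    using mollifier_exists[OF \<open>\<delta> > 0\<close>] by metis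
  have [measurable]: "\<kappa> \<in> borel_measurable borel" using \<kappa>(3) by auto
  have "continuous_on UNIV \<rho>"
  proof (rule continuous_onI)
    fix x e assume "(e::real) > 0"
    show "\<exists>d>0. \<forall>x'\<in>UNIV. dist x' x < d \<longrightarrow> dist (\<rho> x') (\<rho> x) \<le> e"
    proof (intro exI[of _ "e / (\<bar>L\<bar> + 1)"] conjI ballI impI)
      fix x' assume d: "dist x' x < e / (\<bar>L\<bar> + 1)"
      have "dist (\<rho> x') (\<rho> x) \<le> L * norm (x' - x)" using lip by (simp add: dist_real_def)
      also have "\<dots> \<le> (\<bar>L\<bar> + 1) * (e / (\<bar>L\<bar> + 1))"
        using d by (intro mult_mono) (auto simp: dist_norm)
      finally show "dist (\<rho> x') (\<rho> x) \<le> e" by simp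
    qed (use \<open>e > 0\<close> in simp)
  qed
  hence [measurable]: "\<rho> \<in> borel_measurable borel" by (rule borel_measurable_continuous_onI)
  define \<eta> where "\<eta> y = (\<integral>w. \<rho> (y - w) * \<kappa> w \<partial>lborel)" for y
  have int: "integrable lborel (\<lambda>w. \<rho> (y - w) * \<kappa> w)" for y
    by (rule Bochner_Integration.integrable_bound[OF \<kappa>(3)])
      (auto simp: abs_mult \<rho> \<kappa>(2) intro!: mult_left_le_one_le)
  \<comment> \<open>Shifting the variable by \<open>y\<close> turns the convolution into a
    correlation, to which \<open>correlation_slow_growth\<close> applies with the reflected
    \<open>\<rho>\<close>.\<close>
  have eq: "complex_of_real (\<eta> y) = (\<integral>x. complex_of_real (\<rho> (- x)) * complex_of_real (\<kappa> (x + y)) \<partial>lborel)" for y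
  proof -
    have "\<eta> y = (\<integral>x. \<rho> (y - (y + 1 *\<^sub>R x)) * \<kappa> (y + 1 *\<^sub>R x) \<partial>lborel)"
      unfolding \<eta>_def by (subst lborel_integral_affine[of _ 1 y]) auto
    thus ?thesis by (simp add: add.commute integral_complex_of_real[symmetric])
  qed
  show ?thesis
  proof (rule that[of \<eta>])
    show "(\<lambda>x. complex_of_real (\<eta> x)) \<in> slow_growth"
      unfolding eq by (rule correlation_slow_growth[OF \<kappa>(1), where B=1]) (auto simp: \<rho>)
    show "0 \<le> \<eta> x" for x
      unfolding \<eta>_def by (intro Bochner_Integration.integral_nonneg) (auto simp: \<rho> \<kappa>)
    have "\<eta> x \<le> (\<integral>w. \<kappa> w \<partial>lborel)" for x
      unfolding \<eta>_def by (intro integral_mono int \<kappa>(3)) (auto intro!: mult_left_le_one_le \<rho> \<kappa>)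
    thus "\<eta> x \<le> 1" for x by (simp add: \<kappa>)
    show "\<bar>\<eta> x - \<eta> y\<bar> \<le> L * norm (x - y)" for x y
    proof -
      have "\<eta> x - \<eta> y = (\<integral>w. \<rho> (x - w) * \<kappa> w - \<rho> (y - w) * \<kappa> w \<partial>lborel)"
        unfolding \<eta>_def by (rule Bochner_Integration.integral_diff[OF int int, symmetric])
      hence "\<bar>\<eta> x - \<eta> y\<bar> \<le> (\<integral>w. \<bar>\<rho> (x - w) * \<kappa> w - \<rho> (y - w) * \<kappa> w\<bar> \<partial>lborel)"
        by (simp only: integral_abs_bound)
      also have "\<dots> \<le> (\<integral>w. L * norm (x - y) * \<kappa> w \<partial>lborel)"
      proof (intro integral_mono integrable_abs Bochner_Integration.integrable_diff int integrable_mult_right \<kappa>(3))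
        fix w
        have "\<bar>\<rho> (x - w) * \<kappa> w - \<rho> (y - w) * \<kappa> w\<bar> = \<bar>\<rho> (x - w) - \<rho> (y - w)\<bar> * \<kappa> w"
          using \<kappa>(2) by (simp add: left_diff_distrib[symmetric] abs_mult)
        also have "\<dots> \<le> L * norm (x - w - (y - w)) * \<kappa> w" by (intro mult_right_mono lip \<kappa>)
        finally show "\<bar>\<rho> (x - w) * \<kappa> w - \<rho> (y - w) * \<kappa> w\<bar> \<le> L * norm (x - y) * \<kappa> w" by simp
      qed
      finally show ?thesis by (simp add: \<kappa>)
    qed
    show "\<eta> x = c" if c: "\<And>y. dist x y < \<delta> \<Longrightarrow> \<rho> y = c" for x c
    proof -
      have "\<eta> x = (\<integral>w. c * \<kappa> w \<partial>lborel)"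
        unfolding \<eta>_def
      proof (intro Bochner_Integration.integral_cong refl)
        fix w
        show "\<rho> (x - w) * \<kappa> w = c * \<kappa> w"
          using c[of "x - w"] \<kappa>(5)[of w] by (cases "norm w < \<delta>") (auto simp: dist_norm)
      qed
      thus ?thesis by (simp add: \<kappa>)
    qed
  qed
qed

lemma cutoff_exists:
  fixes K :: "'a::euclidean_space set"
  assumes "K \<noteq> {}" "\<epsilon> > 0"
  obtains \<eta> where "(\<lambda>x. complex_of_real (\<eta> x)) \<in> slow_growth"
    "\<And>x. 0 \<le> \<eta> x" "\<And>x. \<eta> x \<le> 1" "\<And>x y. \<bar>\<eta> x - \<eta> y\<bar> \<le> 3 / \<epsilon> * norm (x - y)"
    "\<And>x. infdist x K < \<epsilon> / 6 \<Longrightarrow> \<eta> x = 1" "\<And>x. \<eta> x \<noteq> 0 \<Longrightarrow> infdist x K < \<epsilon>"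
proof -
  \<comment> \<open>The profile is 1 up to distance \<epsilon>/3 and 0 from 2 \<epsilon>/3 on, so
    mollifying at radius \<epsilon>/6 leaves room on both sides. The slope 3/\<epsilon> is that of
    the descent between these distances.\<close>
  define \<rho> where "\<rho> x = max 0 (min 1 (2 - 3 / \<epsilon> * infdist x K))" for x
  have inf: "\<bar>infdist x K - infdist y K\<bar> \<le> norm (x - y)" for x y
    using infdist_triangle_abs[of x K y] by (simp add: dist_norm)
  have "\<bar>\<rho> x - \<rho> y\<bar> \<le> 3 / \<epsilon> * norm (x - y)" for x y
  proof -
    have "\<bar>\<rho> x - \<rho> y\<bar> \<le> \<bar>3 / \<epsilon> * infdist x K - 3 / \<epsilon> * infdist y K\<bar>"
      unfolding \<rho>_def by linarith
    also have "\<dots> = 3 / \<epsilon> * \<bar>infdist x K - infdist y K\<bar>"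
      unfolding right_diff_distrib[symmetric] abs_mult using assms by simp
    also have "\<dots> \<le> 3 / \<epsilon> * norm (x - y)" using assms by (intro mult_left_mono inf) auto
    finally show ?thesis .
  qed
  moreover have "0 \<le> \<rho> x" "\<rho> x \<le> 1" for x by (auto simp: \<rho>_def)
  moreover have "\<epsilon> / 6 > 0" using assms by simp
  ultimately obtain \<eta> where \<eta>: "(\<lambda>x. complex_of_real (\<eta> x)) \<in> slow_growth"
    "\<And>x. 0 \<le> \<eta> x" "\<And>x. \<eta> x \<le> 1" "\<And>x y. \<bar>\<eta> x - \<eta> y\<bar> \<le> 3 / \<epsilon> * norm (x - y)"
    "\<And>x c. (\<And>y. dist x y < \<epsilon> / 6 \<Longrightarrow> \<rho> y = c) \<Longrightarrow> \<eta> x = c"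
    using smooth_approximation[of \<rho> "3 / \<epsilon>" "\<epsilon> / 6"] by metis
  show ?thesis
  proof (rule that[OF \<eta>(1-4)])
    fix x assume x: "infdist x K < \<epsilon> / 6"
    show "\<eta> x = 1"
    proof (rule \<eta>(5))
      fix y assume "dist x y < \<epsilon> / 6"
      hence "infdist y K \<le> \<epsilon> / 3" using x inf[of x y] by (simp add: dist_norm)
      hence "3 / \<epsilon> * infdist y K \<le> 1" using assms by (simp add: field_simps)
      thus "\<rho> y = 1" by (simp add: \<rho>_def)
    qed
  next
    fix x assume x: "\<eta> x \<noteq> 0"
    show "infdist x K < \<epsilon>"
    proof (rule ccontr)
      assume n: "\<not> infdist x K < \<epsilon>"
      have "\<eta> x = 0"
      proof (rule \<eta>(5))
        fix y assume "dist x y < \<epsilon> / 6"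
        hence "infdist y K \<ge> 2 * \<epsilon> / 3" using n inf[of x y] by (simp add: dist_norm)
        hence "3 / \<epsilon> * infdist y K \<ge> 2" using assms by (simp add: field_simps)
        thus "\<rho> y = 0" by (simp add: \<rho>_def)
      qed
      thus False using x by simp
    qed
  qed
qed

section \<open>Supports of tempered distributions\<close>

lemma tempered_add: "tempered u \<Longrightarrow> f \<in> schwartz \<Longrightarrow> g \<in> schwartz \<Longrightarrow> u (\<lambda>x. f x + g x) = u f + u g"
  and tempered_cmult: "tempered u \<Longrightarrow> f \<in> schwartz \<Longrightarrow> u (\<lambda>x. c * f x) = c * u f"
  by (auto simp: tempered_def)

lemma tempered_zero:
  assumes "tempered u" shows "u (\<lambda>x. 0) = 0"
proof -
  have "(\<lambda>x::'a. 0 * complex_of_real 0) \<in> schwartz"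
    using bump_span_schwartz[OF zero_less_one bump_span.mult[OF symbols.const[of 0]]] by simp
  thus ?thesis using tempered_cmult[OF assms, of "\<lambda>x. 0" 0] by simp
qed

text \<open>A partition of unity for two sets: the part of the support outside \<open>V\<close> is
  compact and contained in \<open>U\<close>, so a cutoff equal to 1 near it splits \<phi> into a
  piece living in \<open>U\<close> and a piece living in \<open>V\<close>.\<close>

lemma vanishes_on_Un:
  fixes U V :: "'a::euclidean_space set"
  assumes u: "tempered u" and "open U" "open V" "vanishes_on u U" "vanishes_on u V"
  shows "vanishes_on u (U \<union> V)"
  unfolding vanishes_on_def
proof (intro ballI impI, elim conjE)
  fix \<phi> :: "'a \<Rightarrow> complex"
  let ?K = "closure {x. \<phi> x \<noteq> 0}"
  assume \<phi>: "\<phi> \<in> schwartz" and c: "compact ?K" and sub: "?K \<subseteq> U \<union> V"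
  show "u \<phi> = 0"
  proof (cases "?K - V = {}")
    case True
    thus ?thesis using assms(5) \<phi> c unfolding vanishes_on_def by blast
  next
    case False
    have "compact (?K - V)" using c \<open>open V\<close> by (rule compact_diff)
    then obtain e where e: "e > 0" "{x. infdist x (?K - V) \<le> e} \<subseteq> U"
      using compact_in_open_separated[OF False _ \<open>open U\<close>] sub by blast
    obtain \<eta> where \<eta>: "(\<lambda>x. complex_of_real (\<eta> x)) \<in> slow_growth"
      "\<And>x. infdist x (?K - V) < e / 6 \<Longrightarrow> \<eta> x = 1" "\<And>x. \<eta> x \<noteq> 0 \<Longrightarrow> infdist x (?K - V) < e"
      using cutoff_exists[OF False e(1)] by metis
    let ?f = "\<lambda>x. complex_of_real (\<eta> x) * \<phi> x" and ?g = "\<lambda>x. \<phi> x - complex_of_real (\<eta> x) * \<phi> x"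
    have f: "?f \<in> schwartz" by (rule schwartz_mult[OF \<eta>(1) \<phi>])
    have g: "?g \<in> schwartz" by (rule schwartz_diff[OF \<phi> f])
    have comp: "compact (closure {x. h x \<noteq> 0})" "closure {x. h x \<noteq> 0} \<subseteq> ?K"
      if "\<And>x. h x \<noteq> 0 \<Longrightarrow> \<phi> x \<noteq> 0" for h :: "'a \<Rightarrow> complex"
    proof -
      show "closure {x. h x \<noteq> 0} \<subseteq> ?K" using that by (intro closure_mono) auto
      thus "compact (closure {x. h x \<noteq> 0})" using c
        using compact_Int_closed[OF c closed_closure, of "{x. h x \<noteq> 0}"] by (simp add: Int_absorb1)
    qed
    have "closure {x. ?f x \<noteq> 0} \<subseteq> {x. infdist x (?K - V) \<le> e}"
    proof (rule closure_minimal)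
      show "{x. ?f x \<noteq> 0} \<subseteq> {x. infdist x (?K - V) \<le> e}" using \<eta>(3) by fastforce
      show "closed {x. infdist x (?K - V) \<le> e}"
        by (intro closed_Collect_le continuous_intros)
    qed
    hence "u ?f = 0" using assms(4) f comp[of ?f] e(2) unfolding vanishes_on_def by fastforce
    moreover have "closure {x. ?g x \<noteq> 0} \<subseteq> {x. infdist x (?K - V) \<ge> e / 6}"
    proof (rule closure_minimal)
      show "{x. ?g x \<noteq> 0} \<subseteq> {x. infdist x (?K - V) \<ge> e / 6}"
      proof safe
        fix x assume "?g x \<noteq> 0"
        hence "\<eta> x \<noteq> 1" by auto
        thus "infdist x (?K - V) \<ge> e / 6" using \<eta>(2)[of x] by linarith
      qed
      show "closed {x. infdist x (?K - V) \<ge> e / 6}"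
        by (intro closed_Collect_le continuous_intros)
    qed
    moreover have "{x. infdist x (?K - V) \<ge> e / 6} \<inter> ?K \<subseteq> V"
    proof safe
      fix x assume x: "x \<in> ?K" "e / 6 \<le> infdist x (?K - V)"
      show "x \<in> V"
      proof (rule ccontr)
        assume "x \<notin> V"
        hence "infdist x (?K - V) = 0" using x(1) by (intro infdist_zero) auto
        thus False using x(2) e(1) by linarith
      qed
    qed
    ultimately have "u ?f = 0" "u ?g = 0"
      using assms(5) g comp[of ?g] unfolding vanishes_on_def by (blast, fastforce)
    moreover have "u \<phi> = u (\<lambda>x. ?f x + ?g x)" by simp
    ultimately show ?thesis unfolding tempered_add[OF u f g] by simp
  qed
qed

text \<open>\<open>dist_support\<close> removes every open set on which \<open>u\<close> vanishes,
  and that \<open>u\<close> also vanishes on their union has to be proved: compactness leaves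
  finitely many of them, which are merged one at a time.\<close>

lemma vanishes_off_support:
  fixes \<phi> :: "'a::euclidean_space \<Rightarrow> complex"
  assumes u: "tempered u" and \<phi>: "\<phi> \<in> schwartz" and c: "compact (closure {x. \<phi> x \<noteq> 0})"
    and disj: "closure {x. \<phi> x \<noteq> 0} \<inter> dist_support u = {}"
  shows "u \<phi> = 0"
proof -
  let ?C = "{U. open U \<and> vanishes_on u U}"
  have "closure {x. \<phi> x \<noteq> 0} \<subseteq> \<Union>?C" using disj by (auto simp: dist_support_def)
  then obtain D where D: "D \<subseteq> ?C" "finite D" "closure {x. \<phi> x \<noteq> 0} \<subseteq> \<Union>D"
    using compactE[OF c, of ?C] by blast
  have "open (\<Union>D) \<and> vanishes_on u (\<Union>D)" using D(2,1)
  proof (induction D rule: finite_induct)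
    case empty
    have "u \<psi> = 0" if "{x. \<psi> x \<noteq> 0} = {}" for \<psi> :: "'a \<Rightarrow> complex"
    proof -
      have "\<psi> = (\<lambda>x. 0)" using that by auto
      thus ?thesis using tempered_zero[OF u] by simp
    qed
    thus ?case by (auto simp: vanishes_on_def)
  next
    case (insert U D)
    thus ?case using vanishes_on_Un[OF u, of U "\<Union>D"] by auto
  qed
  thus ?thesis using \<phi> c D(3) unfolding vanishes_on_def by blast
qed

section \<open>A criterion for nullity\<close>

text \<open>\<open>g\<close> is only Lebesgue measurable. A nonnegative Borel function equal to |g|
  almost everywhere gives access to the Fubini arguments over \<open>lborel\<close>, and all later
  bounds are in terms of |g|.\<close>

lemma Lp_representative:
  fixes g :: "'a::euclidean_space \<Rightarrow> complex"
  assumes g: "g \<in> borel_measurable lebesgue" and int: "integrable lebesgue (\<lambda>x. norm (g x) powr p)"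
  obtains \<gamma> :: "'a \<Rightarrow> real" where "\<gamma> \<in> borel_measurable borel" "\<And>x. 0 \<le> \<gamma> x" "integrable lborel (\<lambda>x. \<gamma> x powr p)"
    "\<And>f. ennreal (norm (\<integral>x. g x * f x \<partial>lebesgue)) \<le> (\<integral>\<^sup>+x. ennreal (\<gamma> x) * ennreal (norm (f x)) \<partial>lborel)"
proof -
  have "(\<lambda>x. norm (g x)) \<in> borel_measurable lebesgue" using g by simp
  then obtain \<gamma>0 where \<gamma>0: "\<gamma>0 \<in> borel_measurable lborel" "AE x in lborel. norm (g x) = \<gamma>0 x"
    using completion_ex_borel_measurable_real by blast
  define \<gamma> where "\<gamma> x = \<bar>\<gamma>0 x\<bar>" for x
  have \<gamma>: "\<gamma> \<in> borel_measurable borel" using \<gamma>0(1) unfolding \<gamma>_def by simp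
  have ae: "AE x in lborel. norm (g x) = \<gamma> x" using \<gamma>0(2) by eventually_elim (metis abs_norm_cancel \<gamma>_def)
  show ?thesis
  proof (rule that[OF \<gamma>])
    show "0 \<le> \<gamma> x" for x by (simp add: \<gamma>_def)
    have "(\<integral>\<^sup>+x. ennreal (norm (\<gamma> x powr p)) \<partial>lborel) = (\<integral>\<^sup>+x. ennreal (norm (norm (g x) powr p)) \<partial>lborel)"
      by (rule nn_integral_cong_AE) (use ae in eventually_elim, simp)
    also have "\<dots> = (\<integral>\<^sup>+x. ennreal (norm (norm (g x) powr p)) \<partial>lebesgue)"
      by (rule nn_integral_completion[symmetric])
    also have "\<dots> < \<infinity>" using int unfolding integrable_iff_bounded by blast
    finally show "integrable lborel (\<lambda>x. \<gamma> x powr p)" using \<gamma> by (intro integrableI_bounded) auto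
    fix f :: "'a \<Rightarrow> complex"
    show "ennreal (norm (\<integral>x. g x * f x \<partial>lebesgue)) \<le> (\<integral>\<^sup>+x. ennreal (\<gamma> x) * ennreal (norm (f x)) \<partial>lborel)"
    proof (cases "integrable lebesgue (\<lambda>x. g x * f x)")
      case True
      have "ennreal (norm (\<integral>x. g x * f x \<partial>lebesgue)) \<le> (\<integral>\<^sup>+x. ennreal (norm (g x * f x)) \<partial>lebesgue)"
        by (rule integral_norm_bound_ennreal[OF True])
      also have "\<dots> = (\<integral>\<^sup>+x. ennreal (norm (g x * f x)) \<partial>lborel)" by (rule nn_integral_completion)
      also have "\<dots> = (\<integral>\<^sup>+x. ennreal (\<gamma> x) * ennreal (norm (f x)) \<partial>lborel)"
        by (rule nn_integral_cong_AE) (use ae in eventually_elim, simp add: norm_mult ennreal_mult' \<gamma>_def)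
      finally show ?thesis .
    \<comment> \<open>A product that is not integrable has Bochner integral 0 by convention, so the
      bound is trivial.\<close>
    qed (simp add: not_integrable_integral_eq)
  qed
qed

text \<open>Hoelder's inequality with an arbitrarily small constant, which is what admits the
  endpoint. Below the level n + l, with l of order M^(-1/p), the function is bounded by that level.
  Above it \<gamma> is at most l^(1-p) \<gamma>^p, and only the part of \<gamma>^p where \<gamma> >
  n contributes, whose integral tends to 0 as n grows.\<close>

lemma Lp_small_sets:
  fixes \<gamma> :: "'a::euclidean_space \<Rightarrow> real"
  assumes p: "1 < p" and [measurable]: "\<gamma> \<in> borel_measurable borel" and nn: "\<And>x. 0 \<le> \<gamma> x"
    and int: "integrable lborel (\<lambda>x. \<gamma> x powr p)" and \<eta>: "\<eta> > 0"
  obtains m where "m > 0" "\<And>M (N :: 'a set). 0 < M \<Longrightarrow> M \<le> m \<Longrightarrow> N \<in> sets borel \<Longrightarrow> emeasure lborel N \<le> ennreal M \<Longrightarrow>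
    (\<integral>\<^sup>+x. ennreal (\<gamma> x) * indicator N x \<partial>lborel) \<le> ennreal (\<eta> * M powr (1 - 1 / p))"
proof -
  let ?T = "\<lambda>n x. indicator {x. \<gamma> x > real n} x * \<gamma> x powr p"
  have "(\<lambda>n. \<integral>x. ?T n x \<partial>lborel) \<longlonglongrightarrow> (\<integral>x. 0 \<partial>(lborel :: 'a measure))"
  proof (rule integral_dominated_convergence[where w="\<lambda>x. \<gamma> x powr p"])
    have "(\<lambda>n. ?T n x) \<longlonglongrightarrow> 0" for x
    proof -
      obtain n0 where "\<gamma> x < real n0" using reals_Archimedean2 by blast
      hence "\<forall>\<^sub>F n in sequentially. ?T n x = 0"
        by (intro eventually_sequentiallyI[of n0]) (auto simp: indicator_def)
      thus ?thesis by (rule tendsto_eventually)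
    qed
    thus "AE x in lborel. (\<lambda>n. ?T n x) \<longlonglongrightarrow> 0" by simp
  qed (use int in \<open>auto split: split_indicator\<close>)
  hence lim: "(\<lambda>n. (\<eta> / 3) powr (1 - p) * (\<integral>x. ?T n x \<partial>lborel)) \<longlonglongrightarrow> (\<eta> / 3) powr (1 - p) * 0"
    by (intro tendsto_mult tendsto_const) simp
  have "\<forall>\<^sub>F n in sequentially. (\<eta> / 3) powr (1 - p) * (\<integral>x. ?T n x \<partial>lborel) < \<eta> / 3"
    by (rule order_tendstoD(2)[OF lim]) (use \<eta> in simp)
  then obtain n where n: "(\<eta> / 3) powr (1 - p) * (\<integral>x. ?T n x \<partial>lborel) < \<eta> / 3"
    by (meson eventually_happens sequentially_bot)
  have iT: "integrable lborel (?T n)"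
    by (rule Bochner_Integration.integrable_bound[OF int]) (auto split: split_indicator)
  let ?t = "\<integral>x. ?T n x \<partial>lborel"
  \<comment> \<open>Of the three thirds of \<open>\<eta>\<close>, one is reserved for the level
    \<open>n\<close>: for \<open>M \<le> m\<close> the product n M^(1/p) is at most \<eta>/3. The
    summand 1 keeps the denominator positive.\<close>
  define m where "m = (\<eta> / 3 / (real n + 1)) powr p"
  show ?thesis
  proof (rule that[of m])
    show "m > 0" using \<eta> by (simp add: m_def)
    fix M :: real and N :: "'a set" assume M: "0 < M" "M \<le> m" and [measurable]: "N \<in> sets borel" and N: "emeasure lborel N \<le> ennreal M"
    \<comment> \<open>The level l = (\<eta>/3) M^(-1/p) spends the second third exactly.
      \<open>?b\<close> is l^(1-p), whose factor (\<eta>/3)^(1-p) was already compensated by the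
      choice of \<open>n\<close>.\<close>
    let ?a = "real n + \<eta> / 3 * M powr (- 1 / p)" and ?b = "(\<eta> / 3) powr (1 - p) * M powr (1 - 1 / p)"
    have bnd: "\<gamma> x \<le> ?a + ?b * ?T n x" for x
    proof -
      let ?l = "\<eta> / 3 * M powr (- 1 / p)"
      have l: "?l > 0" using \<eta> M by simp
      consider "\<gamma> x \<le> real n" | "\<gamma> x \<le> ?l" | "\<gamma> x > real n" "\<gamma> x > ?l" by linarith
      thus ?thesis
      proof cases
        case 3
        have "?l powr (1 - p) = ?b"
        proof -
          have "- 1 / p * (1 - p) = 1 - 1 / p" using p by (simp add: field_simps)
          thus ?thesis by (simp only: powr_mult powr_powr)
        qed
        moreover have "\<gamma> x powr (1 - p) \<le> ?l powr (1 - p)"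
          using 3 l p by (intro powr_mono2') auto
        ultimately have "\<gamma> x powr (1 - p) * \<gamma> x powr p \<le> ?b * \<gamma> x powr p"
          by (intro mult_right_mono) auto
        moreover have "\<gamma> x powr (1 - p) * \<gamma> x powr p = \<gamma> x"
          using 3 l by (simp add: powr_add[symmetric])
        ultimately have "\<gamma> x \<le> ?b * ?T n x" using 3 by (simp add: indicator_def)
        thus ?thesis using l by linarith
      next
        case 1
        have "0 \<le> ?b * ?T n x" by (simp add: indicator_def)
        thus ?thesis using 1 l by linarith
      next
        case 2
        have "0 \<le> ?b * ?T n x" by (simp add: indicator_def)
        thus ?thesis using 2 by linarith
      qed
    qed
    have a0: "?a \<ge> 0" using \<eta> by simp
    have "(\<integral>\<^sup>+x. ennreal (\<gamma> x) * indicator N x \<partial>lborel) \<le>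
      (\<integral>\<^sup>+x. ennreal ?a * indicator N x + ennreal ?b * ennreal (?T n x) \<partial>lborel)"
    proof (intro nn_integral_mono)
      fix x
      have "ennreal (\<gamma> x) \<le> ennreal (?a + ?b * ?T n x)" by (rule ennreal_leI[OF bnd])
      also have "\<dots> = ennreal ?a + ennreal ?b * ennreal (?T n x)"
        using a0 by (subst ennreal_mult[symmetric], simp, simp add: indicator_def)
           (rule ennreal_plus, simp_all add: indicator_def)
      finally show "ennreal (\<gamma> x) * indicator N x \<le> ennreal ?a * indicator N x + ennreal ?b * ennreal (?T n x)"
        by (auto split: split_indicator)
    qed
    also have "\<dots> = ennreal ?a * emeasure lborel N + ennreal ?b * ennreal ?t"
      by (subst nn_integral_add) (auto simp: nn_integral_cmult nn_integral_cmult_indicator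
          nn_integral_eq_integral[OF iT] split: split_indicator)
    also have "\<dots> \<le> ennreal ?a * ennreal M + ennreal ?b * ennreal ?t"
      by (intro add_right_mono mult_left_mono N) auto
    also have "\<dots> = ennreal (?a * M + ?b * ?t)"
    proof -
      have "0 \<le> ?t" by (intro Bochner_Integration.integral_nonneg) (auto simp: indicator_def)
      thus ?thesis using a0 M by (simp add: ennreal_mult[symmetric] ennreal_plus[symmetric] del: ennreal_plus)
    qed
    also have "\<dots> \<le> ennreal (\<eta> * M powr (1 - 1 / p))"
    proof (rule ennreal_leI)
      have MM: "M = M powr (1 / p) * M powr (1 - 1 / p)" "M powr (- 1 / p) * M = M powr (1 - 1 / p)"
        using M powr_add[of M "1 / p" "1 - 1 / p"] powr_add[of M "- 1 / p" 1] by simp_all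
      have "M powr (1 / p) \<le> m powr (1 / p)" using M p by (intro powr_mono2) auto
      also have "\<dots> = \<eta> / 3 / (real n + 1)" using p \<eta> by (simp add: m_def powr_powr)
      finally have "real n * M powr (1 / p) \<le> real n * (\<eta> / 3 / (real n + 1))" by (intro mult_left_mono) auto
      also have "\<dots> \<le> \<eta> / 3" using \<eta> by (simp add: field_simps)
      finally have "real n * M powr (1 / p) * M powr (1 - 1 / p) \<le> \<eta> / 3 * M powr (1 - 1 / p)"
        by (intro mult_right_mono) auto
      hence 1: "real n * M \<le> \<eta> / 3 * M powr (1 - 1 / p)" using MM(1) by (simp only: mult.assoc)
      have 2: "\<eta> / 3 * M powr (- 1 / p) * M = \<eta> / 3 * M powr (1 - 1 / p)"
        using MM(2) by (simp only: mult.assoc)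
      have 3: "?b * ?t \<le> \<eta> / 3 * M powr (1 - 1 / p)"
        using mult_right_mono[OF less_imp_le[OF n], of "M powr (1 - 1 / p)"] by (simp add: mult_ac)
      show "?a * M + ?b * ?t \<le> \<eta> * M powr (1 - 1 / p)"
        unfolding distrib_right 2 using 1 3 by linarith
    qed
    finally show "(\<integral>\<^sup>+x. ennreal (\<gamma> x) * indicator N x \<partial>lborel) \<le> ennreal (\<eta> * M powr (1 - 1 / p))" .
  qed
qed

section \<open>Localising a Schwartz function\<close>

lemma schwartz_lipschitz:
  fixes f :: "'a::euclidean_space \<Rightarrow> complex"
  assumes "f \<in> schwartz"
  obtains L where "L > 0" "\<And>x y. norm (f x - f y) \<le> L * norm (x - y)"
proof -
  from schwartz_deriv_bound[OF assms] obtain C where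
    C: "C > 0" "\<And>x v. norm (ddir v f x) \<le> C * decay x * norm v" by metis
  have "norm (f x - f y) \<le> C * norm (x - y)" for x y
  proof (rule differentiable_bound[of UNIV])
    show "(f has_derivative (\<lambda>v. ddir v f x)) (at x within UNIV)" for x
      by (rule schwartz_has_derivative[OF assms])
    show "onorm (\<lambda>v. ddir v f x) \<le> C" for x
    proof (rule onorm_le)
      fix v :: 'a
      have "C * decay x * norm v \<le> C * 1 * norm v"
        using C(1) by (intro mult_right_mono mult_left_mono decay_le_1) auto
      thus "norm (ddir v f x) \<le> C * norm v" using C(2)[where v=v and x=x] by simp
    qed
  qed auto
  thus ?thesis using that C(1) by blast
qed

text \<open>The remainder far out satisfies the hypotheses of \<open>bessel_estimate\<close> at
  scale 1 with the weight A/R times \<open>decay\<close>. Such a truncation is called for because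
  \<open>vanishes_on\<close> tests compact supports only and the boundary may be unbounded.\<close>

lemma schwartz_tail_cutoff:
  fixes \<psi> :: "'a::euclidean_space \<Rightarrow> complex"
  assumes \<psi>: "\<psi> \<in> schwartz"
  obtains A where "A > 0" "\<And>R. R \<ge> 4 \<Longrightarrow> \<exists>\<eta>. (\<lambda>x. complex_of_real (\<eta> x)) \<in> slow_growth \<and>
     (\<forall>x. norm x \<ge> 3 * R \<longrightarrow> \<eta> x = 0) \<and>
     (\<forall>x. norm (\<psi> x - complex_of_real (\<eta> x) * \<psi> x) \<le> A / R * decay x) \<and>
     (\<forall>x h. norm ((\<psi> (x + h) - complex_of_real (\<eta> (x + h)) * \<psi> (x + h)) - (\<psi> x - complex_of_real (\<eta> x) * \<psi> x))
        \<le> min 1 (norm h) * (A / R * decay x + A / R * decay (x + h)))"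
proof -
  obtain C0 where C0: "C0 > 0" "\<And>x. (1 + (norm x)\<^sup>2) * norm (\<psi> x) \<le> C0 * decay x"
    using schwartz_decay_bound_strong[OF \<psi>] by metis
  obtain C1 where C1: "C1 > 0" "\<And>x v. (1 + (norm x)\<^sup>2) * norm (ddir v \<psi> x) \<le> C1 * decay x * norm v"
    using schwartz_deriv_bound_strong[OF \<psi>] by metis
  have far: "a \<le> k / r" if "(1 + (norm x)\<^sup>2) * a \<le> k" "norm x \<ge> r" "r > 0" "a \<ge> 0" for a k r and x :: 'a
  proof -
    have "r * a \<le> (1 + (norm x)\<^sup>2) * a"
      using that le_one_plus_square[of "norm x"] by (intro mult_right_mono) auto
    thus ?thesis using that by (simp add: field_simps)
  qed
  have near: "norm (\<psi> x) \<le> C0 * decay x" for x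
  proof -
    have "1 * norm (\<psi> x) \<le> (1 + (norm x)\<^sup>2) * norm (\<psi> x)" by (intro mult_right_mono) auto
    thus ?thesis using C0(2)[of x] by simp
  qed
  \<comment> \<open>The term \<open>2 * C0\<close> bounds the size, as the remainder lives where |x|
    >= R/2, and absorbs the slope 1/R of the cutoff. The other term bounds the increments of \<psi>:
    along the segment |y| >= R/2 - 1 >= R/4, which uses R >= 4, and \<open>decay\<close> at
    \<open>y\<close> is compared with \<open>decay\<close> at \<open>x\<close>.\<close>
  define A where "A = 4 * C1 * 3 ^ DIM('a) + 2 * C0"
  have A: "A > 0" using C0 C1 by (simp add: A_def add_pos_pos)
  show ?thesis
  proof (rule that[OF A])
    fix R :: real assume R: "R \<ge> 4"
    let ?\<rho> = "\<lambda>x::'a. max 0 (min 1 (2 - norm x / R))"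
    have lip: "\<bar>?\<rho> x - ?\<rho> y\<bar> \<le> 1 / R * norm (x - y)" for x y
    proof -
      have "\<bar>?\<rho> x - ?\<rho> y\<bar> \<le> \<bar>norm x / R - norm y / R\<bar>" by linarith
      also have "\<dots> = \<bar>norm x - norm y\<bar> / R" using R by (simp add: diff_divide_distrib[symmetric])
      also have "\<dots> \<le> norm (x - y) / R" using R norm_triangle_ineq3 by (intro divide_right_mono) auto
      finally show ?thesis by simp
    qed
    have half: "R / 2 > 0" using R by simp
    have r0: "0 \<le> ?\<rho> x" and r1: "?\<rho> x \<le> 1" for x by auto
    obtain \<eta> where \<eta>: "(\<lambda>x. complex_of_real (\<eta> x)) \<in> slow_growth"
      "\<And>x. 0 \<le> \<eta> x" "\<And>x. \<eta> x \<le> 1" "\<And>x y. \<bar>\<eta> x - \<eta> y\<bar> \<le> 1 / R * norm (x - y)"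
      "\<And>x c. (\<And>y. dist x y < R / 2 \<Longrightarrow> ?\<rho> y = c) \<Longrightarrow> \<eta> x = c"
      by (rule smooth_approximation[of ?\<rho> "1 / R" "R / 2", OF lip r0 r1 half]) blast
    have one: "\<eta> x = 1" if "norm x < R / 2" for x
    proof (rule \<eta>(5))
      fix y assume "dist x y < R / 2"
      hence "norm y < R" using that norm_triangle_ineq2[of y x] by (simp add: dist_norm norm_minus_commute)
      hence "norm y / R < 1" using R by simp
      thus "?\<rho> y = 1" by simp
    qed
    have zero: "\<eta> x = 0" if "norm x \<ge> 3 * R" for x
    proof (rule \<eta>(5))
      fix y assume "dist x y < R / 2"
      hence "norm y > 2 * R" using that R norm_triangle_ineq2[of x y] by (simp add: dist_norm)
      hence "norm y / R > 2" using R by (simp add: field_simps)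
      thus "?\<rho> y = 0" by simp
    qed
    let ?\<phi> = "\<lambda>x. \<psi> x - complex_of_real (\<eta> x) * \<psi> x"
    have \<phi>: "?\<phi> x = complex_of_real (1 - \<eta> x) * \<psi> x" for x by (simp add: algebra_simps)
    have size: "norm (?\<phi> x) \<le> A / R * decay x" for x
    proof (cases "norm x < R / 2")
      case True
      thus ?thesis using one A R decay_pos[of x] by (simp add: less_imp_le)
    next
      case False
      have "norm (?\<phi> x) \<le> 1 * norm (\<psi> x)"
        unfolding \<phi> norm_mult norm_of_real using \<eta>(2,3)[of x] by (intro mult_right_mono) auto
      also have "\<dots> \<le> C0 * decay x / (R / 2)"
        using far[OF C0(2)[of x], of "R / 2"] False R by simp
      also have "\<dots> = 2 * C0 / R * decay x" by simp
      also have "\<dots> \<le> A / R * decay x"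
        using R C1 decay_pos[of x] by (intro mult_right_mono divide_right_mono) (auto simp: A_def)
      finally show ?thesis .
    qed
    have osc: "norm (?\<phi> (x + h) - ?\<phi> x) \<le> norm h * (A / R * decay x)" if h: "norm h \<le> 1" for x h
    proof -
      have "?\<phi> (x + h) - ?\<phi> x = complex_of_real (1 - \<eta> (x + h)) * (\<psi> (x + h) - \<psi> x) - complex_of_real (\<eta> (x + h) - \<eta> x) * \<psi> x"
        by (simp add: algebra_simps)
      also have "norm \<dots> \<le> norm (complex_of_real (1 - \<eta> (x + h)) * (\<psi> (x + h) - \<psi> x)) + norm (complex_of_real (\<eta> (x + h) - \<eta> x) * \<psi> x)"
        by (rule norm_triangle_ineq4)
      also have "norm (complex_of_real (\<eta> (x + h) - \<eta> x) * \<psi> x) \<le> (1 / R * norm h) * (C0 * decay x)"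
        unfolding norm_mult norm_of_real using \<eta>(4)[of "x + h" x] R near by (intro mult_mono) auto
      also have "norm (complex_of_real (1 - \<eta> (x + h)) * (\<psi> (x + h) - \<psi> x)) \<le> 4 * C1 * 3 ^ DIM('a) / R * decay x * norm h"
      proof (cases "norm (x + h) < R / 2")
        case True
        thus ?thesis using one C1 R decay_pos[of x] by (simp add: less_imp_le)
      next
        case False
        have "norm (\<psi> (x + h) - \<psi> x) \<le> (4 * C1 * 3 ^ DIM('a) / R * decay x) * norm (x + h - x)"
        proof (rule differentiable_bound[of "closed_segment x (x + h)"])
          fix y assume "y \<in> closed_segment x (x + h)"
          hence "norm (y - x) \<le> norm h" "norm (y - (x + h)) \<le> norm h"
            using segment_bound[of y x "x + h"] by (auto simp: norm_minus_commute)
          hence y: "norm (y - x) \<le> 1" "norm (y - (x + h)) \<le> 1" using h by auto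
          have "norm y \<ge> norm (x + h) - norm (y - (x + h))"
            using norm_triangle_ineq2[of "x + h" "x + h - y"] by (simp add: norm_minus_commute)
          hence ny: "norm y \<ge> R / 4" using y False R by linarith
          show "onorm (\<lambda>v. ddir v \<psi> y) \<le> 4 * C1 * 3 ^ DIM('a) / R * decay x"
          proof (rule onorm_le)
            fix v
            have "norm (ddir v \<psi> y) \<le> C1 * decay y * norm v / (R / 4)"
              by (rule far[OF C1(2) ny]) (use R in auto)
            also have "\<dots> \<le> C1 * (3 ^ DIM('a) * decay x) * norm v / (R / 4)"
              using C1 R by (intro divide_right_mono mult_right_mono mult_left_mono decay_shift y) auto
            finally show "norm (ddir v \<psi> y) \<le> 4 * C1 * 3 ^ DIM('a) / R * decay x * norm v"
              by (simp add: mult_ac)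
          qed
          show "(\<psi> has_derivative (\<lambda>v. ddir v \<psi> y)) (at y within closed_segment x (x + h))"
            by (rule has_derivative_at_withinI[OF schwartz_has_derivative[OF \<psi>]])
        qed auto
        moreover have "norm (complex_of_real (1 - \<eta> (x + h)) * (\<psi> (x + h) - \<psi> x)) \<le> 1 * norm (\<psi> (x + h) - \<psi> x)"
          unfolding norm_mult norm_of_real using \<eta>(2,3)[of "x + h"] by (intro mult_right_mono) auto
        ultimately show ?thesis by simp
      qed
      also have "4 * C1 * 3 ^ DIM('a) / R * decay x * norm h + (1 / R * norm h) * (C0 * decay x) =
          norm h * ((4 * C1 * 3 ^ DIM('a) + C0) / R * decay x)"
        using R by (simp add: field_simps)
      also have "\<dots> \<le> norm h * (A / R * decay x)"
        using R C0 decay_pos[of x] by (intro mult_left_mono mult_right_mono divide_right_mono) (auto simp: A_def)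
      finally show ?thesis by simp
    qed
    have "norm (?\<phi> (x + h) - ?\<phi> x) \<le> min 1 (norm h) * (A / R * decay x + A / R * decay (x + h))" for x h
    proof (cases "norm h \<le> 1")
      case True
      have "norm h * (A / R * decay x) \<le> norm h * (A / R * decay x + A / R * decay (x + h))"
        using A R decay_pos[of "x + h"] by (intro mult_left_mono) auto
      thus ?thesis using osc[OF True, of x] True by (simp add: min_def)
    next
      case False
      thus ?thesis using norm_triangle_ineq4[of "?\<phi> (x + h)" "?\<phi> x"] size[of x] size[of "x + h"]
        by (simp add: min_def)
    qed
    with \<eta>(1) zero size show "\<exists>\<eta>. (\<lambda>x. complex_of_real (\<eta> x)) \<in> slow_growth \<and>
     (\<forall>x. norm x \<ge> 3 * R \<longrightarrow> \<eta> x = 0) \<and>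
     (\<forall>x. norm (\<psi> x - complex_of_real (\<eta> x) * \<psi> x) \<le> A / R * decay x) \<and>
     (\<forall>x h. norm ((\<psi> (x + h) - complex_of_real (\<eta> (x + h)) * \<psi> (x + h)) - (\<psi> x - complex_of_real (\<eta> x) * \<psi> x))
        \<le> min 1 (norm h) * (A / R * decay x + A / R * decay (x + h)))"
      by blast
  qed
qed

text \<open>\<open>A\<close> depends on neither \<open>K\<close> nor \<open>\<epsilon>\<close>: the
  product rule gives the Lipschitz constant 3 S / \<epsilon> + L, which is at most (3 S + L) /
  \<epsilon> because \<epsilon> <= 1. The same constant exceeds the trivial bound 2 S for
  increments.\<close>

lemma compact_support_cutoff:
  fixes \<psi> :: "'a::euclidean_space \<Rightarrow> complex"
  assumes \<psi>: "\<psi> \<in> schwartz"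
  obtains A where "A > 0" "\<And>K \<epsilon>. K \<noteq> {} \<Longrightarrow> 0 < \<epsilon> \<Longrightarrow> \<epsilon> \<le> 1 \<Longrightarrow> \<exists>\<eta>. (\<lambda>x. complex_of_real (\<eta> x)) \<in> slow_growth \<and>
     (\<forall>x. infdist x K < \<epsilon> / 6 \<longrightarrow> \<eta> x = 1) \<and>
     (\<forall>x. norm (complex_of_real (\<eta> x) * \<psi> x) \<le> A * indicator {x. infdist x K < \<epsilon>} x) \<and>
     (\<forall>x h. norm (complex_of_real (\<eta> (x + h)) * \<psi> (x + h) - complex_of_real (\<eta> x) * \<psi> x)
        \<le> min 1 (norm h / \<epsilon>) * (A * indicator {x. infdist x K < \<epsilon>} x + A * indicator {x. infdist x K < \<epsilon>} (x + h)))"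
proof -
  obtain S where S: "S > 0" "\<And>x. norm (\<psi> x) \<le> S" using schwartz_bounded[OF \<psi>] by metis
  obtain L where L: "L > 0" "\<And>x y. norm (\<psi> x - \<psi> y) \<le> L * norm (x - y)" using schwartz_lipschitz[OF \<psi>] by metis
  define A where "A = 3 * S + L"
  have A: "A > 0" "S \<le> A" "2 * S \<le> A" using S L by (auto simp: A_def)
  show ?thesis
  proof (rule that[OF A(1)])
    fix K :: "'a set" and \<epsilon> :: real assume K: "K \<noteq> {}" and \<epsilon>: "0 < \<epsilon>" "\<epsilon> \<le> 1"
    let ?N = "{x. infdist x K < \<epsilon>}"
    obtain \<eta> where \<eta>: "(\<lambda>x. complex_of_real (\<eta> x)) \<in> slow_growth"
      "\<And>x. 0 \<le> \<eta> x" "\<And>x. \<eta> x \<le> 1" "\<And>x y. \<bar>\<eta> x - \<eta> y\<bar> \<le> 3 / \<epsilon> * norm (x - y)"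
      "\<And>x. infdist x K < \<epsilon> / 6 \<Longrightarrow> \<eta> x = 1" "\<And>x. \<eta> x \<noteq> 0 \<Longrightarrow> infdist x K < \<epsilon>"
      using cutoff_exists[OF K \<epsilon>(1)] by blast
    let ?\<phi> = "\<lambda>x. complex_of_real (\<eta> x) * \<psi> x"
    have le_S: "norm (?\<phi> x) \<le> S" for x
      unfolding norm_mult norm_of_real using \<eta>(2,3)[of x] S(2)[of x] by (intro order_trans[OF mult_left_le_one_le]) auto
    have out: "?\<phi> x = 0" if "x \<notin> ?N" for x using \<eta>(6) that by auto
    have size: "norm (?\<phi> x) \<le> A * indicator ?N x" for x
      using le_S[of x] A(2) out[of x] by (auto split: split_indicator)
    have lip: "norm (?\<phi> (x + h) - ?\<phi> x) \<le> norm h / \<epsilon> * A" for x h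
    proof -
      have "?\<phi> (x + h) - ?\<phi> x = complex_of_real (\<eta> (x + h) - \<eta> x) * \<psi> (x + h) + complex_of_real (\<eta> x) * (\<psi> (x + h) - \<psi> x)"
        by (simp add: algebra_simps)
      also have "norm \<dots> \<le> norm (complex_of_real (\<eta> (x + h) - \<eta> x) * \<psi> (x + h)) + norm (complex_of_real (\<eta> x) * (\<psi> (x + h) - \<psi> x))"
        by (rule norm_triangle_ineq)
      also have "\<dots> \<le> (3 / \<epsilon> * norm h) * S + 1 * (L * norm h)"
        unfolding norm_mult norm_of_real
        using \<eta>(4)[of "x + h" x] \<eta>(2,3)[of x] S(2)[of "x + h"] L(2)[of "x + h" x] \<epsilon>
        by (intro add_mono mult_mono) auto
      also have "\<dots> \<le> (3 / \<epsilon> * norm h) * S + (1 / \<epsilon>) * (L * norm h)"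
        using \<epsilon> L by (intro add_left_mono mult_right_mono) (auto simp: field_simps)
      also have "\<dots> = norm h / \<epsilon> * A" using \<epsilon> by (simp add: A_def field_simps)
      finally show ?thesis .
    qed
    have "norm (?\<phi> (x + h) - ?\<phi> x) \<le> min 1 (norm h / \<epsilon>) * (A * indicator ?N x + A * indicator ?N (x + h))" for x h
    proof (cases "x \<in> ?N \<or> x + h \<in> ?N")
      case True
      have "norm (?\<phi> (x + h) - ?\<phi> x) \<le> 1 * A"
        using norm_triangle_ineq4[of "?\<phi> (x + h)" "?\<phi> x"] le_S[of x] le_S[of "x + h"] A(3) by linarith
      hence "norm (?\<phi> (x + h) - ?\<phi> x) \<le> min 1 (norm h / \<epsilon>) * A" using lip[of x h] by (simp add: min_def)
      also have "\<dots> \<le> min 1 (norm h / \<epsilon>) * (A * indicator ?N x + A * indicator ?N (x + h))"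
        using True A(1) \<epsilon> by (intro mult_left_mono) (auto split: split_indicator)
      finally show ?thesis .
    next
      case False
      hence "?\<phi> (x + h) = 0" "?\<phi> x = 0" using out by blast+
      hence "norm (?\<phi> (x + h) - ?\<phi> x) = 0" by (simp only: diff_self norm_zero)
      also have "0 \<le> min 1 (norm h / \<epsilon>) * (A * indicator ?N x + A * indicator ?N (x + h))"
        using A \<epsilon> by simp
      finally show ?thesis .
    qed
    with \<eta>(1,5) size show "\<exists>\<eta>. (\<lambda>x. complex_of_real (\<eta> x)) \<in> slow_growth \<and>
     (\<forall>x. infdist x K < \<epsilon> / 6 \<longrightarrow> \<eta> x = 1) \<and>
     (\<forall>x. norm (complex_of_real (\<eta> x) * \<psi> x) \<le> A * indicator ?N x) \<and>
     (\<forall>x h. norm (complex_of_real (\<eta> (x + h)) * \<psi> (x + h) - complex_of_real (\<eta> x) * \<psi> x)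
        \<le> min 1 (norm h / \<epsilon>) * (A * indicator ?N x + A * indicator ?N (x + h)))"
      by blast
  qed
qed

text \<open>For \<phi> of bounded support the estimates end in |u \<phi>| <= K A \<epsilon>^(-max
  (-s) 0) \<theta> M^(1-1/p), where \<theta> > 0 is arbitrary provided that M is small in terms of
  \<theta>. So the hypothesis fixes \<open>C\<close> first and then asks for arbitrarily small
  \<open>M\<close>, each with an \<epsilon> whose power compensates M^(1-1/p). Letting \<theta> tend
  to 0 gives u \<phi> = 0, and the tail estimate extends this to all \<psi>.\<close>

theorem sp_null_criterion:
  fixes E :: "'a::euclidean_space set"
  assumes p: "1 < p" and E: "closed E" and s: "- 1 < s"
    and small: "\<And>R. \<exists>C>0. \<forall>m>0. \<exists>\<epsilon> M. 0 < \<epsilon> \<and> \<epsilon> \<le> 1 \<and> 0 < M \<and> M \<le> m \<and>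
       emeasure lborel {x. \<exists>y\<in>E \<inter> cball 0 R. dist x y < \<epsilon>} \<le> ennreal M \<and>
       M powr (1 - 1 / p) \<le> C * \<epsilon> powr (max (- s) 0)"
  shows "sp_null s p E"
  unfolding sp_null_def
proof (intro allI impI ballI, elim conjE)
  fix u :: "('a \<Rightarrow> complex) \<Rightarrow> complex" and \<psi> :: "'a \<Rightarrow> complex"
  assume u: "in_Hsp s p u" and sup: "dist_support u \<subseteq> E" and \<psi>: "\<psi> \<in> schwartz"
  have T: "tempered u" using u by (simp add: in_Hsp_def)
  obtain g where g: "g \<in> borel_measurable lebesgue" "integrable lebesgue (\<lambda>x. norm (g x) powr p)"
    and ug: "\<And>\<phi>. \<phi> \<in> schwartz \<Longrightarrow> bessel_potential s u \<phi> = (\<integral>x. g x * \<phi> x \<partial>lebesgue)"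
    using u unfolding in_Hsp_def is_Lp_distribution_def by blast
  obtain \<gamma> where \<gamma>: "\<gamma> \<in> borel_measurable borel" "\<And>x. 0 \<le> \<gamma> x" "integrable lborel (\<lambda>x. \<gamma> x powr p)"
    "\<And>f. ennreal (norm (\<integral>x. g x * f x \<partial>lebesgue)) \<le> (\<integral>\<^sup>+x. ennreal (\<gamma> x) * ennreal (norm (f x)) \<partial>lborel)"
    by (rule Lp_representative[OF g]) blast
  note [measurable] = \<gamma>(1)
  have "- s < 1" using s by simp
  then obtain K where K: "K > 0" and est:
    "\<And>(\<phi> :: 'a \<Rightarrow> complex) G W B \<epsilon>. \<phi> \<in> schwartz \<Longrightarrow> G \<in> borel_measurable borel \<Longrightarrow> W \<in> borel_measurable borel \<Longrightarrow>
       0 < \<epsilon> \<Longrightarrow> \<epsilon> \<le> 1 \<Longrightarrow> (\<And>x. ennreal (norm (\<phi> x)) \<le> W x) \<Longrightarrow>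
       (\<And>x h. ennreal (norm (\<phi> (x + h) - \<phi> x)) \<le> ennreal (min 1 (norm h / \<epsilon>)) * (W x + W (x + h))) \<Longrightarrow>
       (\<And>h. (\<integral>\<^sup>+x. G x * W (x + h) \<partial>lborel) \<le> B) \<Longrightarrow>
       (\<integral>\<^sup>+x. G x * ennreal (norm (bessel (- s) \<phi> x)) \<partial>lborel) \<le> ennreal (K * \<epsilon> powr (- max (- s) 0)) * B"
    by (rule bessel_estimate[of "- s", where 'a='a]) blast
  have u_bound: "ennreal (norm (u \<phi>)) \<le> ennreal (K * \<epsilon> powr (- max (- s) 0)) * ennreal B"
    if \<phi>: "\<phi> \<in> schwartz" and w: "w \<in> borel_measurable borel" "\<And>x. 0 \<le> w x" and \<epsilon>: "0 < \<epsilon>" "\<epsilon> \<le> 1"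
      and size: "\<And>x. norm (\<phi> x) \<le> w x"
      and osc: "\<And>x h. norm (\<phi> (x + h) - \<phi> x) \<le> min 1 (norm h / \<epsilon>) * (w x + w (x + h))"
      and B: "\<And>h. (\<integral>\<^sup>+x. ennreal (\<gamma> x) * ennreal (w (x + h)) \<partial>lborel) \<le> ennreal B"
    for \<phi> w \<epsilon> B
  proof -
    have bS: "bessel (- s) \<phi> \<in> schwartz" by (rule bessel_schwartz[OF \<phi>])
    have "u \<phi> = (\<integral>x. g x * bessel (- s) \<phi> x \<partial>lebesgue)"
      using ug[OF bS] by (simp add: bessel_potential_eq bessel_inverse[OF \<phi>])
    hence "ennreal (norm (u \<phi>)) \<le> (\<integral>\<^sup>+x. ennreal (\<gamma> x) * ennreal (norm (bessel (- s) \<phi> x)) \<partial>lborel)"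
      using \<gamma>(4)[of "bessel (- s) \<phi>"] by simp
    also have "\<dots> \<le> ennreal (K * \<epsilon> powr (- max (- s) 0)) * ennreal B"
    proof (rule est[OF \<phi> _ _ \<epsilon>, where W="\<lambda>x. ennreal (w x)"])
      fix x h
      have "ennreal (norm (\<phi> (x + h) - \<phi> x)) \<le> ennreal (min 1 (norm h / \<epsilon>) * (w x + w (x + h)))"
        by (rule ennreal_leI[OF osc])
      also have "\<dots> = ennreal (min 1 (norm h / \<epsilon>)) * (ennreal (w x) + ennreal (w (x + h)))"
        using \<epsilon> w(2) by (subst ennreal_plus[symmetric], simp, simp, subst ennreal_mult) auto
      finally show "ennreal (norm (\<phi> (x + h) - \<phi> x)) \<le> ennreal (min 1 (norm h / \<epsilon>)) * (ennreal (w x) + ennreal (w (x + h)))" .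
    qed (use w size B in \<open>auto intro: ennreal_leI\<close>)
    finally show ?thesis .
  qed
  have compact_case: "u \<phi> = 0" if \<phi>: "\<phi> \<in> schwartz" and out: "\<And>x. norm x \<ge> R \<Longrightarrow> \<phi> x = 0" for \<phi> R
  proof -
    let ?K = "E \<inter> cball 0 R"
    have K_compact: "compact ?K" using E by (intro closed_Int_compact) auto
    have supp: "closure {x. h x \<noteq> 0} \<subseteq> cball 0 R" "compact (closure {x. h x \<noteq> 0})"
      if "\<And>x. h x \<noteq> 0 \<Longrightarrow> \<phi> x \<noteq> 0" for h :: "'a \<Rightarrow> complex"
    proof -
      have "{x. h x \<noteq> 0} \<subseteq> cball 0 R" using that out by (force simp: not_less[symmetric])
      thus "closure {x. h x \<noteq> 0} \<subseteq> cball 0 R" by (intro closure_minimal) auto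
      thus "compact (closure {x. h x \<noteq> 0})"
        using compact_Int_closed[OF compact_cball closed_closure, of 0 R "{x. h x \<noteq> 0}"] by (simp add: Int_absorb1)
    qed
    show "u \<phi> = 0"
    proof (cases "?K = {}")
      \<comment> \<open>Cutoffs are built around nonempty sets only; here the support of \<phi>
        already misses \<open>E\<close> and nothing has to be cut.\<close>
      case True
      show ?thesis
        by (rule vanishes_off_support[OF T \<phi>]) (use supp[of \<phi>] True sup in blast)+
    next
      case False
      obtain A where A: "A > 0" and cut: "\<And>K \<epsilon>. K \<noteq> {} \<Longrightarrow> 0 < \<epsilon> \<Longrightarrow> \<epsilon> \<le> 1 \<Longrightarrow> \<exists>\<eta>. (\<lambda>x. complex_of_real (\<eta> x)) \<in> slow_growth \<and>
         (\<forall>x. infdist x K < \<epsilon> / 6 \<longrightarrow> \<eta> x = 1) \<and>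
         (\<forall>x. norm (complex_of_real (\<eta> x) * \<phi> x) \<le> A * indicator {x. infdist x K < \<epsilon>} x) \<and>
         (\<forall>x h. norm (complex_of_real (\<eta> (x + h)) * \<phi> (x + h) - complex_of_real (\<eta> x) * \<phi> x)
            \<le> min 1 (norm h / \<epsilon>) * (A * indicator {x. infdist x K < \<epsilon>} x + A * indicator {x. infdist x K < \<epsilon>} (x + h)))"
        by (rule compact_support_cutoff[OF \<phi>]) blast
      obtain C where C: "C > 0" and small': "\<And>m. m > 0 \<Longrightarrow> \<exists>\<epsilon> M. 0 < \<epsilon> \<and> \<epsilon> \<le> 1 \<and> 0 < M \<and> M \<le> m \<and>
       emeasure lborel {x. \<exists>y\<in>?K. dist x y < \<epsilon>} \<le> ennreal M \<and>
       M powr (1 - 1 / p) \<le> C * \<epsilon> powr (max (- s) 0)"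
        using small[of R] by blast
      have bound: "norm (u \<phi>) \<le> K * (A * C) * \<theta>" if \<theta>: "\<theta> > 0" for \<theta>
      proof -
        obtain m where m: "m > 0" "\<And>M N. 0 < M \<Longrightarrow> M \<le> m \<Longrightarrow> N \<in> sets borel \<Longrightarrow> emeasure lborel N \<le> ennreal M \<Longrightarrow>
          (\<integral>\<^sup>+x. ennreal (\<gamma> x) * indicator N x \<partial>lborel) \<le> ennreal (\<theta> * M powr (1 - 1 / p))"
          by (rule Lp_small_sets[OF p \<gamma>(1-3) \<theta>]) blast
        obtain \<epsilon> M where \<epsilon>: "0 < \<epsilon>" "\<epsilon> \<le> 1" and M: "0 < M" "M \<le> m"
          "emeasure lborel {x. \<exists>y\<in>?K. dist x y < \<epsilon>} \<le> ennreal M"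
          "M powr (1 - 1 / p) \<le> C * \<epsilon> powr (max (- s) 0)" using small'[OF m(1)] by blast
        let ?N = "{x. infdist x ?K < \<epsilon>}"
        have N_eq: "?N \<subseteq> {x. \<exists>y\<in>?K. dist x y < \<epsilon>}"
        proof safe
          fix x assume "infdist x ?K < \<epsilon>"
          moreover obtain y where "y \<in> ?K" "infdist x ?K = dist x y"
            using infdist_attains_inf[OF compact_imp_closed[OF K_compact] False] by blast
          ultimately show "\<exists>y\<in>?K. dist x y < \<epsilon>" by auto
        qed
        have N_open: "open ?N" by (intro open_Collect_less continuous_intros)
        have "open {x. \<exists>y\<in>?K. dist x y < \<epsilon>}"
        proof -
          have "{x. \<exists>y\<in>?K. dist x y < \<epsilon>} = (\<Union>y\<in>?K. ball y \<epsilon>)" by (auto simp: dist_commute)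
          thus ?thesis by (simp add: open_UN)
        qed
        hence N_small: "emeasure lborel ?N \<le> ennreal M"
          using emeasure_mono[OF N_eq, of lborel] M(3) by (auto intro: order_trans)
        obtain \<eta> where \<eta>: "(\<lambda>x. complex_of_real (\<eta> x)) \<in> slow_growth"
          "\<And>x. infdist x ?K < \<epsilon> / 6 \<Longrightarrow> \<eta> x = 1"
          "\<And>x. norm (complex_of_real (\<eta> x) * \<phi> x) \<le> A * indicator ?N x"
          "\<And>x h. norm (complex_of_real (\<eta> (x + h)) * \<phi> (x + h) - complex_of_real (\<eta> x) * \<phi> x)
            \<le> min 1 (norm h / \<epsilon>) * (A * indicator ?N x + A * indicator ?N (x + h))"
          using cut[OF False \<epsilon>] by blast
        let ?f = "\<lambda>x. complex_of_real (\<eta> x) * \<phi> x" and ?g = "\<lambda>x. \<phi> x - complex_of_real (\<eta> x) * \<phi> x"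
        have f: "?f \<in> schwartz" by (rule schwartz_mult[OF \<eta>(1) \<phi>])
        have g: "?g \<in> schwartz" by (rule schwartz_diff[OF \<phi> f])
        \<comment> \<open>\<open>?g\<close> vanishes off the ball because \<phi> does, and near the
          points of \<open>E\<close> in the ball because \<eta> = 1 there; hence its support misses
          \<open>E\<close>.\<close>
        have "u ?g = 0"
        proof (rule vanishes_off_support[OF T g])
          show "compact (closure {x. ?g x \<noteq> 0})" by (rule supp(2)) auto
          have "closure {x. ?g x \<noteq> 0} \<subseteq> {x. infdist x ?K \<ge> \<epsilon> / 6}"
          proof (rule closure_minimal)
            show "{x. ?g x \<noteq> 0} \<subseteq> {x. infdist x ?K \<ge> \<epsilon> / 6}"
            proof safe
              fix x assume "?g x \<noteq> 0"
              hence "\<eta> x \<noteq> 1" by auto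
              thus "infdist x ?K \<ge> \<epsilon> / 6" using \<eta>(2)[of x] by linarith
            qed
            show "closed {x. infdist x ?K \<ge> \<epsilon> / 6}" by (intro closed_Collect_le continuous_intros)
          qed
          moreover have "infdist x ?K = 0" if "x \<in> ?K" for x using that by (rule infdist_zero)
          moreover have "closure {x. ?g x \<noteq> 0} \<subseteq> cball 0 R" by (rule supp(1)) auto
          ultimately show "closure {x. ?g x \<noteq> 0} \<inter> dist_support u = {}" using sup \<epsilon>(1) by fastforce
        qed
        hence uf: "u \<phi> = u ?f" using tempered_add[OF T f g] by simp
        have "ennreal (norm (u ?f)) \<le> ennreal (K * \<epsilon> powr (- max (- s) 0)) * ennreal (A * (\<theta> * M powr (1 - 1 / p)))"
        proof (rule u_bound[OF f _ _ \<epsilon>])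
          show "(\<lambda>x. A * indicator ?N x) \<in> borel_measurable borel"
            using N_open by (intro borel_measurable_times borel_measurable_indicator) auto
          show "0 \<le> A * indicator ?N x" for x using A by simp
          fix h
          \<comment> \<open>The translates of \<open>?N\<close> are no longer neighbourhoods of
            \<open>?K\<close>. What survives is their measure, which is why \<open>m\<close> was
            chosen for arbitrary Borel sets.\<close>
          have Nh: "{x. x + h \<in> ?N} \<in> sets borel"
            unfolding mem_Collect_eq by (intro borel_open open_Collect_less continuous_intros)
          have "(\<integral>\<^sup>+x. ennreal (\<gamma> x) * ennreal (A * indicator ?N (x + h)) \<partial>lborel) =
            (\<integral>\<^sup>+x. ennreal A * (ennreal (\<gamma> x) * indicator {x. x + h \<in> ?N} x) \<partial>lborel)"
            using A by (intro nn_integral_cong) (auto split: split_indicator simp: mult.commute)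
          also have "\<dots> = ennreal A * (\<integral>\<^sup>+x. ennreal (\<gamma> x) * indicator {x. x + h \<in> ?N} x \<partial>lborel)"
            using Nh by (intro nn_integral_cmult borel_measurable_times_ennreal borel_measurable_indicator) auto
          also have "\<dots> \<le> ennreal A * ennreal (\<theta> * M powr (1 - 1 / p))"
          proof (intro mult_left_mono m(2) M)
            show "{x. x + h \<in> ?N} \<in> sets borel" by (rule Nh)
            have "emeasure lborel ?N = emeasure lborel {x. x + h \<in> ?N}"
            proof -
              have N: "?N \<in> sets borel" using N_open by auto
              hence "emeasure lborel ?N = (\<integral>\<^sup>+x. indicator ?N x \<partial>lborel)" by simp
              also have "\<dots> = (\<integral>\<^sup>+x. indicator ?N (h + 1 *\<^sub>R x) \<partial>lborel)"
                using N by (subst nn_integral_affine[of _ 1 h]) (auto intro: borel_measurable_indicator)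
              also have "\<dots> = (\<integral>\<^sup>+x. indicator {x. x + h \<in> ?N} x \<partial>lborel)"
                by (intro nn_integral_cong) (auto simp: add.commute split: split_indicator)
              also have "\<dots> = emeasure lborel {x. x + h \<in> ?N}" using Nh by (intro nn_integral_indicator) auto
              finally show ?thesis .
            qed
            thus "emeasure lborel {x. x + h \<in> ?N} \<le> ennreal M" using N_small by simp
          qed auto
          also have "\<dots> = ennreal (A * (\<theta> * M powr (1 - 1 / p)))" using A \<theta> by (simp add: ennreal_mult)
          finally show "(\<integral>\<^sup>+x. ennreal (\<gamma> x) * ennreal (A * indicator ?N (x + h)) \<partial>lborel) \<le> ennreal (A * (\<theta> * M powr (1 - 1 / p)))" .
        qed (use \<eta> in auto)
        also have "\<dots> = ennreal (K * \<epsilon> powr (- max (- s) 0) * (A * (\<theta> * M powr (1 - 1 / p))))"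
          using K A \<theta> by (subst ennreal_mult[symmetric]) auto
        finally have "norm (u \<phi>) \<le> K * \<epsilon> powr (- max (- s) 0) * (A * (\<theta> * M powr (1 - 1 / p)))"
          unfolding uf using K A \<theta> by (subst (asm) ennreal_le_iff) auto
        also have "\<dots> \<le> K * \<epsilon> powr (- max (- s) 0) * (A * (\<theta> * (C * \<epsilon> powr (max (- s) 0))))"
          using K A \<theta> by (intro mult_left_mono M(4)) auto
        also have "\<dots> = K * (A * C) * \<theta> * (\<epsilon> powr (- max (- s) 0) * \<epsilon> powr (max (- s) 0))"
          by (simp only: mult_ac)
        also have "\<epsilon> powr (- max (- s) 0) * \<epsilon> powr (max (- s) 0) = 1"
          using \<epsilon> by (subst powr_add[symmetric]) simp
        finally show ?thesis by simp
      qed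
      have KAC: "K * (A * C) > 0" using K A C by simp
      have "norm (u \<phi>) \<le> 0 + e" if "e > 0" for e
      proof -
        have "norm (u \<phi>) \<le> K * (A * C) * (e / (K * (A * C)))" using that KAC by (intro bound divide_pos_pos)
        also have "\<dots> = e" using KAC by (metis less_irrefl nonzero_mult_div_cancel_left times_divide_eq_right)
        finally show ?thesis by simp
      qed
      hence "norm (u \<phi>) \<le> 0" by (rule field_le_epsilon)
      thus ?thesis by simp
    qed
  qed
  obtain A where A: "A > 0" and tail: "\<And>R. R \<ge> 4 \<Longrightarrow> \<exists>\<eta>. (\<lambda>x. complex_of_real (\<eta> x)) \<in> slow_growth \<and>
     (\<forall>x. norm x \<ge> 3 * R \<longrightarrow> \<eta> x = 0) \<and>
     (\<forall>x. norm (\<psi> x - complex_of_real (\<eta> x) * \<psi> x) \<le> A / R * decay x) \<and>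
     (\<forall>x h. norm ((\<psi> (x + h) - complex_of_real (\<eta> (x + h)) * \<psi> (x + h)) - (\<psi> x - complex_of_real (\<eta> x) * \<psi> x))
        \<le> min 1 (norm h) * (A / R * decay x + A / R * decay (x + h)))"
    by (rule schwartz_tail_cutoff[OF \<psi>]) blast
  \<comment> \<open>Since 0 < \<open>decay\<close> <= 1, the product of \<gamma> and a translate of
    \<open>decay\<close> is at most that translate where \<gamma> <= 1, and at most \<gamma>^p
    elsewhere. The resulting bound is uniform in the translation.\<close>
  define D where "D = (\<integral>x. decay (x::'a) \<partial>lborel) + (\<integral>x. \<gamma> x powr p \<partial>lborel)"
  have D: "(\<integral>\<^sup>+x. ennreal (\<gamma> x) * ennreal (decay (x + h)) \<partial>lborel) \<le> ennreal D" for h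
  proof -
    have i: "integrable lborel (\<lambda>x. decay (x + h))"
      using lborel_integrable_affine[OF decay_integrable, of 1 h] by (simp add: add.commute)
    have "(\<integral>\<^sup>+x. ennreal (\<gamma> x) * ennreal (decay (x + h)) \<partial>lborel) \<le> (\<integral>\<^sup>+x. ennreal (decay (x + h) + \<gamma> x powr p) \<partial>lborel)"
    proof (intro nn_integral_mono)
      fix x
      have d: "0 < decay (x + h)" "decay (x + h) \<le> 1" by (rule decay_pos decay_le_1)+
      have "\<gamma> x * decay (x + h) \<le> decay (x + h) + \<gamma> x powr p"
      proof (cases "\<gamma> x \<le> 1")
        case True
        hence "\<gamma> x * decay (x + h) \<le> 1 * decay (x + h)" using d by (intro mult_right_mono) auto
        thus ?thesis using powr_ge_zero[of "\<gamma> x" p] by linarith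
      next
        case False
        hence "\<gamma> x * decay (x + h) \<le> \<gamma> x * 1" using d by (intro mult_left_mono) auto
        also have "\<dots> \<le> \<gamma> x powr p" using False p powr_mono[of 1 p "\<gamma> x"] by simp
        finally show ?thesis using d by linarith
      qed
      thus "ennreal (\<gamma> x) * ennreal (decay (x + h)) \<le> ennreal (decay (x + h) + \<gamma> x powr p)"
        using \<gamma>(2) d by (subst ennreal_mult[symmetric]) (auto intro: ennreal_leI simp del: ennreal_plus)
    qed
    also have "\<dots> = ennreal (\<integral>x. decay (x + h) + \<gamma> x powr p \<partial>lborel)"
      by (intro nn_integral_eq_integral Bochner_Integration.integrable_add i \<gamma>(3) AE_I2
          add_nonneg_nonneg powr_ge_zero less_imp_le[OF decay_pos])
    also have "(\<integral>x. decay (x + h) + \<gamma> x powr p \<partial>lborel) = D"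
      using lborel_integral_affine[of "decay :: 'a \<Rightarrow> real" 1 h] i \<gamma>(3)
      by (simp add: D_def Bochner_Integration.integral_add add.commute)
    finally show ?thesis .
  qed
  have D0: "D \<ge> 0" unfolding D_def
    by (intro add_nonneg_nonneg Bochner_Integration.integral_nonneg) (auto intro: less_imp_le decay_pos)
  have "norm (u \<psi>) \<le> K * (A / R * D)" if R: "R \<ge> 4" for R
  proof -
    obtain \<eta> where \<eta>: "(\<lambda>x. complex_of_real (\<eta> x)) \<in> slow_growth" "\<And>x. norm x \<ge> 3 * R \<Longrightarrow> \<eta> x = 0"
      "\<And>x. norm (\<psi> x - complex_of_real (\<eta> x) * \<psi> x) \<le> A / R * decay x"
      "\<And>x h. norm ((\<psi> (x + h) - complex_of_real (\<eta> (x + h)) * \<psi> (x + h)) - (\<psi> x - complex_of_real (\<eta> x) * \<psi> x))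
        \<le> min 1 (norm h) * (A / R * decay x + A / R * decay (x + h))" using tail[OF R] by blast
    let ?f = "\<lambda>x. complex_of_real (\<eta> x) * \<psi> x" and ?g = "\<lambda>x. \<psi> x - complex_of_real (\<eta> x) * \<psi> x"
    have f: "?f \<in> schwartz" by (rule schwartz_mult[OF \<eta>(1) \<psi>])
    have g: "?g \<in> schwartz" by (rule schwartz_diff[OF \<psi> f])
    have "u ?f = 0" by (rule compact_case[OF f, of "3 * R"]) (simp add: \<eta>(2))
    hence ug: "u \<psi> = u ?g" using tempered_add[OF T f g] by simp
    \<comment> \<open>The tail oscillates at scale 1, so the power of \<epsilon> is 1 and the factor
      1/R remains to tend to 0.\<close>
    have "ennreal (norm (u ?g)) \<le> ennreal (K * 1 powr (- max (- s) 0)) * ennreal (A / R * D)"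
    proof (rule u_bound[OF g])
      show "(\<lambda>x. A / R * decay x) \<in> borel_measurable borel" by measurable
      show "0 \<le> A / R * decay x" for x using A R decay_pos[of x] by simp
      fix h
      have split: "ennreal (A / R * decay (x + h)) = ennreal (A / R) * ennreal (decay (x + h))" for x h :: 'a
        using A R by (intro ennreal_mult less_imp_le[OF decay_pos]) auto
      have "(\<integral>\<^sup>+x. ennreal (\<gamma> x) * ennreal (A / R * decay (x + h)) \<partial>lborel) =
        ennreal (A / R) * (\<integral>\<^sup>+x. ennreal (\<gamma> x) * ennreal (decay (x + h)) \<partial>lborel)"
        unfolding split by (subst nn_integral_cmult[symmetric], measurable) (simp only: mult_ac)
      also have "\<dots> \<le> ennreal (A / R) * ennreal D" by (intro mult_left_mono D) auto
      also have "\<dots> = ennreal (A / R * D)" by (rule ennreal_mult[symmetric]) (use A R D0 in auto)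
      finally show "(\<integral>\<^sup>+x. ennreal (\<gamma> x) * ennreal (A / R * decay (x + h)) \<partial>lborel) \<le> ennreal (A / R * D)" .
    qed (use \<eta>(3,4) in auto)
    also have "\<dots> = ennreal (K * (A / R * D))" using K A R D0 by (subst ennreal_mult[symmetric]) auto
    finally show ?thesis unfolding ug using K A R D0 by (subst (asm) ennreal_le_iff) auto
  qed
  note bound = this
  have "((\<lambda>R. K * (A / R * D)) \<longlongrightarrow> K * (0 * D)) at_top"
    by (intro tendsto_mult tendsto_const tendsto_divide_0[OF tendsto_const] filterlim_at_top_imp_at_infinity filterlim_ident)
  hence "norm (u \<psi>) \<le> K * (0 * D)"
  proof (rule tendsto_lowerbound)
    show "\<forall>\<^sub>F R in at_top. norm (u \<psi>) \<le> K * (A / R * D)"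
      using eventually_ge_at_top[of 4] by eventually_elim (rule bound)
  qed simp
  thus "u \<psi> = 0" by simp
qed

section \<open>Boundaries of graph domains\<close>

text \<open>Signed distance to the graph in the direction \<open>e\<close>, defined on the whole
  space and without rotated coordinates. Inside \<open>U\<close> the domain is where it is negative,
  and moving by t along the unit vector \<open>e\<close> raises it by t.\<close>

definition height :: "('a::euclidean_space \<Rightarrow> real) \<Rightarrow> 'a \<Rightarrow> 'a \<Rightarrow> real" where
  "height f e y = y \<bullet> e - f (y - (y \<bullet> e) *\<^sub>R e)"

lemma height_continuous:
  assumes "norm e = 1" and f: "continuous_on {y. y \<bullet> e = 0} f"
  shows "continuous_on UNIV (height f e)"
proof -
  have "e \<bullet> e = 1" using assms(1) by (simp add: dot_square_norm)
  hence "continuous_on UNIV (f \<circ> (\<lambda>y. y - (y \<bullet> e) *\<^sub>R e))"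
    by (intro continuous_on_compose continuous_intros continuous_on_subset[OF f])
      (auto simp: inner_diff_left)
  thus ?thesis unfolding height_def[abs_def] o_def by (intro continuous_intros)
qed

lemma height_shift:
  assumes "norm e = 1"
  shows "height f e (y + t *\<^sub>R e) = height f e y + t"
proof -
  have "e \<bullet> e = 1" using assms by (simp add: dot_square_norm)
  thus ?thesis by (simp add: height_def inner_add_left algebra_simps)
qed

lemma holder_on_continuous:
  assumes "holder_on \<alpha> f H" "\<alpha> > 0"
  shows "continuous_on H f"
proof -
  obtain C where C: "\<And>a b. a \<in> H \<Longrightarrow> b \<in> H \<Longrightarrow> \<bar>f a - f b\<bar> \<le> C * norm (a - b) powr \<alpha>"
    using assms(1) unfolding holder_on_def by blast
  show ?thesis
    unfolding continuous_on_def
  proof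
    fix x assume x: "x \<in> H"
    have "((\<lambda>y. norm (y - x) powr \<alpha>) \<longlongrightarrow> 0) (at x within H)"
    proof (rule tendsto_zero_powrI)
      show "((\<lambda>y. norm (y - x)) \<longlongrightarrow> 0) (at x within H)"
        by (intro tendsto_norm_zero LIM_zero tendsto_ident_at)
    qed (use assms(2) in auto)
    hence "((\<lambda>y. C * norm (y - x) powr \<alpha>) \<longlongrightarrow> 0) (at x within H)"
      by (rule tendsto_mult_right_zero)
    moreover have "\<forall>\<^sub>F y in at x within H. norm (f y - f x) \<le> C * norm (y - x) powr \<alpha>"
      using C x by (auto simp: eventually_at_filter)
    ultimately have "((\<lambda>y. f y - f x) \<longlongrightarrow> 0) (at x within H)" by (rule Lim_null_comparison[rotated])
    thus "(f \<longlongrightarrow> f x) (at x within H)" by (rule LIM_zero_cancel)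
  qed
qed

lemma holder_domain_C0: "graph_domain (holder_on \<alpha>) \<Omega> \<Longrightarrow> \<alpha> > 0 \<Longrightarrow> C0_domain \<Omega>"
  unfolding C0_domain_def graph_domain_def using holder_on_continuous by blast

text \<open>The height is continuous, so points of \<open>U\<close> with positive height form an
  open set that misses the domain, while points of \<open>U\<close> with negative height belong to
  the open set \<Omega>. Neither kind can be on the frontier.\<close>

lemma frontier_height_zero:
  assumes "open \<Omega>" and e: "norm e = 1" and U: "open U" and f: "continuous_on {y. y \<bullet> e = 0} f"
    and \<Omega>: "\<Omega> \<inter> U = {y \<in> U. y \<bullet> e < f (y - (y \<bullet> e) *\<^sub>R e)}"
    and y: "y \<in> frontier \<Omega>" "y \<in> U"
  shows "height f e y = 0"
proof (rule ccontr)
  have \<Omega>': "z \<in> \<Omega> \<longleftrightarrow> height f e z < 0" if "z \<in> U" for z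
  proof -
    have "z \<in> \<Omega> \<longleftrightarrow> z \<in> \<Omega> \<inter> U" using that by simp
    thus ?thesis unfolding \<Omega> using that by (simp add: height_def)
  qed
  assume "height f e y \<noteq> 0"
  then consider "height f e y < 0" | "height f e y > 0" by linarith
  thus False
  proof cases
    case 1
    hence "y \<in> \<Omega>" using \<Omega>' y by simp
    thus False using y(1) \<open>open \<Omega>\<close> by (simp add: frontier_def interior_open)
  next
    case 2
    let ?W = "U \<inter> {z. height f e z > 0}"
    have "open ?W"
      by (intro open_Int U open_Collect_less continuous_on_const height_continuous[OF e f])
    moreover have "?W \<inter> \<Omega> = {}" using \<Omega>' by force
    ultimately have "?W \<inter> closure \<Omega> = {}" by (metis open_Int_closure_eq_empty)
    thus False using y 2 by (auto simp: frontier_def)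
  qed
qed

text \<open>A frontier point has height 0. Moving from it along \<open>e\<close>, by half the radius
  of a ball inside \<open>U\<close>, reaches positive height, an open condition that holds only off
  the domain.\<close>

lemma C0_domain_exterior:
  fixes \<Omega> :: "'a::euclidean_space set"
  assumes "C0_domain \<Omega>" "\<Omega> \<noteq> UNIV"
  shows "interior (- \<Omega>) \<noteq> {}"
proof -
  have \<Omega>: "\<Omega> \<noteq> {}" "open \<Omega>" using assms(1) by (auto simp: C0_domain_def graph_domain_def)
  then obtain x where x: "x \<in> frontier \<Omega>" using frontier_not_empty[OF _ assms(2)] by blast
  then obtain e U f where eU: "norm e = 1" "open U" "x \<in> U" "continuous_on {y. y \<bullet> e = 0} f"
    "\<Omega> \<inter> U = {y \<in> U. y \<bullet> e < f (y - (y \<bullet> e) *\<^sub>R e)}"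
    using assms(1) unfolding C0_domain_def graph_domain_def by blast
  have x0: "height f e x = 0" by (rule frontier_height_zero[OF \<Omega>(2) eU(1,2,4,5) x eU(3)])
  obtain r where r: "r > 0" "ball x r \<subseteq> U" using eU(2,3) open_contains_ball by blast
  let ?W = "U \<inter> {z. height f e z > 0}"
  have "x + (r / 2) *\<^sub>R e \<in> ?W"
    using r eU(1) by (auto simp: height_shift x0 dist_norm intro!: subsetD[OF r(2)])
  moreover have "?W \<subseteq> - \<Omega>"
  proof safe
    fix z assume "z \<in> U" "0 < height f e z" "z \<in> \<Omega>"
    hence "z \<in> \<Omega> \<inter> U" by simp
    thus False unfolding eU(5) using \<open>0 < height f e z\<close> by (simp add: height_def)
  qed
  moreover have "open ?W"
    by (intro open_Int eU open_Collect_less continuous_on_const height_continuous)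
  ultimately show ?thesis using interior_maximal by blast
qed

text \<open>Averaging the translates of \<open>S\<close> along \<open>e\<close> replaces Fubini in rotated coordinates.\<close>

lemma emeasure_le_fibres:
  fixes S :: "'a::euclidean_space set"
  assumes S[measurable]: "S \<in> sets borel" and sub: "S \<subseteq> ball 0 r" and e: "norm e = 1"
    and fib: "\<And>y. emeasure lborel {t::real. y + t *\<^sub>R e \<in> S} \<le> c"
  shows "emeasure lborel S \<le> c * emeasure lborel (ball (0::'a) (r + 1))"
proof -
  have "emeasure lborel S = (\<integral>\<^sup>+t. indicator {0..1::real} t * emeasure lborel S \<partial>lborel)"
    by (simp add: nn_integral_multc)
  also have "\<dots> = (\<integral>\<^sup>+t. (\<integral>\<^sup>+y. indicator {0..1::real} t * indicator S (y + t *\<^sub>R e) \<partial>lborel) \<partial>lborel)"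
  proof (intro nn_integral_cong)
    fix t :: real
    have "emeasure lborel S = (\<integral>\<^sup>+y. indicator S y \<partial>lborel)" by simp
    also have "\<dots> = (\<integral>\<^sup>+y. indicator S (t *\<^sub>R e + 1 *\<^sub>R y) \<partial>lborel)"
      by (subst nn_integral_affine[of _ 1 "t *\<^sub>R e"]) auto
    finally have eq: "emeasure lborel S = (\<integral>\<^sup>+y. indicator S (y + t *\<^sub>R e) \<partial>lborel)" by (simp add: add.commute)
    have "(\<integral>\<^sup>+y. indicator {0..1::real} t * indicator S (y + t *\<^sub>R e) \<partial>lborel) =
      indicator {0..1::real} t * (\<integral>\<^sup>+y. indicator S (y + t *\<^sub>R e) \<partial>lborel)"
      by (rule nn_integral_cmult) measurable
    thus "indicator {0..1::real} t * emeasure lborel S =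
      (\<integral>\<^sup>+y. indicator {0..1::real} t * indicator S (y + t *\<^sub>R e) \<partial>lborel)"
      unfolding eq ..
  qed
  also have "\<dots> = (\<integral>\<^sup>+y. (\<integral>\<^sup>+t. indicator {0..1::real} t * indicator S (y + t *\<^sub>R e) \<partial>lborel) \<partial>lborel)"
    by (rule lborel_pair.Fubini') measurable
  \<comment> \<open>Translations of length at most 1 reach \<open>ball 0 r\<close> only from
    \<open>ball 0 (r + 1)\<close>.\<close>
  also have "\<dots> \<le> (\<integral>\<^sup>+y. c * indicator (ball (0::'a) (r + 1)) y \<partial>lborel)"
  proof (intro nn_integral_mono)
    fix y :: 'a
    show "(\<integral>\<^sup>+t. indicator {0..1::real} t * indicator S (y + t *\<^sub>R e) \<partial>lborel) \<le> c * indicator (ball 0 (r + 1)) y"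
    proof (cases "y \<in> ball 0 (r + 1)")
      case True
      have "(\<integral>\<^sup>+t. indicator {0..1::real} t * indicator S (y + t *\<^sub>R e) \<partial>lborel) \<le>
        (\<integral>\<^sup>+t. indicator {t::real. y + t *\<^sub>R e \<in> S} t \<partial>lborel)"
        by (intro nn_integral_mono) (auto split: split_indicator)
      also have "\<dots> = emeasure lborel {t::real. y + t *\<^sub>R e \<in> S}"
        by (rule nn_integral_indicator) measurable
      finally show ?thesis using fib[of y] True by simp
    next
      case False
      have "indicator {0..1::real} t * indicator S (y + t *\<^sub>R e) = (0::ennreal)" for t
      proof (cases "t \<in> {0..1}")
        case True
        have "norm y \<le> norm (y + t *\<^sub>R e) + norm (t *\<^sub>R e)"
          using norm_triangle_ineq4[of "y + t *\<^sub>R e" "t *\<^sub>R e"] by simp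
        hence "norm (y + t *\<^sub>R e) \<ge> r" using False True e by auto
        hence "y + t *\<^sub>R e \<notin> S" using sub by auto
        thus ?thesis by simp
      qed simp
      hence "(\<integral>\<^sup>+t. indicator {0..1::real} t * indicator S (y + t *\<^sub>R e) \<partial>lborel) = (\<integral>\<^sup>+t. 0 \<partial>(lborel :: real measure))"
        by (intro nn_integral_cong) (simp only:)
      thus ?thesis by simp
    qed
  qed
  also have "\<dots> = c * emeasure lborel (ball (0::'a) (r + 1))"
    by (simp add: nn_integral_cmult_indicator)
  finally show ?thesis .
qed

text \<open>Along \<open>e\<close> the height grows with unit speed, so each line meets the layer in
  a set contained in an interval of length 2 \<delta>.\<close>

lemma emeasure_graph_layer:
  fixes e :: "'a::euclidean_space"
  assumes e: "norm e = 1" and f: "continuous_on {y. y \<bullet> e = 0} f" and "\<delta> \<ge> 0"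
  shows "emeasure lborel {y \<in> ball 0 r. \<bar>height f e y\<bar> \<le> \<delta>} \<le>
    ennreal (2 * \<delta>) * emeasure lborel (ball (0::'a) (r + 1))"
proof (rule emeasure_le_fibres[OF _ _ e])
  have [measurable]: "height f e \<in> borel_measurable borel"
    by (rule borel_measurable_continuous_onI[OF height_continuous[OF e f]])
  show "{y \<in> ball 0 r. \<bar>height f e y\<bar> \<le> \<delta>} \<in> sets borel" by measurable
  fix y
  have "emeasure lborel {t::real. y + t *\<^sub>R e \<in> {y \<in> ball 0 r. \<bar>height f e y\<bar> \<le> \<delta>}} \<le>
     emeasure lborel {- height f e y - \<delta> .. - height f e y + \<delta>}"
    by (intro emeasure_mono) (auto simp: height_shift[OF e])
  also have "\<dots> = ennreal (2 * \<delta>)" using assms(3) by simp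
  finally show "emeasure lborel {t::real. y + t *\<^sub>R e \<in> {y \<in> ball 0 r. \<bar>height f e y\<bar> \<le> \<delta>}} \<le> ennreal (2 * \<delta>)" .
qed auto

section \<open>Measure of neighbourhoods of the boundary\<close>

lemma emeasure_ball_fin: "emeasure lborel (ball (a::'a::euclidean_space) r) = ennreal (measure lborel (ball a r))"
  using emeasure_lborel_ball_finite[of a r] by (intro emeasure_eq_ennreal_measure) auto

lemma open_neighbourhood: "open {x. \<exists>y\<in>A. dist x y < (\<epsilon>::real)}"
proof -
  have "{x. \<exists>y\<in>A. dist x y < \<epsilon>} = (\<Union>y\<in>A. ball y \<epsilon>)" by (auto simp: dist_commute)
  thus ?thesis by (simp add: open_UN)
qed

text \<open>Locally the frontier lies in a layer of thickness 0. A compact piece is covered by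
  finitely many charts, and balls of integer radius exhaust the space.\<close>

lemma C0_domain_frontier_null:
  fixes \<Omega> :: "'a::euclidean_space set"
  assumes "C0_domain \<Omega>"
  shows "emeasure lborel (frontier \<Omega>) = 0"
proof -
  have \<Omega>: "open \<Omega>" using assms(1) by (auto simp: C0_domain_def graph_domain_def)
  have local: "frontier \<Omega> \<inter> cball 0 R \<in> null_sets lborel" for R
  proof -
    let ?K = "frontier \<Omega> \<inter> cball 0 R"
    have K: "compact ?K" by (intro closed_Int_compact) auto
    let ?C = "{U. open U \<and> ?K \<inter> U \<in> null_sets lborel}"
    have "?K \<subseteq> \<Union>?C"
    proof
      fix x assume x: "x \<in> ?K"
      then obtain e U f where eU: "norm e = 1" "open U" "x \<in> U" "continuous_on {y. y \<bullet> e = 0} f"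
        "\<Omega> \<inter> U = {y \<in> U. y \<bullet> e < f (y - (y \<bullet> e) *\<^sub>R e)}"
        using assms(1) unfolding C0_domain_def graph_domain_def by blast
      let ?S = "{y \<in> ball 0 (R + 1). \<bar>height f e y\<bar> \<le> 0}"
      have [measurable]: "height f e \<in> borel_measurable borel"
        by (rule borel_measurable_continuous_onI[OF height_continuous[OF eU(1,4)]])
      have "?S \<in> sets lborel" by measurable
      moreover have "emeasure lborel ?S = 0" using emeasure_graph_layer[OF eU(1,4), of 0 "R + 1"] by simp
      ultimately have "?S \<in> null_sets lborel" by blast
      moreover have "?K \<inter> U \<subseteq> ?S" using frontier_height_zero[OF \<Omega> eU(1,2,4,5)] by auto
      moreover have "?K \<inter> U \<in> sets lborel" using eU(2) by auto
      ultimately show "x \<in> \<Union>?C" using eU(2,3) null_sets_subset[of ?S lborel "?K \<inter> U"] by blast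
    qed
    then obtain D where D: "D \<subseteq> ?C" "finite D" "?K \<subseteq> \<Union>D" using compactE[OF K, of ?C] by blast
    hence "(\<Union>U\<in>D. ?K \<inter> U) \<in> null_sets lborel" by (intro null_sets_UN' countable_finite) auto
    moreover have "(\<Union>U\<in>D. ?K \<inter> U) = ?K" using D(3) by blast
    ultimately show ?thesis by simp
  qed
  have "frontier \<Omega> = (\<Union>n. frontier \<Omega> \<inter> cball 0 (real n))"
    using real_arch_simple by fastforce
  also have "\<dots> \<in> null_sets lborel" by (intro null_sets_UN local)
  finally show ?thesis by blast
qed

text \<open>A point within \<epsilon> of the graph has height at most \<epsilon> + L
  \<epsilon>^\<alpha>, and \<epsilon> <= \<epsilon>^\<alpha>. The point may well lie outside the
  chart \<open>U\<close>, since the height is defined everywhere; hence the charts of a finite cover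
  can be treated separately and their constants added.\<close>

lemma holder_domain_neighbourhood:
  fixes \<Omega> :: "'a::euclidean_space set"
  assumes dom: "graph_domain (holder_on \<alpha>) \<Omega>" and \<alpha>: "0 < \<alpha>" "\<alpha> \<le> 1"
  obtains C where "C > 0" "\<And>\<epsilon>. 0 < \<epsilon> \<Longrightarrow> \<epsilon> \<le> 1 \<Longrightarrow>
    emeasure lborel {x. \<exists>y\<in>frontier \<Omega> \<inter> cball 0 R. dist x y < \<epsilon>} \<le> ennreal (C * \<epsilon> powr \<alpha>)"
proof -
  have \<Omega>: "open \<Omega>" using dom by (auto simp: graph_domain_def)
  let ?K = "frontier \<Omega> \<inter> cball 0 R"
  let ?N = "\<lambda>U \<epsilon>. {x. \<exists>y\<in>?K \<inter> U. dist x y < \<epsilon>}"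
  let ?Q = "\<lambda>U. \<exists>C>0. \<forall>\<epsilon>. 0 < \<epsilon> \<longrightarrow> \<epsilon> \<le> 1 \<longrightarrow> emeasure lborel (?N U \<epsilon>) \<le> ennreal (C * \<epsilon> powr \<alpha>)"
  have K: "compact ?K" by (intro closed_Int_compact) auto
  let ?C = "{U. open U \<and> ?Q U}"
  have "?K \<subseteq> \<Union>?C"
  proof
    fix x assume x: "x \<in> ?K"
    then obtain e U f where eU: "norm e = 1" "open U" "x \<in> U" "holder_on \<alpha> f {y. y \<bullet> e = 0}"
      "\<Omega> \<inter> U = {y \<in> U. y \<bullet> e < f (y - (y \<bullet> e) *\<^sub>R e)}"
      using dom unfolding graph_domain_def by blast
    have f: "continuous_on {y. y \<bullet> e = 0} f" by (rule holder_on_continuous[OF eU(4) \<alpha>(1)])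
    have ee: "e \<bullet> e = 1" using eU(1) by (simp add: dot_square_norm)
    obtain L where L: "\<And>a b. a \<bullet> e = 0 \<Longrightarrow> b \<bullet> e = 0 \<Longrightarrow> \<bar>f a - f b\<bar> \<le> L * norm (a - b) powr \<alpha>"
      using eU(4) unfolding holder_on_def by blast
    \<comment> \<open>\<open>holder_on\<close> does not fix the sign of its constant, hence the
      maximum; the 1 accounts for the displacement along \<open>e\<close>.\<close>
    let ?L = "1 + max L 0"
    let ?V = "measure lborel (ball (0::'a) (R + 2 + 1)) + 1"
    have "emeasure lborel (?N U \<epsilon>) \<le> ennreal (2 * ?L * ?V * \<epsilon> powr \<alpha>)" if \<epsilon>: "0 < \<epsilon>" "\<epsilon> \<le> 1" for \<epsilon>
    proof -
      let ?\<delta> = "?L * \<epsilon> powr \<alpha>"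
      have "?N U \<epsilon> \<subseteq> {y \<in> ball 0 (R + 2). \<bar>height f e y\<bar> \<le> ?\<delta>}"
      proof safe
        fix z y assume y: "y \<in> frontier \<Omega>" "y \<in> cball 0 R" "y \<in> U" and zy: "dist z y < \<epsilon>"
        show "z \<in> ball 0 (R + 2)"
          using y(2) zy \<epsilon> norm_triangle_ineq2[of z y] by (simp add: dist_norm)
        let ?P = "\<lambda>y. y - (y \<bullet> e) *\<^sub>R e"
        have Pe: "?P w \<bullet> e = 0" for w using ee by (simp add: inner_diff_left)
        have "norm (?P z - ?P y) \<le> norm (z - y)"
        proof -
          let ?d = "z - y"
          have "(norm (?d - (?d \<bullet> e) *\<^sub>R e))\<^sup>2 = (norm ?d)\<^sup>2 - (?d \<bullet> e)\<^sup>2"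
            unfolding power2_norm_eq_inner using ee
            by (simp add: inner_diff_left inner_diff_right inner_commute power2_eq_square algebra_simps)
          hence "(norm (?d - (?d \<bullet> e) *\<^sub>R e))\<^sup>2 \<le> (norm ?d)\<^sup>2" by simp
          hence "norm (?d - (?d \<bullet> e) *\<^sub>R e) \<le> norm ?d" by (rule power2_le_imp_le) simp
          moreover have "?P z - ?P y = ?d - (?d \<bullet> e) *\<^sub>R e" by (simp add: inner_diff_left algebra_simps)
          ultimately show ?thesis by (simp only:)
        qed
        hence P: "norm (?P z - ?P y) powr \<alpha> \<le> \<epsilon> powr \<alpha>"
          using zy \<alpha> by (intro powr_mono2) (auto simp: dist_norm)
        have "\<bar>f (?P z) - f (?P y)\<bar> \<le> L * norm (?P z - ?P y) powr \<alpha>" by (intro L Pe)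
        also have "\<dots> \<le> max L 0 * norm (?P z - ?P y) powr \<alpha>" by (intro mult_right_mono) auto
        also have "\<dots> \<le> max L 0 * \<epsilon> powr \<alpha>" by (intro mult_left_mono P) auto
        finally have 1: "\<bar>f (?P z) - f (?P y)\<bar> \<le> max L 0 * \<epsilon> powr \<alpha>" .
        have "\<bar>z \<bullet> e - y \<bullet> e\<bar> \<le> norm (z - y) * norm e"
          unfolding inner_diff_left[symmetric] by (rule Cauchy_Schwarz_ineq2)
        also have "\<dots> \<le> \<epsilon>" using zy eU(1) by (simp add: dist_norm)
        also have "\<epsilon> \<le> \<epsilon> powr \<alpha>" using powr_mono'[of \<alpha> 1 \<epsilon>] \<epsilon> \<alpha> by simp
        finally have 2: "\<bar>z \<bullet> e - y \<bullet> e\<bar> \<le> \<epsilon> powr \<alpha>" .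
        have "height f e y = 0" by (rule frontier_height_zero[OF \<Omega> eU(1,2) f eU(5) y(1,3)])
        hence "height f e z = (z \<bullet> e - y \<bullet> e) - (f (?P z) - f (?P y))" by (simp add: height_def)
        thus "\<bar>height f e z\<bar> \<le> ?\<delta>" using 1 2 unfolding distrib_right by linarith
      qed
      moreover have "{y \<in> ball 0 (R + 2). \<bar>height f e y\<bar> \<le> ?\<delta>} \<in> sets lborel"
      proof -
        have [measurable]: "height f e \<in> borel_measurable borel"
          by (rule borel_measurable_continuous_onI[OF height_continuous[OF eU(1) f]])
        show ?thesis by measurable
      qed
      ultimately have "emeasure lborel (?N U \<epsilon>) \<le> emeasure lborel {y \<in> ball 0 (R + 2). \<bar>height f e y\<bar> \<le> ?\<delta>}"
        by (rule emeasure_mono)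
      also have "\<dots> \<le> ennreal (2 * ?\<delta>) * emeasure lborel (ball (0::'a) (R + 2 + 1))"
        by (rule emeasure_graph_layer[OF eU(1) f]) simp
      also have "\<dots> \<le> ennreal (2 * ?\<delta>) * ennreal ?V"
        unfolding emeasure_ball_fin by (intro mult_left_mono ennreal_leI) auto
      also have "\<dots> = ennreal (2 * ?L * ?V * \<epsilon> powr \<alpha>)"
        by (subst ennreal_mult[symmetric]) (auto simp: mult_ac add_nonneg_nonneg)
      finally show ?thesis .
    qed
    moreover have "2 * ?L * ?V > 0" by (intro mult_pos_pos add_pos_nonneg add_nonneg_pos) auto
    ultimately have "?Q U" by blast
    thus "x \<in> \<Union>?C" using eU(2,3) by blast
  qed
  then obtain D where D: "D \<subseteq> ?C" "finite D" "?K \<subseteq> \<Union>D" using compactE[OF K, of ?C] by blast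
  have "?Q (\<Union>D)" using D(2,1)
  proof (induction D rule: finite_induct)
    case empty
    show ?case by (intro exI[of _ 1]) auto
  next
    case (insert U D)
    then obtain C1 C2 where C: "C1 > 0" "C2 > 0"
      "\<And>\<epsilon>. 0 < \<epsilon> \<Longrightarrow> \<epsilon> \<le> 1 \<Longrightarrow> emeasure lborel (?N U \<epsilon>) \<le> ennreal (C1 * \<epsilon> powr \<alpha>)"
      "\<And>\<epsilon>. 0 < \<epsilon> \<Longrightarrow> \<epsilon> \<le> 1 \<Longrightarrow> emeasure lborel (?N (\<Union>D) \<epsilon>) \<le> ennreal (C2 * \<epsilon> powr \<alpha>)" by auto
    have "emeasure lborel (?N (\<Union>(insert U D)) \<epsilon>) \<le> ennreal ((C1 + C2) * \<epsilon> powr \<alpha>)" if \<epsilon>: "0 < \<epsilon>" "\<epsilon> \<le> 1" for \<epsilon>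
    proof -
      have "?N (\<Union>(insert U D)) \<epsilon> = ?N U \<epsilon> \<union> ?N (\<Union>D) \<epsilon>" by blast
      hence "emeasure lborel (?N (\<Union>(insert U D)) \<epsilon>) \<le> emeasure lborel (?N U \<epsilon>) + emeasure lborel (?N (\<Union>D) \<epsilon>)"
        using emeasure_subadditive[of "?N U \<epsilon>" lborel "?N (\<Union>D) \<epsilon>"] by (simp add: borel_open open_neighbourhood)
      also have "\<dots> \<le> ennreal (C1 * \<epsilon> powr \<alpha>) + ennreal (C2 * \<epsilon> powr \<alpha>)" by (intro add_mono C \<epsilon>)
      also have "\<dots> = ennreal ((C1 + C2) * \<epsilon> powr \<alpha>)"
        using C(1,2) by (subst ennreal_plus[symmetric]) (auto simp: distrib_right)
      finally show ?thesis .
    qed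
    thus ?case using C(1,2) by (intro exI[of _ "C1 + C2"]) auto
  qed
  moreover have "?K \<inter> \<Union>D = ?K" using D(3) by blast
  ultimately show ?thesis using that by auto
qed

text \<open>Continuity from above along the neighbourhoods of radius 1/(n+1), which have finite
  measure and whose intersection lies in the closed set.\<close>

lemma null_set_neighbourhood:
  fixes E :: "'a::euclidean_space set"
  assumes "closed E" "emeasure lborel E = 0" "m > 0"
  obtains \<epsilon> where "0 < \<epsilon>" "\<epsilon> \<le> 1" "emeasure lborel {x. \<exists>y\<in>E \<inter> cball 0 R. dist x y < \<epsilon>} \<le> ennreal m"
proof -
  let ?K = "E \<inter> cball 0 R"
  have K: "closed ?K" using assms(1) by auto
  define A where "A n = {x. \<exists>y\<in>?K. dist x y < inverse (real (Suc n))}" for n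
  have A_meas: "range A \<subseteq> sets lborel" unfolding A_def using open_neighbourhood by (auto intro!: borel_open)
  have "decseq A"
  proof (intro decseq_SucI subsetI)
    fix n x assume "x \<in> A (Suc n)"
    moreover have "inverse (real (Suc (Suc n))) \<le> inverse (real (Suc n))" by (intro le_imp_inverse_le) auto
    moreover obtain y where "y \<in> ?K" "dist x y < inverse (real (Suc (Suc n)))"
      using \<open>x \<in> A (Suc n)\<close> unfolding A_def by blast
    ultimately show "x \<in> A n" unfolding A_def by (blast intro: less_le_trans)
  qed
  moreover have "emeasure lborel (A n) \<noteq> \<infinity>" for n
  proof -
    have "A n \<subseteq> ball 0 (R + 2)"
    proof
      fix x assume "x \<in> A n"
      then obtain y where y: "norm y \<le> R" "dist x y < inverse (real (Suc n))" by (auto simp: A_def)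
      have "inverse (real (Suc n)) \<le> 1" by (simp add: inverse_le_1_iff)
      thus "x \<in> ball 0 (R + 2)" using y norm_triangle_ineq2[of x y] by (simp add: dist_norm)
    qed
    hence "emeasure lborel (A n) \<le> emeasure lborel (ball (0::'a) (R + 2))" by (intro emeasure_mono) auto
    thus ?thesis using emeasure_lborel_ball_finite[of "0::'a" "R + 2"] by (auto simp: top_unique)
  qed
  ultimately have "(\<lambda>n. emeasure lborel (A n)) \<longlonglongrightarrow> emeasure lborel (\<Inter>n. A n)"
    by (intro Lim_emeasure_decseq A_meas)
  moreover have "emeasure lborel (\<Inter>n. A n) = 0"
  proof -
    have "(\<Inter>n. A n) \<subseteq> E"
    proof
      fix x assume x: "x \<in> (\<Inter>n. A n)"
      have "x \<in> closure ?K"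
        unfolding closure_approachable
      proof (intro allI impI)
        fix e :: real assume "e > 0"
        then obtain n where "inverse (real (Suc n)) < e" using reals_Archimedean by blast
        moreover have "x \<in> A n" using x by blast
        then obtain y where "y \<in> ?K" "dist x y < inverse (real (Suc n))" unfolding A_def by blast
        ultimately show "\<exists>y\<in>?K. dist y x < e" by (metis dist_commute order.strict_trans)
      qed
      thus "x \<in> E" using K by simp
    qed
    hence "emeasure lborel (\<Inter>n. A n) \<le> emeasure lborel E" using assms(1) by (intro emeasure_mono) auto
    thus ?thesis using assms(2) by simp
  qed
  ultimately have "\<forall>\<^sub>F n in sequentially. emeasure lborel (A n) < ennreal m"
    using assms(3) by (intro order_tendstoD(2)) auto
  then obtain n where n: "emeasure lborel (A n) < ennreal m" by (meson eventually_happens sequentially_bot)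
  show ?thesis
    by (rule that[of "inverse (real (Suc n))"]) (use n in \<open>auto simp: A_def inverse_le_1_iff\<close>)
qed

text \<open>For a merely continuous graph the measure of the neighbourhood tends to 0 at no known
  rate. For s >= 0 the exponent of \<epsilon> in the criterion is 0, so no rate is asked for, and
  \<open>M \<le> 1\<close> lets \<open>C = 1\<close> serve.\<close>

lemma C0_frontier_sp_null:
  fixes \<Omega> :: "'a::euclidean_space set"
  assumes "1 < p" "C0_domain \<Omega>" "0 \<le> s"
  shows "sp_null s p (frontier \<Omega>)"
proof (rule sp_null_criterion[OF assms(1)])
  fix R
  show "\<exists>C>0. \<forall>m>0. \<exists>\<epsilon> M. 0 < \<epsilon> \<and> \<epsilon> \<le> 1 \<and> 0 < M \<and> M \<le> m \<and>
       emeasure lborel {x. \<exists>y\<in>frontier \<Omega> \<inter> cball 0 R. dist x y < \<epsilon>} \<le> ennreal M \<and>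
       M powr (1 - 1 / p) \<le> C * \<epsilon> powr (max (- s) 0)"
  proof (rule exI[of _ 1], intro conjI allI impI)
    fix m :: real assume m: "m > 0"
    define M where "M = min m 1"
    have M: "0 < M" "M \<le> m" "M \<le> 1" using m by (auto simp: M_def)
    obtain \<epsilon> where \<epsilon>: "0 < \<epsilon>" "\<epsilon> \<le> 1" "emeasure lborel {x. \<exists>y\<in>frontier \<Omega> \<inter> cball 0 R. dist x y < \<epsilon>} \<le> ennreal M"
      using null_set_neighbourhood[OF frontier_closed C0_domain_frontier_null[OF assms(2)] M(1)] by blast
    have "M powr (1 - 1 / p) \<le> 1 powr (1 - 1 / p)" using M assms(1) by (intro powr_mono2) auto
    hence "M powr (1 - 1 / p) \<le> 1 * \<epsilon> powr (max (- s) 0)" using \<epsilon> assms(3) by (simp add: max_def)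
    with M \<epsilon> show "\<exists>\<epsilon> M. 0 < \<epsilon> \<and> \<epsilon> \<le> 1 \<and> 0 < M \<and> M \<le> m \<and>
       emeasure lborel {x. \<exists>y\<in>frontier \<Omega> \<inter> cball 0 R. dist x y < \<epsilon>} \<le> ennreal M \<and>
       M powr (1 - 1 / p) \<le> 1 * \<epsilon> powr (max (- s) 0)" by blast
  qed simp
qed (use assms in auto)

text \<open>Includes the endpoint and \<alpha> = 1, so that it serves the Hoelder and the Lipschitz
  case alike. With q = \<open>conj_exp p\<close>, the choice M = C \<epsilon>^\<alpha> gives M^(1/q)
  = C^(1/q) \<epsilon>^(\<alpha>/q), to be compared with -s <= \<alpha>/q.\<close>

lemma holder_frontier_sp_null:
  fixes \<Omega> :: "'a::euclidean_space set"
  assumes p: "1 < p" and dom: "graph_domain (holder_on \<alpha>) \<Omega>" and \<alpha>: "0 < \<alpha>" "\<alpha> \<le> 1"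
    and s: "- \<alpha> / conj_exp p \<le> s"
  shows "sp_null s p (frontier \<Omega>)"
proof (cases "0 \<le> s")
  case True
  thus ?thesis using C0_frontier_sp_null[OF p holder_domain_C0[OF dom \<alpha>(1)]] by blast
next
  case False
  have q: "\<alpha> / conj_exp p = \<alpha> * (1 - 1 / p)" using p by (simp add: conj_exp_def field_simps)
  hence s': "- s \<le> \<alpha> * (1 - 1 / p)" using s by simp
  have "\<alpha> * (1 - 1 / p) \<le> 1 * (1 - 1 / p)" using \<alpha> p by (intro mult_right_mono) auto
  also have "\<dots> < 1" using p by simp
  finally have s1: "- 1 < s" using s' by simp
  show ?thesis
  proof (rule sp_null_criterion[OF p frontier_closed s1])
    fix R
    obtain C where C: "C > 0" "\<And>\<epsilon>. 0 < \<epsilon> \<Longrightarrow> \<epsilon> \<le> 1 \<Longrightarrow>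
      emeasure lborel {x. \<exists>y\<in>frontier \<Omega> \<inter> cball 0 R. dist x y < \<epsilon>} \<le> ennreal (C * \<epsilon> powr \<alpha>)"
      by (rule holder_domain_neighbourhood[OF dom \<alpha>, of R]) blast
    show "\<exists>C>0. \<forall>m>0. \<exists>\<epsilon> M. 0 < \<epsilon> \<and> \<epsilon> \<le> 1 \<and> 0 < M \<and> M \<le> m \<and>
       emeasure lborel {x. \<exists>y\<in>frontier \<Omega> \<inter> cball 0 R. dist x y < \<epsilon>} \<le> ennreal M \<and>
       M powr (1 - 1 / p) \<le> C * \<epsilon> powr (max (- s) 0)"
    proof (rule exI[of _ "C powr (1 - 1 / p)"], intro conjI allI impI)
      fix m :: real assume m: "m > 0"
      \<comment> \<open>The largest value up to 1 for which C \<epsilon>^\<alpha> is at most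
        \<open>m\<close>.\<close>
      define \<epsilon> where "\<epsilon> = min 1 ((m / C) powr (1 / \<alpha>))"
      have \<epsilon>: "0 < \<epsilon>" "\<epsilon> \<le> 1" using m C by (auto simp: \<epsilon>_def)
      have "\<epsilon> powr \<alpha> \<le> ((m / C) powr (1 / \<alpha>)) powr \<alpha>" using \<epsilon> \<alpha> by (intro powr_mono2) (auto simp: \<epsilon>_def)
      also have "\<dots> = m / C" using \<alpha> m C by (simp add: powr_powr)
      finally have Mm: "C * \<epsilon> powr \<alpha> \<le> m" using C by (simp add: field_simps)
      have "(C * \<epsilon> powr \<alpha>) powr (1 - 1 / p) = C powr (1 - 1 / p) * \<epsilon> powr (\<alpha> * (1 - 1 / p))"
        by (simp only: powr_mult powr_powr)
      also have "\<dots> \<le> C powr (1 - 1 / p) * \<epsilon> powr (max (- s) 0)"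
        using \<epsilon> s' False by (intro mult_left_mono powr_mono') auto
      finally show "\<exists>\<epsilon> M. 0 < \<epsilon> \<and> \<epsilon> \<le> 1 \<and> 0 < M \<and> M \<le> m \<and>
       emeasure lborel {x. \<exists>y\<in>frontier \<Omega> \<inter> cball 0 R. dist x y < \<epsilon>} \<le> ennreal M \<and>
       M powr (1 - 1 / p) \<le> C powr (1 - 1 / p) * \<epsilon> powr (max (- s) 0)"
        using \<epsilon> C(1) C(2)[OF \<epsilon>] Mm by (intro exI[of _ \<epsilon>] exI[of _ "C * \<epsilon> powr \<alpha>"]) auto
    qed (use C in simp)
  qed
qed

section \<open>The heat kernel and the first exit map\<close>

text \<open>The kernel (4 pi t)^(-n/2) exp (-|x|^2 / (4 t)), written as a rescaled
  \<open>gauss_density\<close> to match \<open>gauss_mean\<close>, and set to 0 for t <= 0 so that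
  time may range over the whole line.\<close>

definition heat_kernel :: "real \<Rightarrow> 'a::euclidean_space \<Rightarrow> real" where
  "heat_kernel t x = indicator {0<..} t * ((2 * t) powr (- real DIM('a) / 2) * gauss_density (x /\<^sub>R sqrt (2 * t)))"

lemma heat_kernel_borel [measurable]:
  "(\<lambda>(t, x). heat_kernel t x) \<in> borel_measurable (borel \<Otimes>\<^sub>M borel)"
  unfolding heat_kernel_def by measurable

lemma heat_kernel_borel' [measurable (raw)]:
  "f \<in> borel_measurable M \<Longrightarrow> g \<in> borel_measurable M \<Longrightarrow> (\<lambda>x. heat_kernel (f x) (g x)) \<in> borel_measurable M"
  using measurable_compose[OF measurable_Pair[of f M borel g borel] heat_kernel_borel] by simp

lemma heat_kernel_nonneg: "0 \<le> heat_kernel t x"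
  by (simp add: heat_kernel_def less_imp_le[OF gauss_density_pos])

lemma heat_kernel_eq:
  assumes "t > 0"
  shows "heat_kernel t (x::'a::euclidean_space) = (4 * pi * t) powr (- real DIM('a) / 2) * exp (- (norm x)\<^sup>2 / (4 * t))"
proof -
  have "(norm (x /\<^sub>R sqrt (2 * t)))\<^sup>2 / 2 = (norm x)\<^sup>2 / (4 * t)"
    using assms by (simp add: power_divide divide_inverse[symmetric] power_mult_distrib inverse_eq_divide)
  moreover have "(4 * pi * t) powr (- real DIM('a) / 2) = (2 * t) powr (- real DIM('a) / 2) * (2 * pi) powr (- real DIM('a) / 2)"
    unfolding powr_mult[symmetric] by (simp add: mult_ac)
  ultimately show ?thesis
    using assms by (simp add: heat_kernel_def gauss_density_eq)
qed

lemma heat_kernel_scale: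
  assumes "t > 0"
  shows "(sqrt (2 * t)) ^ DIM('a) * heat_kernel t (sqrt (2 * t) *\<^sub>R (z::'a::euclidean_space)) = gauss_density z"
proof -
  have "(sqrt (2 * t)) ^ DIM('a) = (2 * t) powr (real DIM('a) / 2)"
    using assms by (simp add: powr_half_sqrt[symmetric] powr_realpow[symmetric] powr_powr)
  moreover have "(2 * t) powr (real DIM('a) / 2) * (2 * t) powr (- real DIM('a) / 2) = 1"
    using assms by (simp add: powr_add[symmetric])
  ultimately show ?thesis using assms by (simp add: heat_kernel_def mult.assoc[symmetric])
qed

lemma nn_integral_heat_kernel:
  assumes "t > 0"
  shows "(\<integral>\<^sup>+x. ennreal (heat_kernel t (x - x0)) \<partial>lborel) = 1"
proof -
  have "(\<integral>\<^sup>+x. ennreal (heat_kernel t (x - x0)) \<partial>lborel) =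
     ennreal (\<bar>sqrt (2 * t)\<bar> ^ DIM('a)) * (\<integral>\<^sup>+z. ennreal (heat_kernel t (x0 + sqrt (2 * t) *\<^sub>R (z::'a) - x0)) \<partial>lborel)"
    using assms by (subst nn_integral_affine[of _ "sqrt (2 * t)" x0]) auto
  also have "\<dots> = (\<integral>\<^sup>+z. ennreal ((sqrt (2 * t)) ^ DIM('a) * heat_kernel t (sqrt (2 * t) *\<^sub>R (z::'a))) \<partial>lborel)"
    using assms by (subst nn_integral_cmult[symmetric]) (auto simp: ennreal_mult heat_kernel_nonneg)
  also have "\<dots> = 1" by (simp only: heat_kernel_scale[OF assms] nn_integral_gauss_density)
  finally show ?thesis .
qed

lemma heat_kernel_reflect: "heat_kernel t (x - y) = heat_kernel t (y - x)"
proof (cases "t > 0")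
  case True
  thus ?thesis by (simp only: heat_kernel_eq norm_minus_commute)
qed (simp add: heat_kernel_def)

lemma gauss_mean_heat_kernel:
  fixes \<phi> :: "'a::euclidean_space \<Rightarrow> complex"
  assumes t: "t > 0" and [measurable]: "\<phi> \<in> borel_measurable borel"
  shows "gauss_mean (sqrt (2 * t)) \<phi> x0 = (\<integral>x. \<phi> x * complex_of_real (heat_kernel t (x - x0)) \<partial>lborel)"
proof -
  have "(\<integral>x. \<phi> x * complex_of_real (heat_kernel t (x - x0)) \<partial>lborel) =
    \<bar>sqrt (2 * t)\<bar> ^ DIM('a) *\<^sub>R (\<integral>z. \<phi> (x0 + sqrt (2 * t) *\<^sub>R z) * complex_of_real (heat_kernel t (x0 + sqrt (2 * t) *\<^sub>R z - x0)) \<partial>lborel)"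
    using t by (intro lborel_integral_affine) auto
  also have "\<dots> = (\<integral>z. \<bar>sqrt (2 * t)\<bar> ^ DIM('a) *\<^sub>R (\<phi> (x0 + sqrt (2 * t) *\<^sub>R z) * complex_of_real (heat_kernel t (sqrt (2 * t) *\<^sub>R z))) \<partial>lborel)"
    by simp
  also have "\<dots> = (\<integral>z. \<phi> (x0 + sqrt (2 * t) *\<^sub>R z) * complex_of_real (gauss_density z) \<partial>lborel)"
  proof (intro Bochner_Integration.integral_cong refl)
    fix z :: 'a
    show "\<bar>sqrt (2 * t)\<bar> ^ DIM('a) *\<^sub>R (\<phi> (x0 + sqrt (2 * t) *\<^sub>R z) * complex_of_real (heat_kernel t (sqrt (2 * t) *\<^sub>R z))) =
      \<phi> (x0 + sqrt (2 * t) *\<^sub>R z) * complex_of_real (gauss_density z)"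
      unfolding heat_kernel_scale[OF t, symmetric] using t by (simp add: scaleR_conv_of_real mult_ac)
  qed
  finally show ?thesis by (simp add: gauss_mean_def)
qed

text \<open>If \<open>F\<close> is invariant along \<open>e\<close>, then the integral of \<open>F y * G (y \<bullet> e)\<close> is a
  translation invariant functional of \<open>G\<close>, hence proportional to the integral of \<open>G\<close>.\<close>

lemma nn_integral_fibre_product:
  fixes F :: "'a::euclidean_space \<Rightarrow> ennreal" and G1 G2 :: "real \<Rightarrow> ennreal"
  assumes [measurable]: "F \<in> borel_measurable borel" "G1 \<in> borel_measurable borel" "G2 \<in> borel_measurable borel"
    and e: "norm e = 1" and F: "\<And>y t. F (y + t *\<^sub>R e) = F y"
  shows "(\<integral>\<^sup>+y. F y * G1 (y \<bullet> e) \<partial>lborel) * (\<integral>\<^sup>+t. G2 t \<partial>lborel) =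
    (\<integral>\<^sup>+t. G1 t \<partial>lborel) * (\<integral>\<^sup>+y. F y * G2 (y \<bullet> e) \<partial>lborel)"
proof -
  have ee: "e \<bullet> e = 1" using e by (simp add: dot_square_norm)
  have shift: "(\<integral>\<^sup>+t. G2 t \<partial>lborel) = (\<integral>\<^sup>+t. G2 (c + t) \<partial>lborel)" for c
    by (subst nn_integral_real_affine[where c=1 and t=c]) auto
  have refl: "(\<integral>\<^sup>+t. G1 t \<partial>lborel) = (\<integral>\<^sup>+t. G1 (c - t) \<partial>lborel)" for c
    by (subst nn_integral_real_affine[where c="-1" and t=c]) auto
  have "(\<integral>\<^sup>+y. F y * G1 (y \<bullet> e) \<partial>lborel) * (\<integral>\<^sup>+t. G2 t \<partial>lborel) =
     (\<integral>\<^sup>+y. F y * G1 (y \<bullet> e) * (\<integral>\<^sup>+t. G2 t \<partial>lborel) \<partial>lborel)"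
    by (simp add: nn_integral_multc)
  also have "\<dots> = (\<integral>\<^sup>+y. F y * G1 (y \<bullet> e) * (\<integral>\<^sup>+t. G2 (y \<bullet> e + t) \<partial>lborel) \<partial>lborel)"
    by (simp only: shift[symmetric])
  also have "\<dots> = (\<integral>\<^sup>+y. (\<integral>\<^sup>+t. F y * G1 (y \<bullet> e) * G2 (y \<bullet> e + t) \<partial>lborel) \<partial>lborel)"
    by (simp add: nn_integral_cmult)
  also have "\<dots> = (\<integral>\<^sup>+t. (\<integral>\<^sup>+y. F y * G1 (y \<bullet> e) * G2 (y \<bullet> e + t) \<partial>lborel) \<partial>lborel)"
    by (rule lborel_pair.Fubini') measurable
  also have "\<dots> = (\<integral>\<^sup>+t. (\<integral>\<^sup>+y. F y * G1 (y \<bullet> e - t) * G2 (y \<bullet> e) \<partial>lborel) \<partial>lborel)"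
  proof (rule nn_integral_cong)
    fix t :: real
    \<comment> \<open>Translating by \<open>- t *\<^sub>R e\<close> fixes \<open>F\<close> and
      lowers y . e by t, which moves the shift from \<open>G2\<close> to \<open>G1\<close>.
      Integrating over t afterwards frees \<open>G1\<close> from y.\<close>
    have "(\<integral>\<^sup>+y. F y * G1 (y \<bullet> e) * G2 (y \<bullet> e + t) \<partial>lborel) =
      (\<integral>\<^sup>+y. F (- t *\<^sub>R e + 1 *\<^sub>R y) * G1 ((- t *\<^sub>R e + 1 *\<^sub>R y) \<bullet> e) * G2 ((- t *\<^sub>R e + 1 *\<^sub>R y) \<bullet> e + t) \<partial>lborel)"
      by (subst nn_integral_affine[of _ 1 "- t *\<^sub>R e"]) auto
    also have "\<dots> = (\<integral>\<^sup>+y. F y * G1 (y \<bullet> e - t) * G2 (y \<bullet> e) \<partial>lborel)"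
      using F[of _ "- t"] by (simp add: inner_diff_left ee)
    finally show "(\<integral>\<^sup>+y. F y * G1 (y \<bullet> e) * G2 (y \<bullet> e + t) \<partial>lborel) = (\<integral>\<^sup>+y. F y * G1 (y \<bullet> e - t) * G2 (y \<bullet> e) \<partial>lborel)" .
  qed
  also have "\<dots> = (\<integral>\<^sup>+y. (\<integral>\<^sup>+t. F y * G1 (y \<bullet> e - t) * G2 (y \<bullet> e) \<partial>lborel) \<partial>lborel)"
    by (rule lborel_pair.Fubini') measurable
  also have "\<dots> = (\<integral>\<^sup>+y. (\<integral>\<^sup>+t. G1 (y \<bullet> e - t) \<partial>lborel) * (F y * G2 (y \<bullet> e)) \<partial>lborel)"
    by (subst nn_integral_multc[symmetric]) (auto simp: mult_ac)
  also have "\<dots> = (\<integral>\<^sup>+t. G1 t \<partial>lborel) * (\<integral>\<^sup>+y. F y * G2 (y \<bullet> e) \<partial>lborel)"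
    by (simp only: refl[symmetric]) (simp add: nn_integral_cmult)
  finally show ?thesis .
qed

text \<open>\<open>T\<close> moves points along \<open>e\<close> only, so x - T y and x - y have the
  same component orthogonal to \<open>e\<close>. Dropping the other component in the exponent bounds
  the kernel by (4 pi t)^(-1/2) times a heat kernel of dimension n - 1, invariant along
  \<open>e\<close>. The ball lies in a slab of width 2 r, over which the latter integrates to 2
  r.\<close>

lemma heat_kernel_slab:
  fixes T :: "'a::euclidean_space \<Rightarrow> 'a"
  assumes t: "t > 0" and r: "r > 0" and e: "norm e = 1"
    and T[measurable]: "T \<in> borel_measurable borel"
    and along: "\<And>y. \<exists>k. T y = y + k *\<^sub>R e"
  shows "(\<integral>\<^sup>+y. indicator (ball a r) y * ennreal (heat_kernel t (x - T y)) \<partial>lborel) \<le> ennreal (2 * r * t powr (- 1 / 2))"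
proof -
  have ee: "e \<bullet> e = 1" using e by (simp add: dot_square_norm)
  let ?P = "\<lambda>y. y - (y \<bullet> e) *\<^sub>R e"
  have pyth: "(norm y)\<^sup>2 = (norm (?P y))\<^sup>2 + (y \<bullet> e)\<^sup>2" for y
    unfolding power2_norm_eq_inner using ee
    by (simp add: inner_diff_left inner_diff_right inner_commute power2_eq_square algebra_simps)
  let ?c = "(4 * pi * t) powr (- real DIM('a) / 2)"
  let ?s = "sqrt (4 * pi * t)"
  \<comment> \<open>\<open>?F\<close> is the heat kernel of dimension n - 1 in the orthogonal
    component and \<open>?G2\<close> the one on the line, of variance 2 t. Their product is the full
    kernel, whose integral 1 calibrates \<open>nn_integral_fibre_product\<close>.\<close>
  let ?F = "\<lambda>y. ?c * ?s * exp (- (norm (?P (x - y)))\<^sup>2 / (4 * t))"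
  let ?G1 = "indicator {a \<bullet> e - r .. a \<bullet> e + r} :: real \<Rightarrow> ennreal"
  let ?G2 = "\<lambda>\<tau>. normal_density (x \<bullet> e) (sqrt (2 * t)) \<tau>"
  have s0: "?s > 0" using t by simp
  have "(\<integral>\<^sup>+y. ennreal (?F y) * ?G1 (y \<bullet> e) \<partial>lborel) * (\<integral>\<^sup>+\<tau>. ennreal (?G2 \<tau>) \<partial>lborel) =
    (\<integral>\<^sup>+\<tau>. ?G1 \<tau> \<partial>lborel) * (\<integral>\<^sup>+y. ennreal (?F y) * ennreal (?G2 (y \<bullet> e)) \<partial>lborel)"
  proof (rule nn_integral_fibre_product[OF _ _ _ e])
    fix y k
    have "?P (x - (y + k *\<^sub>R e)) = ?P (x - y)" using ee by (simp add: inner_diff_left inner_add_left algebra_simps)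
    thus "ennreal (?F (y + k *\<^sub>R e)) = ennreal (?F y)" by (simp only:)
  qed measurable
  moreover have "(\<integral>\<^sup>+\<tau>. ennreal (?G2 \<tau>) \<partial>lborel) = 1"
    using prob_space.emeasure_space_1[OF prob_space_normal_density[of "sqrt (2 * t)" "x \<bullet> e"]] t
    by (simp add: emeasure_density)
  moreover have "(\<integral>\<^sup>+\<tau>. ?G1 \<tau> \<partial>lborel) = ennreal (2 * r)" using r by simp
  moreover have "(\<integral>\<^sup>+y. ennreal (?F y) * ennreal (?G2 (y \<bullet> e)) \<partial>lborel) = 1"
  proof -
    have "ennreal (?F y) * ennreal (?G2 (y \<bullet> e)) = ennreal (heat_kernel t (y - x))" for y
    proof -
      have "?G2 (y \<bullet> e) = 1 / ?s * exp (- ((x - y) \<bullet> e)\<^sup>2 / (4 * t))"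
        using t by (simp add: normal_density_def inner_diff_left power2_commute mult_ac)
      hence "?F y * ?G2 (y \<bullet> e) = ?c * (exp (- (norm (?P (x - y)))\<^sup>2 / (4 * t)) * exp (- ((x - y) \<bullet> e)\<^sup>2 / (4 * t)))"
        using s0 by simp
      also have "exp (- (norm (?P (x - y)))\<^sup>2 / (4 * t)) * exp (- ((x - y) \<bullet> e)\<^sup>2 / (4 * t)) = exp (- (norm (x - y))\<^sup>2 / (4 * t))"
        unfolding pyth[of "x - y"] by (simp add: exp_add[symmetric] add_divide_distrib diff_divide_distrib)
      also have "?c * \<dots> = heat_kernel t (x - y)" by (simp add: heat_kernel_eq[OF t])
      finally show ?thesis
        unfolding heat_kernel_reflect[of t y x] using s0 by (subst ennreal_mult[symmetric]) auto
    qed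
    thus ?thesis by (simp add: nn_integral_heat_kernel[OF t])
  qed
  ultimately have FG: "(\<integral>\<^sup>+y. ennreal (?F y) * ?G1 (y \<bullet> e) \<partial>lborel) = ennreal (2 * r)" by simp
  have "(\<integral>\<^sup>+y. indicator (ball a r) y * ennreal (heat_kernel t (x - T y)) \<partial>lborel) \<le>
    (\<integral>\<^sup>+y. ennreal (1 / ?s) * (ennreal (?F y) * ?G1 (y \<bullet> e)) \<partial>lborel)"
  proof (intro nn_integral_mono)
    fix y
    show "indicator (ball a r) y * ennreal (heat_kernel t (x - T y)) \<le> ennreal (1 / ?s) * (ennreal (?F y) * ?G1 (y \<bullet> e))"
    proof (cases "y \<in> ball a r")
      case True
      have "\<bar>(y - a) \<bullet> e\<bar> \<le> norm (y - a) * norm e" by (rule Cauchy_Schwarz_ineq2)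
      hence "\<bar>y \<bullet> e - a \<bullet> e\<bar> \<le> r" using True e by (simp add: dist_norm norm_minus_commute inner_diff_left)
      hence G1: "?G1 (y \<bullet> e) = 1" by (auto simp: indicator_def)
      obtain k where k: "T y = y + k *\<^sub>R e" using along by blast
      have E: "?P (x - T y) = ?P (x - y)" unfolding k using ee by (simp add: inner_diff_left inner_add_left algebra_simps)
      have "(norm (?P (x - y)))\<^sup>2 \<le> (norm (x - T y))\<^sup>2" unfolding pyth[of "x - T y"] E by simp
      hence "- (norm (x - T y))\<^sup>2 / (4 * t) \<le> - (norm (?P (x - y)))\<^sup>2 / (4 * t)"
        using t by (intro divide_right_mono) auto
      hence "heat_kernel t (x - T y) \<le> ?c * exp (- (norm (?P (x - y)))\<^sup>2 / (4 * t))"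
        unfolding heat_kernel_eq[OF t] by (intro mult_left_mono) auto
      also have "\<dots> = 1 / ?s * ?F y" using s0 by simp
      finally have "ennreal (heat_kernel t (x - T y)) \<le> ennreal (1 / ?s * ?F y)" by (rule ennreal_leI)
      also have "\<dots> = ennreal (1 / ?s) * ennreal (?F y)" using s0 by (intro ennreal_mult) auto
      finally show ?thesis using True by (simp add: G1)
    qed simp
  qed
  also have "\<dots> = ennreal (1 / ?s) * ennreal (2 * r)"
    by (subst nn_integral_cmult) (measurable, simp only: FG)
  also have "\<dots> = ennreal (1 / ?s * (2 * r))" using s0 r by (intro ennreal_mult[symmetric]) auto
  also have "\<dots> \<le> ennreal (2 * r * t powr (- 1 / 2))"
  proof (rule ennreal_leI)
    have "1 * t \<le> (4 * pi) * t" using pi_gt3 t by (intro mult_right_mono) auto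
    hence "sqrt t \<le> ?s" by (intro real_sqrt_le_mono) simp
    hence "1 / ?s \<le> 1 / sqrt t" using t by (intro divide_left_mono) auto
    also have "\<dots> = t powr (- 1 / 2)"     proof -
      have "t powr (- (1 / 2)) = inverse (sqrt t)"
        using powr_half_sqrt[OF less_imp_le[OF t]] by (subst powr_minus) (rule arg_cong)
      moreover have "(- 1 / 2 :: real) = - (1 / 2)" by simp
      ultimately show ?thesis by (simp only: inverse_eq_divide)
    qed
    finally have "1 / ?s * (2 * r) \<le> t powr (- 1 / 2) * (2 * r)" using r by (intro mult_right_mono) auto
    thus "1 / ?s * (2 * r) \<le> 2 * r * t powr (- 1 / 2)" by (simp add: mult_ac)
  qed
  finally show ?thesis .
qed

text \<open>The exit time need not be continuous, but it is lower semicontinuous: it exceeds c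
  exactly at those points of the ball whose segment of length c in direction \<open>e\<close> avoids
  the complement of \<Omega>, and the excluded points form the sum of a compact and a closed set.
  This gives measurability. Off the ball the map is the identity.\<close>

lemma first_exit_exists:
  fixes \<Omega> :: "'a::euclidean_space set"
  assumes \<Omega>: "open \<Omega>" and e: "norm e = 1" and B: "ball a r \<subseteq> \<Omega>"
    and exit: "\<And>y. y \<in> ball a r \<Longrightarrow> y + L *\<^sub>R e \<notin> \<Omega>" and L: "L \<ge> 0"
  obtains T :: "'a \<Rightarrow> 'a" where "T \<in> borel_measurable borel" "\<And>y. \<exists>k. T y = y + k *\<^sub>R e"
    "\<And>y. norm (T y - y) \<le> L" "\<And>y. y \<in> ball a r \<Longrightarrow> T y \<in> frontier \<Omega>"
proof -
  define \<tau> where "\<tau> y = Inf {t. 0 \<le> t \<and> y + t *\<^sub>R e \<notin> \<Omega>}" for y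
  have mem: "\<tau> y \<in> {t. 0 \<le> t \<and> y + t *\<^sub>R e \<notin> \<Omega>}" if y: "y \<in> ball a r" for y
    unfolding \<tau>_def
  proof (rule closed_contains_Inf)
    show "{t. 0 \<le> t \<and> y + t *\<^sub>R e \<notin> \<Omega>} \<noteq> {}" using exit[OF y] L by blast
    show "bdd_below {t. 0 \<le> t \<and> y + t *\<^sub>R e \<notin> \<Omega>}" by (rule bdd_belowI[of _ 0]) auto
    have "closed ((\<lambda>t. y + t *\<^sub>R e) -` (- \<Omega>))"
      using \<Omega> by (intro continuous_closed_vimage continuous_intros) auto
    hence "closed ({0..} \<inter> (\<lambda>t. y + t *\<^sub>R e) -` (- \<Omega>))" by (intro closed_Int) auto
    moreover have "{0..} \<inter> (\<lambda>t. y + t *\<^sub>R e) -` (- \<Omega>) = {t. 0 \<le> t \<and> y + t *\<^sub>R e \<notin> \<Omega>}" by auto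
    ultimately show "closed {t. 0 \<le> t \<and> y + t *\<^sub>R e \<notin> \<Omega>}" by simp
  qed
  have lower: "\<tau> y \<le> t" if "0 \<le> t" "y + t *\<^sub>R e \<notin> \<Omega>" for y t
    unfolding \<tau>_def by (rule cInf_lower) (use that in \<open>auto intro: bdd_belowI[of _ 0]\<close>)
  have pos: "\<tau> y > 0" if y: "y \<in> ball a r" for y
    using mem[OF y] B y by (cases "\<tau> y = 0") auto
  define g where "g y = indicator (ball a r) y * \<tau> y" for y
  have "g \<in> borel_measurable borel"
    unfolding borel_measurable_iff_greater
  proof
    fix c :: real
    show "{w \<in> space borel. c < g w} \<in> sets borel"
    proof (cases "c < 0")
      case True
      hence "{w. c < g w} = UNIV" using pos by (force simp: g_def indicator_def)
      thus ?thesis by simp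
    next
      case False
      let ?S = "(\<lambda>t. - t *\<^sub>R e) ` {0..c}"
      have "closed (\<Union>x\<in>?S. \<Union>y\<in>- \<Omega>. {x + y})"
        using \<Omega> by (intro compact_closed_sums compact_continuous_image continuous_intros) auto
      moreover have "{w. c < g w} = ball a r \<inter> - (\<Union>x\<in>?S. \<Union>y\<in>- \<Omega>. {x + y})"
      proof (intro set_eqI iffI)
        fix w assume w: "w \<in> {w. c < g w}"
        hence wB: "w \<in> ball a r" using False by (cases "w \<in> ball a r") (auto simp: g_def)
        hence c: "c < \<tau> w" using w by (simp add: g_def)
        have "w \<notin> (\<Union>x\<in>?S. \<Union>y\<in>- \<Omega>. {x + y})"
        proof
          assume "w \<in> (\<Union>x\<in>?S. \<Union>y\<in>- \<Omega>. {x + y})"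
          then obtain t y where t: "0 \<le> t" "t \<le> c" "w = - t *\<^sub>R e + y" "y \<notin> \<Omega>" by auto
          hence "\<tau> w \<le> t" by (intro lower) auto
          thus False using t c by simp
        qed
        with wB show "w \<in> ball a r \<inter> - (\<Union>x\<in>?S. \<Union>y\<in>- \<Omega>. {x + y})" by simp
      next
        fix w assume w: "w \<in> ball a r \<inter> - (\<Union>x\<in>?S. \<Union>y\<in>- \<Omega>. {x + y})"
        have "c < \<tau> w"
        proof (rule ccontr)
          assume "\<not> c < \<tau> w"
          moreover have "0 \<le> \<tau> w" "w + \<tau> w *\<^sub>R e \<notin> \<Omega>" using mem[of w] w by auto
          moreover have "w = - \<tau> w *\<^sub>R e + (w + \<tau> w *\<^sub>R e)" by simp
          ultimately have "w \<in> (\<Union>x\<in>?S. \<Union>y\<in>- \<Omega>. {x + y})"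
            by (intro UN_I[of "- \<tau> w *\<^sub>R e"] UN_I[of "w + \<tau> w *\<^sub>R e"] imageI) auto
          thus False using w by simp
        qed
        thus "w \<in> {w. c < g w}" using w by (simp add: g_def)
      qed
      ultimately have "{w. c < g w} \<in> sets borel"
        by (simp only: sets.Int borel_open open_ball borel_comp borel_closed)
      thus ?thesis by simp
    qed
  qed
  note [measurable] = this
  show ?thesis
  proof (rule that[of "\<lambda>y. y + g y *\<^sub>R e"])
    show "norm (y + g y *\<^sub>R e - y) \<le> L" for y
    proof (cases "y \<in> ball a r")
      case True
      have "norm (y + g y *\<^sub>R e - y) = \<tau> y" using pos[OF True] e True by (simp add: g_def)
      thus ?thesis using lower[OF L exit[OF True]] by simp
    qed (use L in \<open>simp add: g_def\<close>)
    fix y assume y: "y \<in> ball a r"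
    hence g: "g y = \<tau> y" by (simp add: g_def)
    have "y + \<tau> y *\<^sub>R e \<in> closure \<Omega>"
      unfolding closure_approachable
    proof (intro allI impI)
      fix d :: real assume d: "d > 0"
      \<comment> \<open>A slightly earlier time, still nonnegative, at which the segment is in
        \<Omega> because the exit time is an infimum.\<close>
      let ?t = "max 0 (\<tau> y - d / 2)"
      have t: "0 \<le> ?t" "?t < \<tau> y" "\<bar>?t - \<tau> y\<bar> < d" using pos[OF y] d by auto
      have "y + ?t *\<^sub>R e \<in> \<Omega>"
      proof (rule ccontr)
        assume "y + ?t *\<^sub>R e \<notin> \<Omega>"
        hence "\<tau> y \<le> ?t" using lower t(1) by blast
        thus False using t(2) by linarith
      qed
      moreover have "dist (y + ?t *\<^sub>R e) (y + \<tau> y *\<^sub>R e) < d"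
        using t(3) e by (simp add: dist_norm scaleR_left_diff_distrib[symmetric])
      ultimately show "\<exists>z\<in>\<Omega>. dist z (y + \<tau> y *\<^sub>R e) < d" by blast
    qed
    thus "y + g y *\<^sub>R e \<in> frontier \<Omega>" using mem[OF y] \<Omega> by (simp add: g frontier_def interior_open)
  qed auto
qed

text \<open>At index 0 the seminorm is the supremum norm. This suffices for temperedness later,
  where the functional is integration against a finite measure.\<close>

lemma schwartz_seminorm_zero:
  assumes "\<phi> \<in> schwartz"
  shows "norm (\<phi> x) \<le> schwartz_seminorm 0 \<phi>"
proof -
  have set: "{(k, vs). k \<le> 0 \<and> set vs \<subseteq> Basis \<and> length vs \<le> 0} = {(0::nat, [] :: 'a list)}" by auto
  obtain C where C: "\<And>x. norm (\<phi> x) \<le> C" using schwartz_bounded[OF assms] by metis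
  have "norm (\<phi> x) \<le> (SUP x. norm (\<phi> x))"
    by (rule cSUP_upper) (auto intro!: bdd_aboveI[of _ C] C)
  thus ?thesis unfolding schwartz_seminorm_def set by simp
qed

text \<open>Jensen's inequality for \<open>\<integral> \<rho> X\<close>, with the optimal \<open>\<lambda>\<close> chosen afterwards.\<close>

lemma le_power_split:
  fixes X l p :: real
  assumes "0 \<le> X" "0 < l" "1 < p"
  shows "X \<le> l + l powr (1 - p) * X powr p"
proof (cases "X \<le> l")
  case False
  have "X = X powr (1 - p) * X powr p" using False assms by (simp add: powr_add[symmetric])
  also have "\<dots> \<le> l powr (1 - p) * X powr p"
    using False assms by (intro mult_right_mono powr_mono2') auto
  finally show ?thesis using assms by simp
next
  case True
  thus ?thesis using mult_nonneg_nonneg[OF powr_ge_zero powr_ge_zero, of l "1 - p" X p] by linarith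
qed

text \<open>\<open>c\<close> plays the mass of the weight and \<open>q\<close> the weighted p-th
  moment. The choice l = q^(1/p) balances the two terms; for q = 0 arbitrarily small l forces g =
  0.\<close>

lemma powr_le_of_split:
  fixes g c q p :: real
  assumes "\<And>l. l > 0 \<Longrightarrow> g \<le> l * c + l powr (1 - p) * q" and g: "0 \<le> g" and "0 \<le> c" "0 \<le> q" "1 < p"
  shows "g powr p \<le> (c + 1) powr p * q"
proof (cases "q = 0")
  case True
  have "g \<le> 0 + d" if d: "d > 0" for d
  proof -
    have "g \<le> d / (c + 1) * c" using assms(1)[of "d / (c + 1)"] assms(3) d True by simp
    also have "\<dots> \<le> d" using assms(3) d by (simp add: field_simps)
    finally show ?thesis by simp
  qed
  hence "g \<le> 0" by (rule field_le_epsilon)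
  thus ?thesis using g True by simp
next
  case False
  hence q: "q > 0" using assms(4) by simp
  let ?l = "q powr (1 / p)"
  have "?l powr (1 - p) * q = q powr (1 / p * (1 - p) + 1)"
    using q unfolding powr_add powr_powr by simp
  also have "1 / p * (1 - p) + 1 = 1 / p" using assms(5) by (simp add: field_simps)
  finally have "g \<le> ?l * (c + 1)" using assms(1)[of ?l] q by (simp add: distrib_left)
  hence "g powr p \<le> (?l * (c + 1)) powr p" using g assms(5) by (intro powr_mono2) auto
  also have "\<dots> = q * (c + 1) powr p" using q assms(5) by (simp add: powr_mult powr_powr)
  finally show ?thesis by (simp add: mult.commute)
qed

section \<open>The exit measure of an open set\<close>

lemma integrable_lborel_pairI:
  fixes f :: "'a::euclidean_space \<Rightarrow> 'b::euclidean_space \<Rightarrow> complex"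
  assumes [measurable]: "case_prod f \<in> borel_measurable (lborel \<Otimes>\<^sub>M lborel)"
    and "(\<integral>\<^sup>+x. (\<integral>\<^sup>+y. ennreal (norm (f x y)) \<partial>lborel) \<partial>lborel) < \<infinity>"
  shows "integrable (lborel \<Otimes>\<^sub>M lborel) (case_prod f)"
proof (rule integrableI_bounded)
  have "(\<integral>\<^sup>+z. ennreal (norm (case_prod f z)) \<partial>(lborel \<Otimes>\<^sub>M lborel)) =
     (\<integral>\<^sup>+x. (\<integral>\<^sup>+y. ennreal (norm (case_prod f (x, y))) \<partial>lborel) \<partial>lborel)"
    by (rule lborel.nn_integral_fst[symmetric]) measurable
  thus "(\<integral>\<^sup>+z. ennreal (norm (case_prod f z)) \<partial>(lborel \<Otimes>\<^sub>M lborel)) < \<infinity>" using assms(2) by simp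
qed measurable

text \<open>\<open>T\<close> is the exit map, \<open>ball c r\<close> carries the mass that it
  transports, and the potential will have order -2 a. The lower bound on \<open>a\<close> says that
  2 a exceeds 1/q, with q conjugate to \<open>p\<close>.\<close>

locale exit_measure =
  fixes T :: "'a::euclidean_space \<Rightarrow> 'a" and c e :: 'a and r p a :: real
  assumes r: "r > 0" and e: "norm e = 1" and T[measurable]: "T \<in> borel_measurable borel"
    and along: "\<And>y. \<exists>k. T y = y + k *\<^sub>R e" and p: "1 < p" and a: "(1 - 1 / p) / 2 < a"
begin

abbreviation ind :: "'a \<Rightarrow> real" where "ind \<equiv> indicator (ball c r)"
abbreviation W :: "real \<Rightarrow> real" where "W t \<equiv> pow_weight a t * exp (- t)"

text \<open>The heat extension at time t of the image measure \<mu>, that is, of Lebesgue measure on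
  \<open>ball c r\<close> transported by \<open>T\<close>.\<close>

definition H :: "real \<Rightarrow> 'a \<Rightarrow> real" where
  "H t x = (\<integral>y. ind y * heat_kernel t (x - T y) \<partial>lborel)"

text \<open>Gamma of \<open>a\<close> times the Bessel potential of \<mu> of order -2 a.\<close>

definition exit_density :: "'a \<Rightarrow> real" where
  "exit_density x = (\<integral>t. W t * H t x \<partial>lborel)"

abbreviation vol :: real where "vol \<equiv> measure lborel (ball c r)"

declare T [measurable]

lemma ball_borel [measurable]: "ball c r \<in> sets borel"
  by simp

lemma a_pos: "a > 0"
proof -
  have "0 < (1 - 1 / p) / 2" using p by simp
  thus ?thesis using a by linarith
qed

lemma nn_integral_ind: "(\<integral>\<^sup>+y. ennreal (ind y) \<partial>lborel) = ennreal vol"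
  by (simp add: ennreal_indicator emeasure_ball_fin)

lemma H_nonneg: "0 \<le> H t x"
  unfolding H_def by (intro Bochner_Integration.integral_nonneg) (simp add: heat_kernel_nonneg)

lemma nn_integral_exit_kernel_le:
  assumes "t > 0"
  shows "(\<integral>\<^sup>+y. ennreal (ind y * heat_kernel t (x - T y)) \<partial>lborel) \<le> ennreal (2 * r * t powr (- 1 / 2))"
  using heat_kernel_slab[OF assms r e T along, of c x]
  by (simp add: ennreal_mult heat_kernel_nonneg ennreal_indicator)

lemma exit_kernel_integrable: "integrable lborel (\<lambda>y. ind y * heat_kernel t (x - T y))"
proof (cases "t > 0")
  case True
  show ?thesis
  proof (rule integrableI_nonneg)
    show "(\<integral>\<^sup>+y. ennreal (ind y * heat_kernel t (x - T y)) \<partial>lborel) < \<infinity>"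
      using nn_integral_exit_kernel_le[OF True] by (rule order.strict_trans1) simp
  qed (auto simp: heat_kernel_nonneg)
qed (simp add: heat_kernel_def)

lemma ennreal_H: "ennreal (H t x) = (\<integral>\<^sup>+y. ennreal (ind y * heat_kernel t (x - T y)) \<partial>lborel)"
  unfolding H_def by (rule nn_integral_eq_integral[symmetric]) (auto simp: exit_kernel_integrable heat_kernel_nonneg)

lemma H_le: "t > 0 \<Longrightarrow> H t x \<le> 2 * r * t powr (- 1 / 2)"
  using nn_integral_exit_kernel_le[of t x] r unfolding ennreal_H[symmetric] by (subst (asm) ennreal_le_iff) auto

lemma H_borel [measurable (raw)]:
  "f \<in> borel_measurable M \<Longrightarrow> g \<in> borel_measurable M \<Longrightarrow> (\<lambda>x. H (f x) (g x)) \<in> borel_measurable M"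
proof -
  assume [measurable]: "f \<in> borel_measurable M" "g \<in> borel_measurable M"
  show ?thesis unfolding H_def by measurable
qed

lemma exit_density_borel [measurable]: "exit_density \<in> borel_measurable borel"
  unfolding exit_density_def[abs_def] by measurable

lemma nn_integral_H:
  assumes t: "t > 0"
  shows "(\<integral>\<^sup>+x. ennreal (H t x) \<partial>lborel) = ennreal vol"
proof -
  have "(\<integral>\<^sup>+x. ennreal (H t x) \<partial>lborel) = (\<integral>\<^sup>+x. (\<integral>\<^sup>+y. ennreal (ind y * heat_kernel t (x - T y)) \<partial>lborel) \<partial>lborel)"
    by (simp only: ennreal_H)
  also have "\<dots> = (\<integral>\<^sup>+y. (\<integral>\<^sup>+x. ennreal (ind y * heat_kernel t (x - T y)) \<partial>lborel) \<partial>lborel)"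
    by (rule lborel_pair.Fubini') measurable
  also have "\<dots> = (\<integral>\<^sup>+y. ennreal (ind y) \<partial>lborel)"
    by (simp add: ennreal_mult heat_kernel_nonneg nn_integral_cmult nn_integral_heat_kernel[OF t])
  finally show ?thesis by (simp add: nn_integral_ind)
qed

lemma exit_density_nonneg: "0 \<le> exit_density x"
  unfolding exit_density_def by (intro Bochner_Integration.integral_nonneg) (simp add: H_nonneg pow_weight_nonneg)

text \<open>Interpolation: H^p <= (2 r t^(-1/2))^(p-1) H, so the p-th power of t^k H with k = (1 -
  1/p)/2 is bounded by a multiple of \<open>H\<close> in which t no longer occurs. The leftover
  weight t^(d-1) exp (-t) with d = a - k > 0 has finite mass; hence convexity moves the power inside
  the time integral, and the constant mass of \<open>H\<close> bounds the result.\<close>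

lemma exit_density_Lp: "integrable lborel (\<lambda>x. exit_density x powr p)"
proof -
  define k where "k = (1 - 1 / p) / 2"
  define d where "d = a - k"
  have d: "d > 0" using a by (simp add: d_def k_def)
  have kp: "k * p = (p - 1) / 2" using p by (simp add: k_def field_simps)
  let ?\<rho> = "\<lambda>t. pow_weight d t * exp (- t)"
  let ?C = "(2 * r) powr (p - 1)"
  define Q where "Q x = (\<integral>\<^sup>+t. ennreal (?\<rho> t) * ennreal (H t x) \<partial>lborel)" for x
  have \<rho>0: "0 \<le> ?\<rho> t" for t by (simp add: pow_weight_nonneg)
  have \<rho>int: "(\<integral>\<^sup>+t. ennreal (?\<rho> t) \<partial>lborel) = ennreal (Gamma d)" by (rule nn_integral_pow_weight_exp[OF d])
  have G0: "Gamma d > 0" by (rule Gamma_real_pos[OF d])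
  let ?A = "(Gamma d + 1) powr p * ?C"
  have A0: "?A > 0" using G0 r by simp
  have split: "ennreal (W t * H t x) \<le> ennreal l * ennreal (?\<rho> t) + ennreal (l powr (1 - p) * ?C) * (ennreal (?\<rho> t) * ennreal (H t x))"
    if l: "l > 0" for l t x
  proof (cases "t > 0")
    case t: True
    let ?X = "t powr k * H t x"
    have "t powr (a - 1) = t powr (d - 1) * t powr k"
      unfolding powr_add[symmetric] by (simp add: d_def)
    hence "W t * H t x = ?\<rho> t * ?X" using t by (simp add: pow_weight_def)
    also have "\<dots> \<le> ?\<rho> t * (l + l powr (1 - p) * ?X powr p)"
      using t by (intro mult_left_mono \<rho>0 le_power_split l p mult_nonneg_nonneg H_nonneg) auto
    also have "\<dots> \<le> ?\<rho> t * (l + l powr (1 - p) * (?C * H t x))"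
    proof (intro mult_left_mono add_left_mono \<rho>0)
      show "?X powr p \<le> ?C * H t x"
      proof (cases "H t x = 0")
        case False
        hence H0: "H t x > 0" using H_nonneg[of t x] by simp
        have "?X powr p = t powr ((p - 1) / 2) * (H t x powr (p - 1) * H t x)"
          using H0 powr_add[of "H t x" "p - 1" 1] by (simp add: powr_mult powr_powr kp)
        also have "\<dots> \<le> t powr ((p - 1) / 2) * ((2 * r * t powr (- 1 / 2)) powr (p - 1) * H t x)"
          using H0 p by (intro mult_left_mono mult_right_mono powr_mono2 H_le[OF t]) auto
        also have "(2 * r * t powr (- 1 / 2)) powr (p - 1) = ?C * t powr (- 1 / 2 * (p - 1))"
          by (simp only: powr_mult powr_powr)
        also have "t powr ((p - 1) / 2) * (?C * t powr (- 1 / 2 * (p - 1)) * H t x) =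
            ?C * H t x * t powr ((p - 1) / 2 + - 1 / 2 * (p - 1))"
          by (simp only: powr_add mult_ac)
        also have "(p - 1) / 2 + - 1 / 2 * (p - 1) = 0" by simp
        finally show ?thesis using t by simp
      qed simp
    qed auto
    also have "\<dots> = l * ?\<rho> t + (l powr (1 - p) * ?C) * (?\<rho> t * H t x)" by (simp add: algebra_simps)
    finally have "ennreal (W t * H t x) \<le> ennreal (l * ?\<rho> t + (l powr (1 - p) * ?C) * (?\<rho> t * H t x))"
      by (rule ennreal_leI)
    also have "\<dots> = ennreal (l * ?\<rho> t) + ennreal ((l powr (1 - p) * ?C) * (?\<rho> t * H t x))"
      using l \<rho>0 H_nonneg by (intro ennreal_plus mult_nonneg_nonneg) (auto simp: pow_weight_nonneg)
    also have "\<dots> = ennreal l * ennreal (?\<rho> t) + ennreal (l powr (1 - p) * ?C) * (ennreal (?\<rho> t) * ennreal (H t x))"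
    proof -
      have "ennreal (u * R) + ennreal (v * (R * h)) = ennreal u * ennreal R + ennreal v * (ennreal R * ennreal h)"
        if "0 \<le> u" "0 \<le> v" "0 \<le> R" "0 \<le> h" for u v R h :: real
        using that by (simp add: ennreal_mult)
      thus ?thesis using l \<rho>0 H_nonneg by (simp add: pow_weight_nonneg)
    qed
    finally show ?thesis .
  qed (simp add: pow_weight_def)
  have point: "ennreal (exit_density x powr p) \<le> ennreal ?A * Q x" for x
  proof (cases "Q x = \<infinity>")
    case True
    \<comment> \<open>In \<open>ennreal\<close> the product of 0 and infinity is 0, so even this
      trivial case calls for a positive constant.\<close>
    moreover have "ennreal ?A \<noteq> 0" using A0 by (simp only: ennreal_eq_0_iff not_le simp_thms)
    ultimately show ?thesis by (simp only: ennreal_mult_top infinity_ennreal_def if_False top_greatest)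
  next
    case False
    then obtain q where q: "q \<ge> 0" "Q x = ennreal q" by (cases "Q x") auto
    have "exit_density x \<le> l * Gamma d + l powr (1 - p) * (?C * q)" if l: "l > 0" for l
    proof -
      have "ennreal (exit_density x) \<le> (\<integral>\<^sup>+t. ennreal (W t * H t x) \<partial>lborel)"
      proof (cases "integrable lborel (\<lambda>t. W t * H t x)")
        case True
        thus ?thesis unfolding exit_density_def
          by (subst nn_integral_eq_integral) (auto simp: H_nonneg pow_weight_nonneg)
      qed (simp add: exit_density_def not_integrable_integral_eq)
      also have "\<dots> \<le> (\<integral>\<^sup>+t. ennreal l * ennreal (?\<rho> t) + ennreal (l powr (1 - p) * ?C) * (ennreal (?\<rho> t) * ennreal (H t x)) \<partial>lborel)"
        by (intro nn_integral_mono split l)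
      also have "\<dots> = ennreal l * ennreal (Gamma d) + ennreal (l powr (1 - p) * ?C) * ennreal q"
        by (simp add: nn_integral_add nn_integral_cmult \<rho>int Q_def[symmetric] q(2))
      also have "\<dots> = ennreal (l * Gamma d + l powr (1 - p) * (?C * q))"
        using l G0 q(1) by (simp add: ennreal_mult[symmetric] ennreal_plus[symmetric] mult.assoc del: ennreal_plus)
      finally show ?thesis using l G0 q(1) by (subst (asm) ennreal_le_iff) auto
    qed
    hence "exit_density x powr p \<le> (Gamma d + 1) powr p * (?C * q)"
      using exit_density_nonneg G0 q(1) p by (intro powr_le_of_split) auto
    hence "ennreal (exit_density x powr p) \<le> ennreal (?A * q)" by (intro ennreal_leI) (simp add: mult.assoc)
    thus ?thesis unfolding q(2) using A0 q(1) by (simp add: ennreal_mult)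
  qed
  have "(\<integral>\<^sup>+x. Q x \<partial>lborel) = (\<integral>\<^sup>+t. (\<integral>\<^sup>+x. ennreal (?\<rho> t) * ennreal (H t x) \<partial>lborel) \<partial>lborel)"
    unfolding Q_def by (rule lborel_pair.Fubini') measurable
  also have "\<dots> = (\<integral>\<^sup>+t. ennreal (?\<rho> t) * ennreal vol \<partial>lborel)"
  proof (rule nn_integral_cong)
    fix t :: real
    show "(\<integral>\<^sup>+x. ennreal (?\<rho> t) * ennreal (H t x) \<partial>lborel) = ennreal (?\<rho> t) * ennreal vol"
    proof (cases "t > 0")
      case True
      show ?thesis by (subst nn_integral_cmult) (auto simp: nn_integral_H[OF True])
    qed (simp add: pow_weight_def)
  qed
  also have "\<dots> < \<infinity>" by (simp add: nn_integral_multc \<rho>int ennreal_mult_less_top)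
  finally have Qint: "(\<integral>\<^sup>+x. Q x \<partial>lborel) < \<infinity>" .
  have Qm: "Q \<in> borel_measurable borel" unfolding Q_def[abs_def] by measurable
  have "(\<integral>\<^sup>+x. ennreal (exit_density x powr p) \<partial>lborel) \<le> (\<integral>\<^sup>+x. ennreal ?A * Q x \<partial>lborel)"
    by (intro nn_integral_mono point)
  also have "\<dots> < \<infinity>" using Qm Qint by (simp add: nn_integral_cmult ennreal_mult_less_top)
  finally show ?thesis by (intro integrableI_nonneg) auto
qed

text \<open>Symmetry of the potential, moved from the test function to \<mu>. Fubini is applied
  three times: y against t, then y against x at fixed time, where the Gaussian average becomes an
  integral of the heat kernel, then t against x. Each majorant rests on the boundedness of
  \<phi>.\<close>

lemma exit_average_bessel:
  assumes \<phi>: "\<phi> \<in> schwartz"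
  shows "complex_of_real (Gamma a) * (\<integral>y. complex_of_real (ind y) * bessel (- 2 * a) \<phi> (T y) \<partial>lborel) =
    (\<integral>x. complex_of_real (exit_density x) * \<phi> x \<partial>lborel)"
proof -
  note [measurable] = schwartz_borel[OF \<phi>]
  obtain S where S: "S > 0" "\<And>x. norm (\<phi> x) \<le> S" using schwartz_bounded[OF \<phi>] by metis
  let ?b = "\<lambda>y. complex_of_real (ind y)"
  let ?g = "\<lambda>t. gauss_mean (sqrt (2 * t)) \<phi>"
  have gm [measurable]: "(\<lambda>(y, t). ?g t (T y)) \<in> borel_measurable (borel \<Otimes>\<^sub>M borel)"
    unfolding gauss_mean_def by measurable
  have g_bound: "ennreal (norm (?g t x)) \<le> ennreal S" for t x
  proof -
    have "ennreal (norm (?g t x)) \<le> (\<integral>\<^sup>+z. ennreal (gauss_density z) * ennreal (norm (\<phi> (x + sqrt (2 * t) *\<^sub>R z))) \<partial>lborel)"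
      by (rule norm_gauss_mean_le[OF \<phi>])
    also have "\<dots> \<le> (\<integral>\<^sup>+z. ennreal (gauss_density (z::'a)) * ennreal S \<partial>lborel)"
      by (intro nn_integral_mono mult_left_mono ennreal_leI S) auto
    also have "\<dots> = ennreal S" by (simp add: nn_integral_multc nn_integral_gauss_density)
    finally show ?thesis .
  qed
  have Wint: "(\<integral>\<^sup>+t. ennreal (W t) \<partial>lborel) = ennreal (Gamma a)" by (rule nn_integral_pow_weight_exp[OF a_pos])
  let ?F = "\<lambda>y t. ?b y * (complex_of_real (W t) * ?g t (T y))"
  have intF: "integrable (lborel \<Otimes>\<^sub>M lborel) (\<lambda>(y, t). ?F y t)"
  proof (rule integrable_lborel_pairI)
    have "(\<integral>\<^sup>+y. (\<integral>\<^sup>+t. ennreal (norm (?F y t)) \<partial>lborel) \<partial>lborel) \<le>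
      (\<integral>\<^sup>+y. (\<integral>\<^sup>+t. ennreal (ind y) * (ennreal (W t) * ennreal S) \<partial>lborel) \<partial>lborel)"
    proof (intro nn_integral_mono)
      fix y t
      have "ennreal (norm (?F y t)) = ennreal (ind y) * (ennreal (W t) * ennreal (norm (?g t (T y))))"
        by (simp add: norm_mult ennreal_mult pow_weight_nonneg)
      thus "ennreal (norm (?F y t)) \<le> ennreal (ind y) * (ennreal (W t) * ennreal S)"
        using g_bound by (auto intro!: mult_left_mono)
    qed
    also have "\<dots> = ennreal vol * (ennreal (Gamma a) * ennreal S)"
      by (simp add: nn_integral_cmult nn_integral_multc Wint nn_integral_ind)
    also have "\<dots> < \<infinity>" by (simp add: ennreal_mult_less_top)
    finally show "(\<integral>\<^sup>+y. (\<integral>\<^sup>+t. ennreal (norm (?F y t)) \<partial>lborel) \<partial>lborel) < \<infinity>" .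
  qed measurable
  have B: "(\<integral>y. ?b y * ?g t (T y) \<partial>lborel) = (\<integral>x. \<phi> x * complex_of_real (H t x) \<partial>lborel)" if t: "t > 0" for t
  proof -
    let ?E = "\<lambda>y x. ?b y * (\<phi> x * complex_of_real (heat_kernel t (x - T y)))"
    have intE: "integrable (lborel \<Otimes>\<^sub>M lborel) (\<lambda>(y, x). ?E y x)"
    proof (rule integrable_lborel_pairI)
      have "(\<integral>\<^sup>+y. (\<integral>\<^sup>+x. ennreal (norm (?E y x)) \<partial>lborel) \<partial>lborel) \<le>
        (\<integral>\<^sup>+y. (\<integral>\<^sup>+x. ennreal (ind y) * (ennreal S * ennreal (heat_kernel t (x - T y))) \<partial>lborel) \<partial>lborel)"
      proof (intro nn_integral_mono)
        fix y x
        have "ennreal (norm (?E y x)) = ennreal (ind y) * (ennreal (norm (\<phi> x)) * ennreal (heat_kernel t (x - T y)))"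
          by (simp add: norm_mult ennreal_mult heat_kernel_nonneg)
        thus "ennreal (norm (?E y x)) \<le> ennreal (ind y) * (ennreal S * ennreal (heat_kernel t (x - T y)))"
          using S by (auto intro!: mult_left_mono mult_right_mono ennreal_leI)
      qed
      also have "\<dots> = ennreal vol * ennreal S"
        by (simp add: nn_integral_cmult nn_integral_multc nn_integral_heat_kernel[OF t] nn_integral_ind)
      also have "\<dots> < \<infinity>" by (simp add: ennreal_mult_less_top)
      finally show "(\<integral>\<^sup>+y. (\<integral>\<^sup>+x. ennreal (norm (?E y x)) \<partial>lborel) \<partial>lborel) < \<infinity>" .
    qed measurable
    have "(\<integral>y. ?b y * ?g t (T y) \<partial>lborel) = (\<integral>y. (\<integral>x. ?E y x \<partial>lborel) \<partial>lborel)"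
      by (simp add: gauss_mean_heat_kernel[OF t])
    also have "\<dots> = (\<integral>x. (\<integral>y. ?E y x \<partial>lborel) \<partial>lborel)"
      by (rule lborel_pair.Fubini_integral[symmetric, OF intE])
    also have "\<dots> = (\<integral>x. \<phi> x * complex_of_real (H t x) \<partial>lborel)"
    proof (intro Bochner_Integration.integral_cong refl)
      fix x
      have "(\<integral>y. ?E y x \<partial>lborel) = (\<integral>y. \<phi> x * complex_of_real (ind y * heat_kernel t (x - T y)) \<partial>lborel)"
        by (simp add: mult_ac)
      thus "(\<integral>y. ?E y x \<partial>lborel) = \<phi> x * complex_of_real (H t x)"
        unfolding H_def integral_complex_of_real[symmetric] by simp
    qed
    finally show ?thesis .
  qed
  let ?D = "\<lambda>t x. complex_of_real (W t) * (\<phi> x * complex_of_real (H t x))"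
  have intD: "integrable (lborel \<Otimes>\<^sub>M lborel) (\<lambda>(t, x). ?D t x)"
  proof (rule integrable_lborel_pairI)
    have "(\<integral>\<^sup>+t. (\<integral>\<^sup>+x. ennreal (norm (?D t x)) \<partial>lborel) \<partial>lborel) \<le>
      (\<integral>\<^sup>+t. ennreal (W t) * (ennreal S * ennreal vol) \<partial>lborel)"
    proof (rule nn_integral_mono)
      fix t :: real
      show "(\<integral>\<^sup>+x. ennreal (norm (?D t x)) \<partial>lborel) \<le> ennreal (W t) * (ennreal S * ennreal vol)"
      proof (cases "t > 0")
        case True
        have "(\<integral>\<^sup>+x. ennreal (norm (?D t x)) \<partial>lborel) \<le> (\<integral>\<^sup>+x. ennreal (W t) * (ennreal S * ennreal (H t x)) \<partial>lborel)"
        proof (rule nn_integral_mono)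
          fix x
          have "ennreal (norm (?D t x)) = ennreal (W t) * (ennreal (norm (\<phi> x)) * ennreal (H t x))"
            by (simp add: norm_mult ennreal_mult H_nonneg pow_weight_nonneg)
          thus "ennreal (norm (?D t x)) \<le> ennreal (W t) * (ennreal S * ennreal (H t x))"
            using S by (auto intro!: mult_left_mono mult_right_mono ennreal_leI)
        qed
        thus ?thesis by (simp add: nn_integral_cmult nn_integral_H[OF True])
      qed (simp add: pow_weight_def)
    qed
    also have "\<dots> < \<infinity>" by (simp add: nn_integral_multc Wint ennreal_mult_less_top)
    finally show "(\<integral>\<^sup>+t. (\<integral>\<^sup>+x. ennreal (norm (?D t x)) \<partial>lborel) \<partial>lborel) < \<infinity>" .
  qed measurable
  have "complex_of_real (Gamma a) * (\<integral>y. ?b y * bessel (- 2 * a) \<phi> (T y) \<partial>lborel) =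
    (\<integral>y. ?b y * (complex_of_real (Gamma a) * bessel (- 2 * a) \<phi> (T y)) \<partial>lborel)"
    by (subst Bochner_Integration.integral_mult_right_zero[symmetric]) (simp only: mult_ac)
  also have "\<dots> = (\<integral>y. (\<integral>t. ?F y t \<partial>lborel) \<partial>lborel)"
    unfolding bessel_negative_order(2)[OF \<phi> a_pos] by simp
  also have "\<dots> = (\<integral>t. (\<integral>y. ?F y t \<partial>lborel) \<partial>lborel)"
    by (rule lborel_pair.Fubini_integral[symmetric, OF intF])
  also have "\<dots> = (\<integral>t. (\<integral>x. ?D t x \<partial>lborel) \<partial>lborel)"
  proof (rule Bochner_Integration.integral_cong[OF refl])
    fix t :: real
    show "(\<integral>y. ?F y t \<partial>lborel) = (\<integral>x. ?D t x \<partial>lborel)"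
    proof (cases "t > 0")
      case True
      have "(\<integral>y. ?F y t \<partial>lborel) = (\<integral>y. complex_of_real (W t) * (?b y * ?g t (T y)) \<partial>lborel)"
        by (simp only: mult_ac)
      thus ?thesis by (simp only: Bochner_Integration.integral_mult_right_zero B[OF True])
    qed (simp add: pow_weight_def)
  qed
  also have "\<dots> = (\<integral>x. (\<integral>t. ?D t x \<partial>lborel) \<partial>lborel)"
    by (rule lborel_pair.Fubini_integral[symmetric, OF intD])
  also have "\<dots> = (\<integral>x. complex_of_real (exit_density x) * \<phi> x \<partial>lborel)"
  proof (intro Bochner_Integration.integral_cong refl)
    fix x
    have "(\<integral>t. ?D t x \<partial>lborel) = (\<integral>t. \<phi> x * complex_of_real (W t * H t x) \<partial>lborel)"
      by (simp add: mult_ac)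
    thus "(\<integral>t. ?D t x \<partial>lborel) = complex_of_real (exit_density x) * \<phi> x"
      unfolding exit_density_def integral_complex_of_real[symmetric] by (simp add: mult.commute)
  qed
  finally show ?thesis .
qed

section \<open>The distribution defined by the exit measure\<close>

definition exit_distribution :: "('a \<Rightarrow> complex) \<Rightarrow> complex" where
  "exit_distribution \<phi> = (\<integral>y. complex_of_real (ind y) * \<phi> (T y) \<partial>lborel)"

lemma exit_integrand_integrable:
  assumes "\<phi> \<in> schwartz"
  shows "integrable lborel (\<lambda>y. complex_of_real (ind y) * \<phi> (T y))"
proof -
  note [measurable] = schwartz_borel[OF assms]
  obtain S where S: "S > 0" "\<And>x. norm (\<phi> x) \<le> S" using schwartz_bounded[OF assms] by metis
  have i: "integrable lborel (\<lambda>y. S * ind y)"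
    using emeasure_lborel_ball_finite[of c r] by (intro integrable_mult_right integrable_real_indicator) auto
  show ?thesis
    by (rule Bochner_Integration.integrable_bound[OF i]) (use S in \<open>auto simp: norm_mult split: split_indicator\<close>)
qed

lemma exit_distribution_tempered: "tempered exit_distribution"
  unfolding tempered_def
proof (intro conjI ballI allI)
  fix f g :: "'a \<Rightarrow> complex" assume "f \<in> schwartz" "g \<in> schwartz"
  thus "exit_distribution (\<lambda>x. f x + g x) = exit_distribution f + exit_distribution g"
    by (simp add: exit_distribution_def distrib_left exit_integrand_integrable Bochner_Integration.integral_add)
next
  fix f :: "'a \<Rightarrow> complex" and k
  have "exit_distribution (\<lambda>x. k * f x) = (\<integral>y. k * (complex_of_real (ind y) * f (T y)) \<partial>lborel)"
    by (simp add: exit_distribution_def mult_ac)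
  thus "exit_distribution (\<lambda>x. k * f x) = k * exit_distribution f"
    by (simp add: exit_distribution_def)
next
  show "\<exists>C N. \<forall>f\<in>schwartz. norm (exit_distribution f) \<le> C * schwartz_seminorm N f"
  proof (intro exI ballI)
    fix f :: "'a \<Rightarrow> complex" assume f: "f \<in> schwartz"
    have i: "integrable lborel (\<lambda>y. ind y * schwartz_seminorm 0 f)"
      using emeasure_lborel_ball_finite[of c r] by (intro integrable_mult_left integrable_real_indicator) auto
    have "norm (exit_distribution f) \<le> (\<integral>y. ind y * schwartz_seminorm 0 f \<partial>lborel)"
      unfolding exit_distribution_def
      by (rule order_trans[OF integral_norm_bound integral_mono[OF integrable_norm[OF exit_integrand_integrable[OF f]] i]])
        (auto simp: norm_mult intro!: mult_left_mono schwartz_seminorm_zero[OF f])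
    thus "norm (exit_distribution f) \<le> vol * schwartz_seminorm 0 f" by simp
  qed
qed

lemma exit_distribution_Hsp: "in_Hsp (- 2 * a) p exit_distribution"
  unfolding in_Hsp_def
proof
  show "is_Lp_distribution p (bessel_potential (- 2 * a) exit_distribution)"
    unfolding is_Lp_distribution_def
  proof (intro exI conjI ballI)
    let ?g = "\<lambda>x. complex_of_real (inverse (Gamma a) * exit_density x)"
    have G: "Gamma a > 0" by (rule Gamma_real_pos[OF a_pos])
    have gm: "?g \<in> borel_measurable lborel" by measurable
    thus "?g \<in> borel_measurable lebesgue" by (rule measurable_completion)
    have "integrable lborel (\<lambda>x. inverse (Gamma a) powr p * exit_density x powr p)"
      by (intro integrable_mult_right exit_density_Lp)
    moreover have "norm (?g x) powr p = inverse (Gamma a) powr p * exit_density x powr p" for x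
    proof -
      have "norm (?g x) = inverse (Gamma a) * exit_density x"
        unfolding norm_of_real using G exit_density_nonneg[of x] by simp
      thus ?thesis by (simp only: powr_mult)
    qed
    ultimately have "integrable lborel (\<lambda>x. norm (?g x) powr p)" by simp
    thus "integrable lebesgue (\<lambda>x. norm (?g x) powr p)"
      by (subst integrable_completion) auto
    fix \<phi> :: "'a \<Rightarrow> complex" assume \<phi>: "\<phi> \<in> schwartz"
    note [measurable] = schwartz_borel[OF \<phi>]
    have "(\<integral>x. ?g x * \<phi> x \<partial>lebesgue) = (\<integral>x. ?g x * \<phi> x \<partial>lborel)"
      by (rule integral_completion) measurable
    also have "\<dots> = (\<integral>x. complex_of_real (inverse (Gamma a)) * (complex_of_real (exit_density x) * \<phi> x) \<partial>lborel)"
      by (simp only: of_real_mult mult.assoc)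
    also have "\<dots> = complex_of_real (inverse (Gamma a)) * (complex_of_real (Gamma a) * exit_distribution (bessel (- 2 * a) \<phi>))"
      by (simp only: Bochner_Integration.integral_mult_right_zero exit_average_bessel[OF \<phi>, symmetric] exit_distribution_def)
    also have "\<dots> = exit_distribution (bessel (- 2 * a) \<phi>)" using G by (simp flip: of_real_mult mult.assoc)
    finally show "bessel_potential (- 2 * a) exit_distribution \<phi> = (\<integral>x. ?g x * \<phi> x \<partial>lebesgue)"
      by (simp add: bessel_potential_eq)
  qed
qed (rule exit_distribution_tempered)

lemma exit_distribution_support:
  assumes "closed E" "\<And>y. y \<in> ball c r \<Longrightarrow> T y \<in> E"
  shows "dist_support exit_distribution \<subseteq> E"
proof -
  have "vanishes_on exit_distribution (- E)"
    unfolding vanishes_on_def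
  proof (intro ballI impI, elim conjE)
    fix \<phi> :: "'a \<Rightarrow> complex" assume "closure {x. \<phi> x \<noteq> 0} \<subseteq> - E"
    hence "ind y = 0 \<or> \<phi> (T y) = 0" for y
      using assms(2)[of y] closure_subset[of "{x. \<phi> x \<noteq> 0}"] by (cases "y \<in> ball c r") auto
    hence "complex_of_real (ind y) * \<phi> (T y) = 0" for y by (metis mult_eq_0_iff of_real_0)
    thus "exit_distribution \<phi> = 0" by (simp only: exit_distribution_def Bochner_Integration.integral_zero)
  qed
  thus ?thesis using assms(1) unfolding dist_support_def by blast
qed

text \<open>The image of the ball is bounded, so a bump on a larger ball has a positive lower bound
  on it. Integrating against a positive measure gives at least that bound times the volume of the
  ball.\<close>

lemma exit_distribution_nonzero:
  assumes "\<And>y. y \<in> ball c r \<Longrightarrow> norm (T y) \<le> R"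
  shows "\<exists>\<phi>\<in>schwartz. exit_distribution \<phi> \<noteq> 0"
proof
  let ?d = "\<bar>R\<bar> + 1"
  let ?f = "\<lambda>x::'a. flat 0 (?d\<^sup>2 - (norm x)\<^sup>2)"
  have "(\<lambda>x::'a. 1 * complex_of_real (?f x)) \<in> bump_span ?d" by (intro bump_span.mult symbols.const)
  thus S: "(\<lambda>x. complex_of_real (?f x)) \<in> schwartz" using bump_span_schwartz[of ?d "\<lambda>x. complex_of_real (?f x)"] by simp
  define m where "m = flat 0 (?d\<^sup>2 - R\<^sup>2)"
  have dR: "?d\<^sup>2 - R\<^sup>2 > 0" by (simp add: power2_eq_square algebra_simps add_pos_nonneg)
  have m: "m > 0" using dR by (simp add: m_def flat_def)
  have le: "m \<le> ?f (T y)" if y: "y \<in> ball c r" for y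
  proof -
    have "(norm (T y))\<^sup>2 \<le> R\<^sup>2" using assms[OF y] by (intro power_mono) auto
    hence "?d\<^sup>2 - R\<^sup>2 \<le> ?d\<^sup>2 - (norm (T y))\<^sup>2" by simp
    moreover from this have "?d\<^sup>2 - (norm (T y))\<^sup>2 > 0" using dR by linarith
    ultimately show ?thesis using dR by (simp add: m_def flat_def)
  qed
  have i1: "integrable lborel (\<lambda>y. ind y * ?f (T y))"
    using integrable_Re[OF exit_integrand_integrable[OF S]] by simp
  have i2: "integrable lborel (\<lambda>y. m * ind y)"
    using emeasure_lborel_ball_finite[of c r] by (intro integrable_mult_right integrable_real_indicator) auto
  have "0 < m * vol" using m r by (simp add: content_ball_pos)
  also have "\<dots> = (\<integral>y. m * ind y \<partial>lborel)" by simp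
  also have "\<dots> \<le> (\<integral>y. ind y * ?f (T y) \<partial>lborel)"
    by (rule integral_mono[OF i2 i1]) (use le in \<open>auto split: split_indicator\<close>)
  finally have "(\<integral>y. ind y * ?f (T y) \<partial>lborel) \<noteq> 0" by simp
  moreover have "exit_distribution (\<lambda>x. complex_of_real (?f x)) = complex_of_real (\<integral>y. ind y * ?f (T y) \<partial>lborel)"
    unfolding exit_distribution_def integral_complex_of_real[symmetric] by simp
  ultimately show "exit_distribution (\<lambda>x. complex_of_real (?f x)) \<noteq> 0" by simp
qed

end

theorem frontier_not_sp_null:
  fixes \<Omega> :: "'a::euclidean_space set"
  assumes p: "1 < p" and \<Omega>: "open \<Omega>" "\<Omega> \<noteq> {}" and ext: "interior (- \<Omega>) \<noteq> {}"
    and s: "s < - 1 / conj_exp p"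
  shows "\<not> sp_null s p (frontier \<Omega>)"
proof -
  obtain c r1 where c: "r1 > 0" "ball c r1 \<subseteq> \<Omega>" using \<Omega> open_contains_ball by blast
  obtain b r2 where b: "r2 > 0" "ball b r2 \<subseteq> - \<Omega>" using ext by (meson ex_in_conv mem_interior)
  \<comment> \<open>With equal radii the translation by b - c takes one ball into the other, so
    every segment of length \<open>L\<close> starting in \<open>ball c r\<close> ends outside
    \<Omega>.\<close>
  define r where "r = min r1 r2"
  have r: "r > 0" "ball c r \<subseteq> \<Omega>" "ball b r \<subseteq> - \<Omega>"
    using c b subset_ball[of r r1 c] subset_ball[of r r2 b] by (auto simp: r_def)
  have cb: "c \<noteq> b" using r centre_in_ball by blast
  define L where "L = norm (b - c)"
  define e where "e = (b - c) /\<^sub>R L"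
  have L: "L > 0" using cb by (simp add: L_def)
  have e: "norm e = 1" "L *\<^sub>R e = b - c" using L by (auto simp: e_def L_def)
  have exit: "y + L *\<^sub>R e \<notin> \<Omega>" if "y \<in> ball c r" for y
  proof -
    have "y + L *\<^sub>R e \<in> ball b r" using that by (simp add: e(2) dist_norm algebra_simps)
    thus ?thesis using r(3) by blast
  qed
  obtain T :: "'a \<Rightarrow> 'a" where exitT: "T \<in> borel_measurable borel" "\<And>y. \<exists>k. T y = y + k *\<^sub>R e"
    "\<And>y. norm (T y - y) \<le> L" "\<And>y. y \<in> ball c r \<Longrightarrow> T y \<in> frontier \<Omega>"
    by (rule first_exit_exists[OF \<Omega>(1) e(1) r(2) exit less_imp_le[OF L]]) blast+
  define a where "a = - s / 2"
  have "1 / conj_exp p = 1 - 1 / p" using p by (simp add: conj_exp_def field_simps)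
  hence "(1 - 1 / p) / 2 < a" using s by (simp add: a_def)
  then interpret exit_measure T c e r p a
    by unfold_locales (use r e exitT p in auto)
  have sa: "s = - 2 * a" by (simp add: a_def)
  have bound: "norm (T y) \<le> norm c + r + L" if "y \<in> ball c r" for y
  proof -
    have "norm (T y) \<le> norm (T y - y) + norm (y - c) + norm c"
      using norm_triangle_ineq[of "T y - y" y] norm_triangle_ineq[of "y - c" c] by simp
    moreover have "norm (y - c) \<le> r" using that by (simp add: dist_norm norm_minus_commute)
    ultimately show ?thesis using exitT(3)[of y] by linarith
  qed
  show ?thesis
  proof
    assume "sp_null s p (frontier \<Omega>)"
    moreover have "dist_support exit_distribution \<subseteq> frontier \<Omega>"
      by (rule exit_distribution_support[OF frontier_closed exitT(4)])
    ultimately have "\<forall>\<phi>\<in>schwartz. exit_distribution \<phi> = 0"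
      using exit_distribution_Hsp unfolding sp_null_def sa by blast
    thus False using exit_distribution_nonzero[OF bound] by blast
  qed
qed

theorem theorem2p18:
  fixes p :: real and \<Omega> :: "'a::euclidean_space set"
  assumes "1 < p" and "open \<Omega>" and "\<Omega> \<noteq> {}"
  shows "(\<forall>s. interior (- \<Omega>) \<noteq> {} \<and> s < - 1 / conj_exp p \<longrightarrow> \<not> sp_null s p (frontier \<Omega>))
       \<and> (C0_domain \<Omega> \<and> \<Omega> \<noteq> UNIV \<longrightarrow> interior (- \<Omega>) \<noteq> {})
       \<and> (\<forall>s. C0_domain \<Omega> \<and> 0 \<le> s \<longrightarrow> sp_null s p (frontier \<Omega>))
       \<and> (\<forall>\<alpha> s. 0 < \<alpha> \<and> \<alpha> < 1 \<and> C0alpha_domain \<alpha> \<Omega> \<and> - \<alpha> / conj_exp p < s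
                \<longrightarrow> sp_null s p (frontier \<Omega>))
       \<and> (lipschitz_domain \<Omega> \<and> \<Omega> \<noteq> UNIV \<longrightarrow>
             (\<forall>s. sp_null s p (frontier \<Omega>) \<longleftrightarrow> - 1 / conj_exp p \<le> s))"
proof (intro conjI allI impI; (elim conjE)?)
  show not_null: "\<not> sp_null s p (frontier \<Omega>)" if "interior (- \<Omega>) \<noteq> {}" "s < - 1 / conj_exp p" for s
    using frontier_not_sp_null[OF assms that] .
  show ext: "interior (- \<Omega>) \<noteq> {}" if "C0_domain \<Omega>" "\<Omega> \<noteq> UNIV"
    using C0_domain_exterior[OF that] .
  show "sp_null s p (frontier \<Omega>)" if "C0_domain \<Omega>" "0 \<le> s" for s
    using C0_frontier_sp_null[OF assms(1) that] .
  show "sp_null s p (frontier \<Omega>)" if "0 < \<alpha>" "\<alpha> < 1" "C0alpha_domain \<alpha> \<Omega>" "- \<alpha> / conj_exp p < s" for \<alpha> s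
    using holder_frontier_sp_null[OF assms(1), of \<alpha> \<Omega> s] that by (simp add: C0alpha_domain_def)
  show "sp_null s p (frontier \<Omega>) \<longleftrightarrow> - 1 / conj_exp p \<le> s" if "lipschitz_domain \<Omega>" "\<Omega> \<noteq> UNIV" for s
  proof
    have lip: "graph_domain (holder_on 1) \<Omega>" using that(1) by (simp add: lipschitz_domain_def)
    show "sp_null s p (frontier \<Omega>)" if "- 1 / conj_exp p \<le> s"
      using holder_frontier_sp_null[OF assms(1) lip _ _ that] by simp
    \<comment> \<open>A Lipschitz domain other than the whole space has exterior points, so nullity
      fails below the critical order.\<close>
    have "C0_domain \<Omega>" using holder_domain_C0[OF lip] by simp
    thus "- 1 / conj_exp p \<le> s" if "sp_null s p (frontier \<Omega>)"
      using not_null[OF ext[OF _ \<open>\<Omega> \<noteq> UNIV\<close>]] that by (meson not_le)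
  qed
qed

end
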